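(* Let $X_1,X_2$ be complex Banach spaces and let $\mathcal{A}_1\subseteq\mathcal{B}(X_1)$, $\mathcal{A}_2\subseteq\mathcal{B}(X_2)$ be standard operator algebras. Fix an integer $k\geq 2$ and a finite sequence $(i_1,\ldots,i_m)$ with $\{i_1,\ldots,i_m\}=\{1,\ldots,k\}$ such that some term $i_p$ satisfies $i_p\neq i_q$ for all $q\neq p$, and let $T_1*\cdots*T_k=T_{i_1}T_{i_2}\cdots T_{i_m}$ be the associated generalized product of width $m$. Let $\Phi:\mathcal{A}_1\to\mathcal{A}_2$ be a map (no linearity or additivity assumed) whose range contains every operator in $\mathcal{B}(X_2)$ of rank at most two. Then $$\sigma_\pi(\Phi(A_1)*\cdots*\Phi(A_k))=\sigma_\pi(A_1*\cdots*A_k)\quad\text{for all }A_1,\ldots,A_k\in\mathcal{A}_1$$ holds if and only if one of the following holds: (1) there exist $\lambda\in\mathbb{C}$ with $\lambda^m=1$ and an invertible operator $T\in\mathcal{B}(X_1,X_2)$ such that $\Phi(A)=\lambda TAT^{-1}$ for all $A\in\mathcal{A}_1$; (2) $X_1$ and $X_2$ are reflexive, the generalized product is a generalized quasi-semi Jordan product, and there exist $\lambda\in\mathbb{C}$ with $\lambda^m=1$ and an invertible operator $T\in\mathcal{B}(X_1^*,X_2)$ such that $\Phi(A)=\lambda TA^*T^{-1}$ for all $A\in\mathcal{A}_1$ (here $A^*\in\mathcal{B}(X_1^* )$ is the Banach-space adjoint).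
   Context: A standard operator algebra on a complex Banach space $X$ is a subalgebra of $\mathcal{B}(X)$ (the algebra of bounded linear operators on $X$) containing all finite rank operators; it is not assumed to be closed or to contain the identity. For $T\in\mathcal{B}(X)$, $\sigma(T)$ is the spectrum, $r(T)$ the spectral radius, and the peripheral spectrum is $\sigma_\pi(T)=\{z\in\sigma(T):|z|=r(T)\}$. The generalized product $T_1*\cdots*T_k=T_{i_1}\cdots T_{i_m}$ is called a generalized quasi-semi Jordan product if, with $p$ the position of the term appearing exactly once, $$(i_{p+1},i_{p+2},\ldots,i_m,i_1,i_2,\ldots,i_{p-1})=(i_{p-1},i_{p-2},\ldots,i_1,i_m,i_{m-1},\ldots,i_{p+1}).$$ *)

theory Defs
  imports "HOL-Analysis.Analysis"
begin

class complex_banach = banach +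
  fixes scaleC :: "complex \<Rightarrow> 'a \<Rightarrow> 'a"
  assumes scaleC_add_right: "scaleC a (x + y) = scaleC a x + scaleC a y"
    and scaleC_add_left: "scaleC (a + b) x = scaleC a x + scaleC b x"
    and scaleC_scaleC: "scaleC a (scaleC b x) = scaleC (a * b) x"
    and scaleC_one: "scaleC 1 x = x"
    and scaleR_scaleC: "scaleR r x = scaleC (complex_of_real r) x"
    and norm_scaleC: "norm (scaleC a x) = cmod a * norm x"

instantiation complex :: complex_banach
begin
definition scaleC_complex :: "complex \<Rightarrow> complex \<Rightarrow> complex" where
  "scaleC_complex a x = a * x"
instance
  by standard (auto simp: scaleC_complex_def algebra_simps norm_mult scaleR_conv_of_real)
end

definition cblin :: "('a::complex_banach \<Rightarrow> 'b::complex_banach) \<Rightarrow> bool" where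
  "cblin f \<longleftrightarrow> bounded_linear f \<and> (\<forall>c x. f (scaleC c x) = scaleC c (f x))"

abbreviation Bop :: "('a::complex_banach \<Rightarrow> 'b::complex_banach) set" where
  "Bop \<equiv> {f. cblin f}"

abbreviation cspan :: "'a::complex_banach set \<Rightarrow> 'a set" where
  "cspan \<equiv> module.span scaleC"

definition finite_rank :: "('a::complex_banach \<Rightarrow> 'b::complex_banach) \<Rightarrow> bool" where
  "finite_rank f \<longleftrightarrow> (\<exists>B. finite B \<and> range f \<subseteq> cspan B)"

definition rank_le :: "('a::complex_banach \<Rightarrow> 'b::complex_banach) \<Rightarrow> nat \<Rightarrow> bool" where
  "rank_le f n \<longleftrightarrow> (\<exists>B. finite B \<and> card B \<le> n \<and> range f \<subseteq> cspan B)"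

definition standard_operator_algebra :: "('a::complex_banach \<Rightarrow> 'a) set \<Rightarrow> bool" where
  "standard_operator_algebra \<A> \<longleftrightarrow>
     \<A> \<subseteq> Bop \<and>
     {f \<in> Bop. finite_rank f} \<subseteq> \<A> \<and>
     (\<forall>S\<in>\<A>. \<forall>T\<in>\<A>. (\<lambda>x. S x + T x) \<in> \<A>) \<and>
     (\<forall>c. \<forall>T\<in>\<A>. (\<lambda>x. scaleC c (T x)) \<in> \<A>) \<and>
     (\<forall>S\<in>\<A>. \<forall>T\<in>\<A>. S \<circ> T \<in> \<A>)"

definition invertible_op :: "('a::complex_banach \<Rightarrow> 'a) \<Rightarrow> bool" where
  "invertible_op T \<longleftrightarrow> (\<exists>S\<in>Bop. S \<circ> T = id \<and> T \<circ> S = id)"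

definition spectrum_op :: "('a::complex_banach \<Rightarrow> 'a) \<Rightarrow> complex set" where
  "spectrum_op T = {z. \<not> invertible_op (\<lambda>x. T x - scaleC z x)}"

definition spectral_radius_op :: "('a::complex_banach \<Rightarrow> 'a) \<Rightarrow> real" where
  "spectral_radius_op T = Sup (cmod ` spectrum_op T)"

definition peripheral_spectrum :: "('a::complex_banach \<Rightarrow> 'a) \<Rightarrow> complex set" where
  "peripheral_spectrum T = {z \<in> spectrum_op T. cmod z = spectral_radius_op T}"

text \<open>X^* is the set of bounded complex-linear functionals, normed by the operator norm.\<close>
abbreviation dual_space :: "('a::complex_banach \<Rightarrow> complex) set" where
  "dual_space \<equiv> {f. cblin f}"

definition cblin_from_dual :: "(('a::complex_banach \<Rightarrow> complex) \<Rightarrow> 'b::complex_banach) \<Rightarrow> bool" where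
  "cblin_from_dual T \<longleftrightarrow>
     (\<forall>f\<in>dual_space. \<forall>g\<in>dual_space. T (\<lambda>x. f x + g x) = T f + T g) \<and>
     (\<forall>c. \<forall>f\<in>dual_space. T (\<lambda>x. c * f x) = scaleC c (T f)) \<and>
     (\<exists>K. \<forall>f\<in>dual_space. norm (T f) \<le> K * onorm f)"

definition cblin_to_dual :: "('b::complex_banach \<Rightarrow> ('a::complex_banach \<Rightarrow> complex)) \<Rightarrow> bool" where
  "cblin_to_dual S \<longleftrightarrow>
     (\<forall>y. S y \<in> dual_space) \<and>
     (\<forall>y z. S (y + z) = (\<lambda>x. S y x + S z x)) \<and>
     (\<forall>c y. S (scaleC c y) = (\<lambda>x. c * S y x)) \<and>
     (\<exists>K. \<forall>y. onorm (S y) \<le> K * norm y)"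

definition adjoint_op :: "('a::complex_banach \<Rightarrow> 'a) \<Rightarrow> ('a \<Rightarrow> complex) \<Rightarrow> ('a \<Rightarrow> complex)" where
  "adjoint_op A f = f \<circ> A"

definition reflexive_space :: "'a::complex_banach itself \<Rightarrow> bool" where
  "reflexive_space _ \<longleftrightarrow>
     (\<forall>\<phi> :: ('a \<Rightarrow> complex) \<Rightarrow> complex.
        (\<forall>f\<in>dual_space. \<forall>g\<in>dual_space. \<phi> (\<lambda>x. f x + g x) = \<phi> f + \<phi> g) \<and>
        (\<forall>c. \<forall>f\<in>dual_space. \<phi> (\<lambda>x. c * f x) = c * \<phi> f) \<and>
        (\<exists>K. \<forall>f\<in>dual_space. cmod (\<phi> f) \<le> K * onorm f)
        \<longrightarrow> (\<exists>x. \<forall>f\<in>dual_space. \<phi> f = f x))"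

text \<open>Index sequence (i_1,...,i_m) is the list idx (0-based positions).
  T_1 * ... * T_k = T_{i_1} \<circ> ... \<circ> T_{i_m}.\<close>
definition gen_prod :: "nat list \<Rightarrow> (nat \<Rightarrow> ('a \<Rightarrow> 'a)) \<Rightarrow> ('a \<Rightarrow> 'a)" where
  "gen_prod idx T = foldr (\<circ>) (map T idx) id"

definition unique_pos :: "nat list \<Rightarrow> nat \<Rightarrow> bool" where
  "unique_pos idx p \<longleftrightarrow> p < length idx \<and> (\<forall>q<length idx. q \<noteq> p \<longrightarrow> idx ! q \<noteq> idx ! p)"

definition gen_prod_index :: "nat \<Rightarrow> nat list \<Rightarrow> bool" where
  "gen_prod_index k idx \<longleftrightarrow> set idx = {1..k} \<and> (\<exists>p. unique_pos idx p)"

definition quasi_semi_jordan :: "nat list \<Rightarrow> bool" where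
  "quasi_semi_jordan idx \<longleftrightarrow>
     (\<exists>p. unique_pos idx p \<and>
        drop (Suc p) idx @ take p idx = rev (drop (Suc p) idx @ take p idx))"

end

theory Submission
  imports Defs "HOL-Complex_Analysis.Complex_Analysis"
begin

text \<open>Let \<open>p\<close> be the position of the index occurring once and \<open>n = m - 1\<close>. Putting \<open>S\<close> at \<open>p\<close> and \<open>B\<close>
  elsewhere gives, since peripheral spectra of \<open>ST\<close> and \<open>TS\<close> agree,
  \<open>\<sigma>\<^sub>\<pi>(\<Phi>(S) \<Phi>(B)\<^sup>n) = \<sigma>\<^sub>\<pi>(S B\<^sup>n)\<close>. If \<open>\<Phi>(B)\<close> is a non-nilpotent rank-one operator, the left side is a
  singleton for all \<open>S\<close>, and so is the peripheral spectrum with the roles exchanged; test operators of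
  rank two then force \<open>B\<close> to have rank one. The resulting trace identity
  \<open>tr(\<Phi>(S) \<Phi>(B)) tr(\<Phi>(B))\<^sup>n\<^sup>-\<^sup>1 = tr(S B) tr(B)\<^sup>n\<^sup>-\<^sup>1\<close> makes \<open>\<Phi>\<close> linear, and evaluating it on the families
  \<open>x \<otimes> f\<^sub>0\<close> and \<open>x\<^sub>0 \<otimes> f\<close> shows that \<open>\<Phi>(x \<otimes> f) = \<lambda> T x \<otimes> S f\<close> or \<open>\<lambda> T f \<otimes> S x\<close> where the pairing of \<open>T\<close>
  with \<open>S\<close> reproduces that of \<open>x\<close> with \<open>f\<close>. Uniform boundedness makes \<open>T\<close> an isomorphism, the second case forces
  reflexivity, and words in operators \<open>t \<mapsto> 2 t + b\<close> show that, in dimension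
  at least two, it occurs only for palindromic index sequences.\<close>

text \<open>The rank-one argument reaches \<open>x \<otimes> f\<close> only when
  \<open>f x \<noteq> 0\<close>, since it needs a nonzero peripheral value. Most later identities
  are therefore proved where some pairing is nonzero and carried to the remaining hyperplane by
  adding a base vector.

  The test operators of rank two are built to have the eigenvalues \<open>\<mu>\<close> and
  \<open>- \<mu>\<close>: having equal modulus, both survive in the peripheral spectrum, so a
  singleton is contradicted. The hypothesis on the range places such operators among the values of
  \<open>\<Phi>\<close>.

  The scalar \<open>\<lambda>\<close> appears because \<open>f\<^sub>0 x\<^sub>0 = 1\<close> and
  \<open>\<Phi>(x\<^sub>0 \<otimes> f\<^sub>0) = y \<otimes> g\<close> only give
  \<open>g(y)\<^sup>m = 1\<close>; dividing \<open>\<Phi>\<close> by \<open>g y\<close> normalizes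
  the base point. As no continuity of \<open>\<Phi>\<close> is assumed, that of \<open>T\<close> and
  its inverse has to be recovered from the pairing.

  Small spaces behave differently. On the zero space all spectra are empty, and in dimension one the
  adjoint form says nothing about the index sequence but is also a similarity form.\<close>

interpretation scaleC: vector_space "scaleC :: complex \<Rightarrow> 'a \<Rightarrow> 'a::complex_banach"
  by standard (simp_all add: scaleC_add_right scaleC_add_left scaleC_scaleC scaleC_one)

declare scaleC_scaleC [simp] scaleC_one [simp] norm_scaleC [simp]

section \<open>Bounded complex-linear maps\<close>

lemma scaleC_complex [simp]: "scaleC a (x::complex) = a * x"
  by (simp add: scaleC_complex_def)

lemma cblinI:
  assumes "\<And>x y. f (x + y) = f x + f y" "\<And>c x. f (scaleC c x) = scaleC c (f x)"
    "\<And>x. norm (f x) \<le> K * norm x"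
  shows "cblin f"
  unfolding cblin_def
  using assms by (auto intro!: bounded_linear_intro[where K = K] simp: scaleR_scaleC mult.commute)

lemma
  assumes "cblin f"
  shows cblin_add: "f (x + y) = f x + f y"
    and cblin_diff: "f (x - y) = f x - f y"
    and cblin_zero: "f 0 = 0"
    and cblin_scaleC: "f (scaleC c x) = scaleC c (f x)"
    and cblin_bounded_linear: "bounded_linear f"
  using assms
  by (auto simp: cblin_def linear_simps)

lemma cblin_bound: "cblin f \<Longrightarrow> norm (f x) \<le> onorm f * norm x"
  by (simp add: cblin_def onorm)

lemma cblin_onorm_nonneg: "cblin f \<Longrightarrow> 0 \<le> onorm f"
  by (simp add: cblin_def onorm_pos_le)

lemma cblin_compose: "cblin f \<Longrightarrow> cblin g \<Longrightarrow> cblin (\<lambda>x. f (g x))"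
  by (simp add: cblin_def bounded_linear_compose)

lemma cblin_comp: "cblin f \<Longrightarrow> cblin g \<Longrightarrow> cblin (f \<circ> g)"
  by (simp add: comp_def cblin_compose)

lemma cblin_ident [simp]: "cblin (\<lambda>x. x)" and cblin_id [simp]: "cblin id"
  by (simp_all add: cblin_def bounded_linear_ident id_def)

lemma cblin_const_zero [simp]: "cblin (\<lambda>x. 0)"
  by (simp add: cblin_def bounded_linear_zero)

lemma cblin_plus: "cblin f \<Longrightarrow> cblin g \<Longrightarrow> cblin (\<lambda>x. f x + g x)"
  by (simp add: cblin_def bounded_linear_add scaleC_add_right)

lemma cblin_minusfun: "cblin f \<Longrightarrow> cblin g \<Longrightarrow> cblin (\<lambda>x. f x - g x)"
  by (simp add: cblin_def bounded_linear_sub scaleC.scale_right_diff_distrib)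

lemma cblin_scaleC_left:
  assumes "cblin f"
  shows "cblin (\<lambda>x. scaleC (f x) y)"
proof (rule cblinI[where K = "onorm f * norm y"])
  show "norm (scaleC (f x) y) \<le> onorm f * norm y * norm x" for x
    using mult_right_mono[OF cblin_bound[OF assms, of x] norm_ge_zero[of y]] by (simp add: mult_ac)
qed (simp_all add: assms cblin_add cblin_scaleC scaleC_add_left)

lemma cblin_scaleC_right:
  assumes "cblin f"
  shows "cblin (\<lambda>x. scaleC c (f x))"
proof (rule cblinI[where K = "cmod c * onorm f"])
  show "norm (scaleC c (f x)) \<le> cmod c * onorm f * norm x" for x
    using mult_left_mono[OF cblin_bound[OF assms, of x] norm_ge_zero[of c]] by (simp add: mult_ac)
qed (simp_all add: assms cblin_add cblin_scaleC scaleC_add_right mult.commute)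

lemma cblin_cmult: "cblin f \<Longrightarrow> cblin (\<lambda>x. c * f x :: complex)"
  using cblin_scaleC_right[of f c] by simp

lemma cblin_uminus: "cblin f \<Longrightarrow> cblin (\<lambda>x. - f x)"
  using cblin_scaleC_right[of f "-1"] by simp

lemma cblin_funpow: "cblin f \<Longrightarrow> cblin (f ^^ n)" for f :: "'a::complex_banach \<Rightarrow> 'a"
  by (induction n) (simp_all add: cblin_comp)

section \<open>The Hahn--Banach theorem and its consequences\<close>

definition sublin :: "('a::real_vector \<Rightarrow> real) \<Rightarrow> bool" where
  "sublin q \<longleftrightarrow> (\<forall>x y. q (x + y) \<le> q x + q y) \<and> (\<forall>t>0. \<forall>x. q (t *\<^sub>R x) \<le> t * q x)"

text \<open>Applying the inequality to \<open>1 / t\<close> yields the reverse one, so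
  \<open>sublin\<close> can demand a single direction.\<close>

lemma sublin_scale:
  assumes "sublin q" "t > 0"
  shows "q (t *\<^sub>R x) = t * q x"
proof (rule antisym)
  show "q (t *\<^sub>R x) \<le> t * q x"
    using assms by (auto simp: sublin_def)
  have "q ((1/t) *\<^sub>R (t *\<^sub>R x)) \<le> (1/t) * q (t *\<^sub>R x)"
    using assms unfolding sublin_def by (metis zero_less_divide_1_iff)
  then show "t * q x \<le> q (t *\<^sub>R x)"
    using assms by (simp add: field_simps)
qed

lemma sublin_zero: "sublin q \<Longrightarrow> q 0 = 0"
  using sublin_scale[of q 2 0] by simp

lemma sublin_neg: "sublin q \<Longrightarrow> - q (- x) \<le> q x"
proof -
  assume q: "sublin q"
  then have "q (x + - x) \<le> q x + q (- x)" unfolding sublin_def by blast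
  then show ?thesis using sublin_zero[OF q] by simp
qed

text \<open>The infimum along the ray in direction \<open>v\<close> pushes the functional down at
  \<open>- v\<close>: the last bound at \<open>x = - v\<close> reads
  \<open>p (- v) \<le> - q v\<close>. It is finite because its terms stay above
  \<open>- q (- x)\<close>. The construction serves twice: to force additivity of a minimal
  functional, and to prescribe the value at a supported vector.\<close>

lemma sublin_shift:
  fixes q :: "'a::real_vector \<Rightarrow> real"
  assumes q: "sublin q"
  obtains p where "sublin p" "\<And>x. p x \<le> q x" "\<And>x. p x \<le> q (x + v) - q v"
proof -
  let ?F = "\<lambda>x t. q (x + t *\<^sub>R v) - t * q v"
  define p where "p x = (INF t\<in>{0..}. ?F x t)" for x
  have tv: "q (t *\<^sub>R v) = t * q v" if "t \<ge> 0" for t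
    using that q by (cases "t = 0") (auto simp: sublin_zero sublin_scale)
  have lb: "- q (- x) \<le> ?F x t" if "t \<ge> 0" for x t
  proof -
    have "q ((x + t *\<^sub>R v) + - x) \<le> q (x + t *\<^sub>R v) + q (- x)"
      using q unfolding sublin_def by blast
    then show ?thesis using tv[OF that] by simp
  qed
  have bdd: "bdd_below (?F x ` {0..})" for x
    using lb[of _ x] by (auto intro!: bdd_belowI2[where m = "- q (- x)"])
  have le: "p x \<le> ?F x t" if "t \<ge> 0" for x t
    unfolding p_def using that by (intro cINF_lower bdd) auto
  have ge: "c \<le> p x" if "\<And>t. t \<ge> 0 \<Longrightarrow> c \<le> ?F x t" for c x
    unfolding p_def using that by (intro cINF_greatest) auto
  have "sublin p"
    unfolding sublin_def
  proof (intro conjI allI impI)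
    fix x y
    have *: "p (x + y) \<le> ?F x s + ?F y t" if "s \<ge> 0" "t \<ge> 0" for s t
    proof -
      have "p (x + y) \<le> ?F (x + y) (s + t)"
        using that by (intro le) auto
      also have "x + y + (s + t) *\<^sub>R v = (x + s *\<^sub>R v) + (y + t *\<^sub>R v)"
        by (simp add: algebra_simps)
      also have "q ((x + s *\<^sub>R v) + (y + t *\<^sub>R v)) \<le> q (x + s *\<^sub>R v) + q (y + t *\<^sub>R v)"
        using q by (auto simp: sublin_def)
      finally show ?thesis by (simp add: algebra_simps)
    qed
    have "p (x + y) - ?F x s \<le> p y" if "s \<ge> 0" for s
      using *[OF that] by (intro ge) (simp add: algebra_simps)
    then have "p (x + y) - p y \<le> p x"
      by (intro ge) (simp add: algebra_simps)
    then show "p (x + y) \<le> p x + p y" by simp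
  next
    fix t :: real and x assume t: "t > 0"
    have "p (t *\<^sub>R x) / t \<le> p x"
    proof (rule ge)
      fix s :: real assume "s \<ge> 0"
      have "p (t *\<^sub>R x) \<le> ?F (t *\<^sub>R x) (t * s)"
        using \<open>s \<ge> 0\<close> t by (intro le) auto
      also have "t *\<^sub>R x + (t * s) *\<^sub>R v = t *\<^sub>R (x + s *\<^sub>R v)"
        by (simp add: algebra_simps)
      also have "q (t *\<^sub>R (x + s *\<^sub>R v)) = t * q (x + s *\<^sub>R v)"
        by (rule sublin_scale[OF q t])
      finally show "p (t *\<^sub>R x) / t \<le> ?F x s"
        using t by (simp add: field_simps)
    qed
    then show "p (t *\<^sub>R x) \<le> t * p x"
      using t by (simp add: field_simps)
  qed
  moreover have "p x \<le> q x" for x using le[of 0 x] by simp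
  moreover have "p x \<le> q (x + v) - q v" for x using le[of 1 x] by simp
  ultimately show ?thesis using that by blast
qed

text \<open>Subadditivity has to compare \<open>a x\<close> and \<open>b y\<close> for different
  members \<open>a\<close>, \<open>b\<close>; in a chain the smaller of the two is subadditive and
  lies below both. All members stay above \<open>- q0 (- x)\<close>, so the infimum is
  finite.\<close>

lemma sublin_chain_Inf:
  fixes C :: "('a::real_vector \<Rightarrow> real) set"
  assumes "C \<noteq> {}" "\<And>q. q \<in> C \<Longrightarrow> sublin q \<and> (\<forall>x. q x \<le> q0 x)"
    and ch: "\<And>a b. a \<in> C \<Longrightarrow> b \<in> C \<Longrightarrow> (\<forall>x. a x \<le> b x) \<or> (\<forall>x. b x \<le> a x)"
  obtains p where "sublin p" "\<And>q x. q \<in> C \<Longrightarrow> p x \<le> q x"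
proof -
  define p where "p x = (INF q\<in>C. q x)" for x
  have bdd: "bdd_below ((\<lambda>q. q x) ` C)" for x
  proof (rule bdd_belowI2)
    fix q assume "q \<in> C"
    then show "- q0 (- x) \<le> q x"
      using assms(2)[of q] sublin_neg[of q x] by (smt (verit))
  qed
  have le: "p x \<le> q x" if "q \<in> C" for x q
    unfolding p_def using that by (intro cINF_lower bdd) auto
  have ge: "c \<le> p x" if "\<And>q. q \<in> C \<Longrightarrow> c \<le> q x" for c x
    unfolding p_def using that assms(1) by (intro cINF_greatest) auto
  have "sublin p"
    unfolding sublin_def
  proof (intro conjI allI impI)
    fix x y
    have *: "p (x + y) \<le> a x + b y" if "a \<in> C" "b \<in> C" for a b
      using ch[OF that] le[of _ "x + y"] assms(2)[OF that(1)] assms(2)[OF that(2)] that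
      unfolding sublin_def by (smt (verit))
    have "p (x + y) - a x \<le> p y" if "a \<in> C" for a
      using *[OF that] by (intro ge) (simp add: algebra_simps)
    then have "p (x + y) - p y \<le> p x"
      by (intro ge) (simp add: algebra_simps)
    then show "p (x + y) \<le> p x + p y" by simp
  next
    fix t :: real and x assume t: "t > 0"
    have "p (t *\<^sub>R x) / t \<le> p x"
    proof (rule ge)
      fix q assume "q \<in> C"
      then show "p (t *\<^sub>R x) / t \<le> q x"
        using le[of q "t *\<^sub>R x"] assms(2) sublin_scale[of q t x] t by (simp add: field_simps)
    qed
    then show "p (t *\<^sub>R x) \<le> t * p x"
      using t by (simp add: field_simps)
  qed
  then show ?thesis using that le by blast
qed

text \<open>A minimal sublinear functional below a given one is linear: minimality forces it to
  agree with the smaller functional supplied by \<open>sublin_shift\<close>.\<close>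

lemma linear_below_sublin:
  fixes q0 :: "'a::real_vector \<Rightarrow> real"
  assumes q0: "sublin q0"
  obtains u where "linear u" "\<And>x. u x \<le> q0 x"
proof -
  define A where "A = {q. sublin q \<and> (\<forall>x. q x \<le> q0 x)}"
  \<comment> \<open>The order is reversed, so the maximal element given by Zorn's lemma is a minimal
    functional.\<close>
  let ?P = "\<lambda>a b. \<forall>x. b x \<le> (a x :: real)"
  have "\<exists>m\<in>A. \<forall>a\<in>A. ?P m a \<longrightarrow> a = m"
  proof (rule predicate_Zorn)
    show "partial_order_on A (relation_of ?P A)"
      by (rule partial_order_on_relation_ofI) (auto intro: order_trans simp: fun_eq_iff intro!: antisym)
    fix C assume C: "C \<in> Chains (relation_of ?P A)"
    show "\<exists>u\<in>A. \<forall>a\<in>C. ?P a u"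
    proof (cases "C = {}")
      case True
      then show ?thesis using q0 by (auto simp: A_def)
    next
      case False
      have CA: "sublin q \<and> (\<forall>x. q x \<le> q0 x)" if "q \<in> C" for q
        using C that unfolding Chains_def relation_of_def A_def by blast
      have "(\<forall>x. a x \<le> b x) \<or> (\<forall>x. b x \<le> a x)" if "a \<in> C" "b \<in> C" for a b
        using C that unfolding Chains_def relation_of_def by blast
      from sublin_chain_Inf[OF False CA this]
      obtain p where "sublin p" "\<And>q x. q \<in> C \<Longrightarrow> p x \<le> q x" by blast
      moreover obtain q where "q \<in> C" using False by blast
      ultimately have "p x \<le> q0 x" for x using CA by (metis order_trans)
      then show ?thesis using \<open>sublin p\<close> \<open>\<And>q x. q \<in> C \<Longrightarrow> p x \<le> q x\<close>
        unfolding A_def by (intro bexI[of _ p]) auto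
    qed
  qed
  then obtain u where uA: "u \<in> A" and uA_min: "\<And>a. a \<in> A \<Longrightarrow> \<forall>x. a x \<le> u x \<Longrightarrow> a = u"
    by blast
  then have u: "sublin u" "\<And>x. u x \<le> q0 x" by (auto simp: A_def)
  have min: "a = u" if "sublin a" "\<And>x. a x \<le> u x" for a
  proof (rule uA_min)
    show "a \<in> A" using that u(2) order_trans unfolding A_def by blast
  qed (use that in blast)
  have add: "u (x + v) = u x + u v" for x v
  proof (rule antisym)
    show "u (x + v) \<le> u x + u v" using u(1) by (auto simp: sublin_def)
    obtain p where p: "sublin p" "\<And>x. p x \<le> u x" "\<And>x. p x \<le> u (x + v) - u v"
      using sublin_shift[OF u(1)] by blast
    then have "p = u" using min by blast
    then show "u x + u v \<le> u (x + v)" using p(3)[of x] by simp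
  qed
  have neg: "u (- x) = - u x" for x
    using add[of x "- x"] sublin_zero[OF u(1)] by simp
  have "u (t *\<^sub>R x) = t * u x" for t x
  proof -
    consider "t > 0" | "t = 0" | "t < 0" by linarith
    then show ?thesis
    proof cases
      case 3
      then have "u ((- t) *\<^sub>R x) = (- t) * u x"
        by (intro sublin_scale[OF u(1)]) auto
      then show ?thesis by (simp add: neg)
    qed (auto simp: sublin_scale[OF u(1)] sublin_zero[OF u(1)])
  qed
  with add have "linear u" by (intro linearI) auto
  with u(2) that show ?thesis by blast
qed

text \<open>The norm is lowered by a shift along \<open>x0\<close>, so a linear functional below it
  satisfies \<open>u (- x0) \<le> - norm x0\<close> and attains the norm at \<open>x0\<close>. Its
  complexification is \<open>u x - \<i> u (\<i> x)\<close>; a unimodular multiple of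
  \<open>x\<close> makes this value real, where it is controlled by \<open>u\<close>.\<close>

theorem hahn_banach_support:
  fixes x0 :: "'a::complex_banach"
  obtains f where "cblin f" "\<And>x. cmod (f x) \<le> norm x" "f x0 = of_real (norm x0)"
proof -
  have "sublin (norm :: 'a \<Rightarrow> real)"
    by (auto simp: sublin_def norm_triangle_ineq)
  then obtain p where p: "sublin p" "\<And>x::'a. p x \<le> norm x" "\<And>x. p x \<le> norm (x + x0) - norm x0"
    using sublin_shift[of norm x0] by metis
  obtain u where u: "linear u" "\<And>x. u x \<le> p x"
    using linear_below_sublin[OF p(1)] by blast
  have ule: "u x \<le> norm x" for x using u(2) p(2) order_trans by blast
  have "u (- x0) \<le> - norm x0"
    using u(2)[of "-x0"] p(3)[of "-x0"] by simp
  then have ux0: "u x0 = norm x0"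
    using ule[of x0] u(1) by (simp add: linear_neg)
  define f where "f x = Complex (u x) (- u (scaleC \<i> x))" for x
  have add: "f (x + y) = f x + f y" for x y
    using u(1) by (simp add: f_def linear_add scaleC_add_right complex_eq_iff)
  have scaleR: "u (scaleC (complex_of_real r) x) = r * u x" for r x
    using u(1) by (simp add: linear_scale flip: scaleR_scaleC)
  have scale: "f (scaleC c x) = c * f x" for c x
  proof -
    have c: "scaleC c x = scaleC (of_real (Re c)) x + scaleC (of_real (Im c)) (scaleC \<i> x)" for x :: 'a
      by (metis complex_eq mult.commute scaleC_add_left scaleC_scaleC)
    have u1: "u (scaleC c x) = Re c * u x + Im c * u (scaleC \<i> x)" for x
      unfolding c[of x] using u(1) by (simp add: linear_add scaleR del: scaleC_scaleC)
    have "u (scaleC \<i> (scaleC c x)) = Re c * u (scaleC \<i> x) - Im c * u x"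
      using u1[of "scaleC \<i> x"] u(1) by (simp add: linear_neg mult.commute[of c])
    with u1[of x] show ?thesis
      unfolding f_def by (simp add: complex_eq_iff del: scaleC_scaleC)
  qed
  have bound: "cmod (f x) \<le> norm x" for x
  proof (cases "f x = 0")
    case False
    define c where "c = cnj (f x) / of_real (cmod (f x))"
    have c: "cmod c = 1" using False by (simp add: c_def norm_divide)
    have "f (scaleC c x) = (f x * cnj (f x)) / of_real (cmod (f x))"
      by (simp add: scale c_def)
    also have "\<dots> = of_real (cmod (f x))"
      using False unfolding complex_norm_square[symmetric] by (simp add: power2_eq_square)
    finally have "f (scaleC c x) = of_real (cmod (f x))" .
    then have "cmod (f x) = u (scaleC c x)"
      by (simp add: f_def complex_eq_iff)
    also have "\<dots> \<le> norm (scaleC c x)" by (rule ule)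
    finally show ?thesis using c by simp
  qed simp
  have "cblin f"
    using add scale bound by (intro cblinI[where K = 1]) auto
  moreover have "f x0 = of_real (norm x0)"
  proof -
    have "Re (f x0) = norm x0" by (simp add: f_def ux0)
    moreover have "(Re (f x0))\<^sup>2 + (Im (f x0))\<^sup>2 \<le> (norm x0)\<^sup>2"
      using power_mono[OF bound[of x0], of 2] by (simp add: cmod_power2)
    ultimately have "Re (f x0) = norm x0" "Im (f x0) = 0" by simp_all
    then show ?thesis by (simp add: complex_eq_iff)
  qed
  ultimately show ?thesis using that bound by blast
qed

lemma norm_le_of_functionals:
  fixes x :: "'a::complex_banach"
  assumes "\<And>f. cblin f \<Longrightarrow> cmod (f x) \<le> K * onorm f" "K \<ge> 0"
  shows "norm x \<le> K"
proof -
  obtain f where f: "cblin f" "\<And>x. cmod (f x) \<le> norm x" "f x = of_real (norm x)"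
    using hahn_banach_support[of x] by blast
  have "onorm f \<le> 1" using f(2) by (intro onorm_bound) auto
  then have "K * onorm f \<le> K" using assms(2) by (simp add: mult_left_le)
  with assms(1)[OF f(1)] f(3) show ?thesis by simp
qed

lemma functional_nonzero:
  fixes x :: "'a::complex_banach"
  assumes "x \<noteq> 0"
  obtains f :: "'a \<Rightarrow> complex" where "cblin f" "f x = 1"
proof -
  obtain f where f: "cblin f" "\<And>z. cmod (f z) \<le> norm z" "f x = of_real (norm x)"
    using hahn_banach_support[of x] by blast
  then have "cblin (\<lambda>z. (1 / of_real (norm x)) * f z)" by (intro cblin_cmult)
  with that[OF this] f(3) assms show ?thesis by simp
qed

lemma functionals_separate:
  fixes x y :: "'a::complex_banach"
  assumes "\<And>f :: 'a \<Rightarrow> complex. cblin f \<Longrightarrow> f x = f y"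
  shows "x = y"
proof (rule ccontr)
  assume "x \<noteq> y"
  then obtain f :: "'a \<Rightarrow> complex" where "cblin f" "f (x - y) = 1"
    using functional_nonzero[of "x - y"] by auto
  with assms[of f] show False by (simp add: cblin_diff)
qed

lemma functional_vanishing_on_span:
  fixes x :: "'a::complex_banach"
  assumes "finite W" "x \<notin> cspan W"
  obtains f :: "'a \<Rightarrow> complex" where "cblin f" "f x = 1" "\<And>w. w \<in> W \<Longrightarrow> f w = 0"
  using assms
proof (induction W arbitrary: x thesis rule: finite_induct)
  case empty
  then show ?case using functional_nonzero[of x] by (auto simp: scaleC.span_empty)
next
  case (insert w W)
  show ?case
  proof (cases "w \<in> cspan W")
    case True
    then have "x \<notin> cspan W" using insert.prems(2) by (auto simp: scaleC.span_redundant)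
    then obtain f :: "'a \<Rightarrow> complex" where f: "cblin f" "f x = 1" "\<And>w. w \<in> W \<Longrightarrow> f w = 0"
      using insert.IH by blast
    have "f z = 0" if "z \<in> cspan W" for z
      using that by (induction rule: scaleC.span_induct_alt) (auto simp: f cblin_zero cblin_add cblin_scaleC)
    then show ?thesis using insert.prems(1) f True by blast
  next
    case False
    then obtain g :: "'a \<Rightarrow> complex" where g: "cblin g" "g w = 1" "\<And>w. w \<in> W \<Longrightarrow> g w = 0"
      using insert.IH by blast
    have "x - scaleC (g x) w \<notin> cspan W"
      using insert.prems(2) by (auto simp: scaleC.span_insert)
    then obtain h :: "'a \<Rightarrow> complex" where h: "cblin h" "h (x - scaleC (g x) w) = 1" "\<And>w. w \<in> W \<Longrightarrow> h w = 0"
      using insert.IH by blast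
    \<comment> \<open>Subtracting \<open>h w * g\<close> cancels the value at \<open>w\<close>,
      where \<open>g\<close> is 1, and leaves the zeros on \<open>W\<close> alone. At
      \<open>x\<close> it gives \<open>h (x - g(x) w)\<close>, which is 1 by the choice of
      \<open>h\<close>.\<close>
    let ?f = "\<lambda>z. h z - h w * g z"
    have "cblin ?f" by (intro cblin_minusfun cblin_cmult g h)
    moreover have "?f x = 1"
      using h(1,2) by (simp add: cblin_diff cblin_scaleC mult.commute)
    moreover have "?f z = 0" if "z \<in> insert w W" for z using that g h by auto
    ultimately show ?thesis using insert.prems(1) by blast
  qed
qed

section \<open>The dual space as a type\<close>

text \<open>As a type, the dual becomes an instance of \<open>complex_banach\<close>, so that
  spectra, uniform boundedness and everything proved for operators between spaces apply to it as
  well. The theorem itself speaks of functionals as plain functions; the translation is made at the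
  end.\<close>

typedef (overloaded) 'a cdual = "{f :: 'a::complex_banach \<Rightarrow> complex. cblin f}"
  morphisms dual_apply Abs_cdual
  by (rule exI[of _ "\<lambda>x. 0"]) simp

setup_lifting type_definition_cdual

lemma cblin_dual_apply [simp]: "cblin (dual_apply f)"
  using dual_apply[of f] by simp

lemma dual_apply_Abs [simp]: "cblin f \<Longrightarrow> dual_apply (Abs_cdual f) = f"
  by (simp add: Abs_cdual_inverse)

instantiation cdual :: (complex_banach) real_normed_vector
begin

lift_definition norm_cdual :: "'a cdual \<Rightarrow> real" is onorm .
lift_definition minus_cdual :: "'a cdual \<Rightarrow> 'a cdual \<Rightarrow> 'a cdual" is "\<lambda>f g x. f x - g x"
  by (rule cblin_minusfun)
lift_definition uminus_cdual :: "'a cdual \<Rightarrow> 'a cdual" is "\<lambda>f x. - f x"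
  by (rule cblin_uminus)
lift_definition zero_cdual :: "'a cdual" is "\<lambda>x. 0"
  by simp
lift_definition plus_cdual :: "'a cdual \<Rightarrow> 'a cdual \<Rightarrow> 'a cdual" is "\<lambda>f g x. f x + g x"
  by (rule cblin_plus)
lift_definition scaleR_cdual :: "real \<Rightarrow> 'a cdual \<Rightarrow> 'a cdual" is "\<lambda>r f x. r *\<^sub>R f x"
  by (simp add: scaleR_conv_of_real cblin_cmult)

definition sgn_cdual :: "'a cdual \<Rightarrow> 'a cdual" where "sgn_cdual x = scaleR (inverse (norm x)) x"
definition dist_cdual :: "'a cdual \<Rightarrow> 'a cdual \<Rightarrow> real" where "dist_cdual a b = norm (a - b)"
definition uniformity_cdual :: "('a cdual \<times> 'a cdual) filter" where
  "uniformity_cdual = (INF e\<in>{0 <..}. principal {(x, y). dist x y < e})"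
definition open_cdual :: "'a cdual set \<Rightarrow> bool" where
  "open_cdual S = (\<forall>x\<in>S. \<forall>\<^sub>F (x', y) in uniformity. x' = x \<longrightarrow> y \<in> S)"

instance
  apply standard
  unfolding dist_cdual_def open_cdual_def sgn_cdual_def uniformity_cdual_def
  apply (rule refl | (transfer, force simp: cblin_def onorm_triangle onorm_scaleR onorm_eq_0 algebra_simps))+
  done

end

lemma dual_apply_bound: "cmod (dual_apply f x) \<le> norm f * norm x"
  by transfer (rule cblin_bound)

lemma norm_cdual_le: "K \<ge> 0 \<Longrightarrow> (\<And>x. cmod (dual_apply f x) \<le> K * norm x) \<Longrightarrow> norm f \<le> K"
  by transfer (rule onorm_bound)

lemma cdual_eqI: "(\<And>x. dual_apply f x = dual_apply g x) \<Longrightarrow> f = g"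
  by transfer auto

lemma Cauchy_cdual_convergent:
  fixes X :: "nat \<Rightarrow> 'a::complex_banach cdual"
  assumes "Cauchy X"
  shows "convergent X"
proof -
  have Cx: "Cauchy (\<lambda>n. dual_apply (X n) x)" for x
  proof (rule CauchyI)
    fix e :: real assume e: "e > 0"
    obtain M where M: "\<And>m n. m \<ge> M \<Longrightarrow> n \<ge> M \<Longrightarrow> norm (X m - X n) < e / (norm x + 1)"
      using CauchyD[OF assms, of "e / (norm x + 1)"] e by (auto simp: add_nonneg_pos)
    have "cmod (dual_apply (X m) x - dual_apply (X n) x) < e" if "m \<ge> M" "n \<ge> M" for m n
    proof -
      have "cmod (dual_apply (X m) x - dual_apply (X n) x) \<le> norm (X m - X n) * norm x"
        using dual_apply_bound[of "X m - X n" x] by (simp add: minus_cdual.rep_eq)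
      also have "\<dots> \<le> e / (norm x + 1) * norm x"
        using M[OF that] by (intro mult_right_mono) auto
      also have "\<dots> < e" using e by (simp add: add_nonneg_pos pos_divide_less_eq distrib_left)
      finally show ?thesis .
    qed
    then show "\<exists>M. \<forall>m\<ge>M. \<forall>n\<ge>M. norm (dual_apply (X m) x - dual_apply (X n) x) < e" by blast
  qed
  define g where "g x = lim (\<lambda>n. dual_apply (X n) x)" for x
  have lim: "(\<lambda>n. dual_apply (X n) x) \<longlonglongrightarrow> g x" for x
    unfolding g_def using Cx[of x] by (simp add: Cauchy_convergent convergent_LIMSEQ_iff[symmetric])
  obtain B where B: "\<And>n. norm (X n) \<le> B"
    using Cauchy_Bseq[OF assms] unfolding Bseq_def by blast
  have gadd: "g (x + y) = g x + g y" for x y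
    by (rule LIMSEQ_unique[OF lim]) (auto simp: cblin_add intro: tendsto_add lim)
  have gsc: "g (scaleC c x) = scaleC c (g x)" for c x
    by (rule LIMSEQ_unique[OF lim]) (auto simp: cblin_scaleC intro: tendsto_mult_left lim)
  have "cmod (g x) \<le> B * norm x" for x
  proof (rule tendsto_upperbound[OF tendsto_norm[OF lim]])
    show "\<forall>\<^sub>F n in sequentially. cmod (dual_apply (X n) x) \<le> B * norm x"
      using B by (intro always_eventually allI order_trans[OF dual_apply_bound] mult_right_mono) auto
  qed simp
  then have g: "cblin g" by (rule cblinI[OF gadd gsc])
  have "X \<longlonglongrightarrow> Abs_cdual g"
  proof (rule LIMSEQ_I)
    fix e :: real assume e: "e > 0"
    obtain M where M: "\<And>m n. m \<ge> M \<Longrightarrow> n \<ge> M \<Longrightarrow> norm (X m - X n) < e / 2"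
      using CauchyD[OF assms, of "e / 2"] e by auto
    have "norm (X m - Abs_cdual g) < e" if "m \<ge> M" for m
    proof -
      have "norm (X m - Abs_cdual g) \<le> e / 2"
      proof (rule norm_cdual_le)
        \<comment> \<open>With \<open>m\<close> fixed, letting \<open>n\<close> tend to infinity in
          the pointwise Cauchy estimate bounds the distance to the limit.\<close>
        fix x
        have "(\<lambda>n. cmod (dual_apply (X m) x - dual_apply (X n) x)) \<longlonglongrightarrow> cmod (dual_apply (X m) x - g x)"
          by (intro tendsto_norm tendsto_diff tendsto_const lim)
        moreover have "\<forall>\<^sub>F n in sequentially. cmod (dual_apply (X m) x - dual_apply (X n) x) \<le> e / 2 * norm x"
        proof (rule eventually_sequentiallyI[of M])
          fix n assume "n \<ge> M"
          have "cmod (dual_apply (X m) x - dual_apply (X n) x) \<le> norm (X m - X n) * norm x"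
            using dual_apply_bound[of "X m - X n" x] by (simp add: minus_cdual.rep_eq)
          also have "\<dots> \<le> e / 2 * norm x"
            using M[OF that \<open>n \<ge> M\<close>] by (intro mult_right_mono) auto
          finally show "cmod (dual_apply (X m) x - dual_apply (X n) x) \<le> e / 2 * norm x" .
        qed
        ultimately show "cmod (dual_apply (X m - Abs_cdual g) x) \<le> e / 2 * norm x"
          unfolding minus_cdual.rep_eq dual_apply_Abs[OF g]
          by (rule tendsto_upperbound) simp
      qed (use e in simp)
      then show ?thesis using e by simp
    qed
    then show "\<exists>no. \<forall>n\<ge>no. norm (X n - Abs_cdual g) < e" by blast
  qed
  then show ?thesis by (auto simp: convergent_def)
qed

instantiation cdual :: (complex_banach) complex_banach
begin

lift_definition scaleC_cdual :: "complex \<Rightarrow> 'a cdual \<Rightarrow> 'a cdual" is "\<lambda>c f x. c * f x"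
  by (rule cblin_cmult)

instance
proof
  fix a :: complex and x :: "'a cdual"
  show "norm (scaleC a x) = cmod a * norm x"
  proof (cases "a = 0")
    case True
    then show ?thesis by transfer (simp add: onorm_zero)
  next
    case False
    \<comment> \<open>Used for \<open>a\<close> and again for \<open>1 / a\<close>, this inequality
      becomes an equality.\<close>
    have le: "norm (scaleC a x) \<le> cmod a * norm x" for a and x :: "'a cdual"
      using dual_apply_bound[of x]
      by (intro norm_cdual_le) (auto simp: scaleC_cdual.rep_eq norm_mult mult.assoc mult_left_mono)
    have "x = scaleC (1 / a) (scaleC a x)" using False by transfer (simp add: fun_eq_iff)
    then have "norm x \<le> cmod (1 / a) * norm (scaleC a x)" using le by metis
    then show ?thesis using le[of a x] False by (simp add: norm_divide field_simps)
  qed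
next
  fix X :: "nat \<Rightarrow> 'a cdual"
  assume "Cauchy X"
  then show "convergent X" by (rule Cauchy_cdual_convergent)
next
  fix a b :: complex and r :: real and x y :: "'a cdual"
  show "scaleC a (x + y) = scaleC a x + scaleC a y" by transfer (simp add: distrib_left)
  show "scaleC (a + b) x = scaleC a x + scaleC b x" by transfer (simp add: distrib_right)
  show "scaleC a (scaleC b x) = scaleC (a * b) x" by transfer (simp add: mult.assoc)
  show "scaleC 1 x = x" by transfer simp
  show "r *\<^sub>R x = scaleC (complex_of_real r) x" by transfer (simp add: scaleR_conv_of_real)
qed

end

section \<open>Uniform boundedness\<close>

text \<open>Nested balls: if the family were unbounded, functionals of the family could be made large
  on smaller and smaller closed balls, and the family would be unbounded at their common point.\<close>

theorem uniform_boundedness: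
  fixes F :: "('a::complex_banach \<Rightarrow> complex) set"
  assumes F: "\<And>f. f \<in> F \<Longrightarrow> cblin f"
    and pt: "\<And>x. \<exists>K. \<forall>f\<in>F. cmod (f x) \<le> K"
  obtains K where "K \<ge> 0" "\<And>f x. f \<in> F \<Longrightarrow> cmod (f x) \<le> K * norm x"
proof -
  have "\<exists>K\<ge>0. \<forall>f\<in>F. \<forall>x. cmod (f x) \<le> K * norm x"
  proof (rule ccontr)
    assume "\<not> ?thesis"
    then have unb: "\<exists>f\<in>F. \<exists>x. K * norm x < cmod (f x)" if "K \<ge> 0" for K
      using that by (meson not_le)
    have step: "\<exists>x' r'. 0 < r' \<and> r' \<le> r / 2 \<and> cball x' r' \<subseteq> cball x r \<and>
        (\<exists>f\<in>F. \<forall>z\<in>cball x' r'. K < cmod (f z))"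
      if r: "r > 0" and K: "K \<ge> 0" for x :: 'a and r K :: real
    proof -
      \<comment> \<open>The factor \<open>2 * K / r\<close> is chosen so that \<open>z\<close>,
        rescaled to norm \<open>r / 2\<close>, has a value of modulus above
        \<open>K\<close>.\<close>
      obtain f z where f: "f \<in> F" and z: "(2 * K / r) * norm z < cmod (f z)"
        using unb[of "2 * K / r"] r K by auto
      note cb = F[OF f]
      have "z \<noteq> 0" using z by (auto simp: cblin_zero[OF cb])
      define w where "w = scaleC (of_real (r / (2 * norm z))) z"
      have nw: "norm w = r / 2" using \<open>z \<noteq> 0\<close> r by (simp add: w_def norm_divide norm_mult)
      have "cmod (f w) = r / (2 * norm z) * cmod (f z)"
        using r by (simp add: w_def cblin_scaleC[OF cb] norm_mult norm_divide)
      also have "\<dots> > K" using z \<open>z \<noteq> 0\<close> r by (simp add: field_simps)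
      finally have fw: "cmod (f w) > K" .
      \<comment> \<open>Whatever the value at the centre \<open>x\<close> is, one of the two points
        \<open>x + w\<close> and \<open>x - w\<close> must carry a value larger than
        \<open>K\<close>.\<close>
      have "2 * cmod (f w) = cmod (f (x + w) - f (x - w))"
        by (simp add: cblin_add[OF cb] cblin_diff[OF cb] flip: mult_2)
      also have "\<dots> \<le> cmod (f (x + w)) + cmod (f (x - w))" by (rule norm_triangle_ineq4)
      finally have "K < cmod (f (x + w)) \<or> K < cmod (f (x - w))" using fw by linarith
      moreover have "dist x (x + w) \<le> r / 2" "dist x (x - w) \<le> r / 2" using nw by (simp_all add: dist_norm)
      ultimately obtain x' where x': "dist x x' \<le> r / 2" "cmod (f x') > K" by blast
      have "continuous_on UNIV (\<lambda>z. cmod (f z))"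
        by (intro continuous_on_norm linear_continuous_on cblin_bounded_linear cb)
      then have "open {z. K < cmod (f z)}"
        by (intro open_Collect_less continuous_on_const)
      then obtain e where e: "e > 0" "cball x' e \<subseteq> {z. K < cmod (f z)}"
        using x'(2) by (auto simp: open_contains_cball)
      have "cball x' (min e (r / 2)) \<subseteq> cball x r"
      proof
        fix z assume "z \<in> cball x' (min e (r / 2))"
        then show "z \<in> cball x r" using x'(1) dist_triangle[of x z x'] by (simp add: dist_commute)
      qed
      with e r f show ?thesis
        by (intro exI[of _ x'] exI[of _ "min e (r / 2)"]) (auto intro!: bexI[of _ f])
    qed
    have "\<exists>b :: nat \<Rightarrow> 'a \<times> real. \<forall>n. snd (b n) > 0 \<and> (snd (b (Suc n)) \<le> snd (b n) / 2 \<and>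
        cball (fst (b (Suc n))) (snd (b (Suc n))) \<subseteq> cball (fst (b n)) (snd (b n)) \<and>
        (\<exists>f\<in>F. \<forall>z\<in>cball (fst (b (Suc n))) (snd (b (Suc n))). real n < cmod (f z)))"
    proof (rule dependent_nat_choice)
      show "\<exists>x :: 'a \<times> real. 0 < snd x" by (rule exI[of _ "(0, 1)"]) simp
    next
      fix b :: "'a \<times> real" and n assume "0 < snd b"
      from step[OF this, of "real n" "fst b"]
      show "\<exists>y. 0 < snd y \<and> snd y \<le> snd b / 2 \<and> cball (fst y) (snd y) \<subseteq> cball (fst b) (snd b) \<and>
          (\<exists>f\<in>F. \<forall>z\<in>cball (fst y) (snd y). real n < cmod (f z))"
        by auto
    qed
    then obtain b :: "nat \<Rightarrow> 'a \<times> real" where b_all: "\<forall>n. snd (b n) > 0 \<and> (snd (b (Suc n)) \<le> snd (b n) / 2 \<and>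
        cball (fst (b (Suc n))) (snd (b (Suc n))) \<subseteq> cball (fst (b n)) (snd (b n)) \<and>
        (\<exists>f\<in>F. \<forall>z\<in>cball (fst (b (Suc n))) (snd (b (Suc n))). real n < cmod (f z)))" ..
    have b: "snd (b n) > 0" "snd (b (Suc n)) \<le> snd (b n) / 2"
      "cball (fst (b (Suc n))) (snd (b (Suc n))) \<subseteq> cball (fst (b n)) (snd (b n))"
      "\<exists>f\<in>F. \<forall>z\<in>cball (fst (b (Suc n))) (snd (b (Suc n))). real n < cmod (f z)" for n
      using spec[OF b_all, of n] by - (elim conjE, assumption)+
    define B where "B n = cball (fst (b n)) (snd (b n))" for n
    have anti: "B n \<subseteq> B m" if "m \<le> n" for m n
      by (rule lift_Suc_antimono_le[of B, OF _ that]) (simp only: B_def b(3))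
    have small: "snd (b n) \<le> snd (b 0) / 2 ^ n" for n
    proof (induction n)
      case (Suc n)
      have "snd (b (Suc n)) \<le> snd (b n) / 2" by (rule b(2))
      also have "\<dots> \<le> (snd (b 0) / 2 ^ n) / 2" using Suc by (intro divide_right_mono) auto
      finally show ?case by (simp add: mult.commute)
    qed simp
    have ne: "closed (B n)" "B n \<noteq> {}" for n using b(1)[of n] by (auto simp: B_def)
    have diam: "\<exists>n. \<forall>x\<in>B n. \<forall>y\<in>B n. dist x y < e" if e: "e > 0" for e
    proof -
      obtain n where n: "(1 / 2) ^ n < e / 2 / snd (b 0)"
        using real_arch_pow_inv[of "e / 2 / snd (b 0)" "1/2"] e b(1)[of 0] by auto
      then have "snd (b 0) / 2 ^ n < e / 2"
        using b(1)[of 0] by (simp add: field_simps power_one_over)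
      then have "dist x y < e" if "x \<in> B n" "y \<in> B n" for x y
        using that dist_triangle3[of x y "fst (b n)"] small[of n] unfolding B_def mem_cball by linarith
      then show ?thesis by blast
    qed
    obtain a where a: "\<And>n. a \<in> B n"
      using decreasing_closed_nest[of B, OF ne anti diam] by blast
    obtain K where K: "\<And>f. f \<in> F \<Longrightarrow> cmod (f a) \<le> K" using pt by blast
    obtain n where "K < real n" using reals_Archimedean2 by blast
    moreover obtain f where "f \<in> F" "real n < cmod (f a)"
      using b(4)[of n] a[of "Suc n"] unfolding B_def by blast
    ultimately show False using K[of f] by simp
  qed
  then show ?thesis using that by blast
qed

section \<open>Spectra\<close>

lemma invertible_opI:
  assumes "cblin S" "\<And>x. S (T x) = x" "\<And>x. T (S x) = x"
  shows "invertible_op T"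
  unfolding invertible_op_def using assms by (auto simp: fun_eq_iff)

lemma invertible_opE:
  assumes "invertible_op T"
  obtains S where "cblin S" "\<And>x. S (T x) = x" "\<And>x. T (S x) = x"
  using assms unfolding invertible_op_def by (auto simp: fun_eq_iff)

lemma not_in_spectrumI:
  assumes "cblin S" "\<And>x. S (T x - scaleC z x) = x" "\<And>x. T (S x) - scaleC z (S x) = x"
  shows "z \<notin> spectrum_op T"
  using invertible_opI[of S "\<lambda>x. T x - scaleC z x"] assms by (simp add: spectrum_op_def)

lemma not_in_spectrumE:
  assumes "z \<notin> spectrum_op T"
  obtains S where "cblin S" "\<And>x. S (T x - scaleC z x) = x" "\<And>x. T (S x) - scaleC z (S x) = x"
proof -
  have "invertible_op (\<lambda>x. T x - scaleC z x)" using assms by (simp add: spectrum_op_def)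
  from this that show thesis by (rule invertible_opE)
qed

text \<open>For an operator satisfying a polynomial identity, polynomial division produces
  \<open>G\<close> with \<open>(T - z) G = k\<close>; the scalar is divided out here once for all
  such uses.\<close>

lemma not_in_spectrumI_multiple:
  assumes "cblin G" "k \<noteq> 0"
    and "\<And>x. G (T x - scaleC z x) = scaleC k x" "\<And>x. T (G x) - scaleC z (G x) = scaleC k x"
    and T: "cblin T"
  shows "z \<notin> spectrum_op T"
proof (rule not_in_spectrumI)
  show "cblin (\<lambda>x. scaleC (1 / k) (G x))" by (rule cblin_scaleC_right[OF assms(1)])
  show "scaleC (1 / k) (G (T x - scaleC z x)) = x" for x
    using assms by simp
  have "T (scaleC (1 / k) (G x)) - scaleC z (scaleC (1 / k) (G x)) = scaleC (1 / k) (T (G x) - scaleC z (G x))" for x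
    by (simp add: cblin_scaleC[OF T] scaleC.scale_right_diff_distrib)
  then show "T (scaleC (1 / k) (G x)) - scaleC z (scaleC (1 / k) (G x)) = x" for x
    using assms by simp
qed

lemma eigenvalue_in_spectrum:
  assumes "F v = scaleC z v" "v \<noteq> 0" "cblin F"
  shows "z \<in> spectrum_op F"
proof (rule ccontr)
  assume "z \<notin> spectrum_op F"
  then obtain S where S: "cblin S" "\<And>x. S (F x - scaleC z x) = x" "\<And>x. F (S x) - scaleC z (S x) = x"
    using not_in_spectrumE by metis
  from S(2)[of v] show False using assms cblin_zero[OF S(1)] by simp
qed

lemma invertible_op_bounded_below:
  assumes T: "cblin T" and d: "d > 0" "\<And>x. d * norm x \<le> norm (T x)" and "surj T"
  shows "invertible_op T"
proof -
  have inj: "inj T"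
  proof (rule injI)
    fix x y assume "T x = T y"
    then show "x = y" using d(2)[of "x - y"] d(1)
      by (simp add: cblin_diff[OF T] mult_le_0_iff)
  qed
  define S where "S = inv T"
  have ST: "S (T x) = x" for x using inj by (simp add: S_def)
  have TS: "T (S x) = x" for x using \<open>surj T\<close> by (simp add: S_def surj_f_inv_f)
  have "cblin S"
  proof (rule cblinI[where K = "1 / d"])
    show "S (x + y) = S x + S y" for x y
      by (rule injD[OF inj]) (simp add: TS cblin_add[OF T])
    show "S (scaleC c x) = scaleC c (S x)" for c x
      by (rule injD[OF inj]) (simp add: TS cblin_scaleC[OF T])
    show "norm (S x) \<le> 1 / d * norm x" for x
      using d(2)[of "S x"] d(1) by (simp add: TS field_simps)
  qed
  then show ?thesis using invertible_opI ST TS by blast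
qed

text \<open>For larger \<open>z\<close> the equation \<open>T x - z x = y\<close> is the fixed point
  equation of a contraction with ratio \<open>onorm T / cmod z\<close>, which gives surjectivity.
  The gap \<open>cmod z - onorm T\<close> bounds the inverse.\<close>

lemma spectrum_norm_le:
  assumes T: "cblin T" and z: "z \<in> spectrum_op T"
  shows "cmod z \<le> onorm T"
proof (rule ccontr)
  assume "\<not> ?thesis"
  then have lt: "onorm T < cmod z" by simp
  then have z0: "cmod z > 0" using cblin_onorm_nonneg[OF T] by linarith
  let ?D = "\<lambda>x. T x - scaleC z x"
  have "invertible_op ?D"
  proof (rule invertible_op_bounded_below)
    show "cblin ?D" by (intro cblin_minusfun T cblin_scaleC_right cblin_ident)
    show "0 < cmod z - onorm T" using lt by simp
    show "(cmod z - onorm T) * norm x \<le> norm (?D x)" for x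
      using cblin_bound[OF T, of x] norm_triangle_ineq2[of "scaleC z x" "T x"]
      by (simp add: left_diff_distrib norm_minus_commute)
    show "surj ?D"
      unfolding surj_def
    proof
      fix y
      let ?f = "\<lambda>x. scaleC (1 / z) (T x - y)"
      have "\<exists>!x. ?f x = x"
      proof (rule banach_fix_type[where c = "onorm T / cmod z"])
        show "\<forall>x w. dist (?f x) (?f w) \<le> onorm T / cmod z * dist x w"
        proof (intro allI)
          fix x w
          have "?f x - ?f w = scaleC (1 / z) (T (x - w))"
            by (simp add: cblin_diff[OF T] flip: scaleC.scale_right_diff_distrib)
          then show "dist (?f x) (?f w) \<le> onorm T / cmod z * dist x w"
            using cblin_bound[OF T, of "x - w"] z0
            by (simp add: dist_norm norm_divide divide_right_mono)
        qed
      qed (use lt z0 cblin_onorm_nonneg[OF T] in auto)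
      then obtain x where "?f x = x" by blast
      then have "scaleC z (?f x) = scaleC z x" by simp
      then have "T x - y = scaleC z x" using z0 by simp
      then show "\<exists>x. y = ?D x" by (intro exI[of _ x]) (simp add: eq_diff_eq diff_eq_eq add.commute)
    qed
  qed
  with z show False by (simp add: spectrum_op_def)
qed

text \<open>Were the resolvent defined everywhere, each scalar function \<open>f (R z x)\<close>
  would be entire and vanish at infinity, hence be zero by Liouville. Working with scalar functions
  reduces holomorphy to the resolvent identity, which turns the difference quotient into
  \<open>f (R w (R z x))\<close>.\<close>

theorem spectrum_nonempty:
  fixes T :: "'a::complex_banach \<Rightarrow> 'a"
  assumes T: "cblin T" and x0: "(x0::'a) \<noteq> 0"
  shows "spectrum_op T \<noteq> {}"
proof
  assume "spectrum_op T = {}"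
  then have notin: "z \<notin> spectrum_op T" for z by simp
  have "\<exists>S. cblin S \<and> (\<forall>x. S (T x - scaleC z x) = x) \<and> (\<forall>x. T (S x) - scaleC z (S x) = x)" for z
    by (rule not_in_spectrumE[OF notin[of z]]) blast
  then obtain R where R: "\<And>z. cblin (R z)" "\<And>z x. R z (T x - scaleC z x) = x"
      "\<And>z x. T (R z x) - scaleC z (R z x) = x"
    by metis
  have TR: "T (R z x) = x + scaleC z (R z x)" for z x using R(3)[of z x] by (simp add: diff_eq_eq)
  have res1: "R w x - R z x = scaleC (w - z) (R w (R z x))" for w z x
  proof -
    have "x = T (R z x) - scaleC w (R z x) + scaleC (w - z) (R z x)"
      by (simp add: TR scaleC.scale_left_diff_distrib)
    then have "R w x = R w (T (R z x) - scaleC w (R z x) + scaleC (w - z) (R z x))" by simp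
    then show ?thesis by (simp only: cblin_add[OF R(1)] cblin_scaleC[OF R(1)] R(2)) simp
  qed
  have res2: "R w x - R z x = scaleC (w - z) (R z (R w x))" for w z x
    using res1[of z x w] by (metis minus_diff_eq scaleC.scale_minus_left)
  have cont: "((\<lambda>w. R w u) \<longlongrightarrow> R z u) (at z)" for z u
  proof -
    \<comment> \<open>No bound on \<open>R w\<close> near \<open>z\<close> is known yet. For
      \<open>v = R z u\<close> the resolvent identity bounds the norm of \<open>R w v\<close> by
      \<open>C * norm v\<close> plus \<open>cmod (w - z) * C\<close> times that same norm. The
      radius \<open>1 / (2 * (C + 1))\<close> makes the last factor at most one half, so the term is
      absorbed; the summand 1 covers \<open>C = 0\<close>.\<close>
    define C where "C = onorm (R z)"
    have C0: "C \<ge> 0" by (simp add: C_def cblin_onorm_nonneg R)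
    have "norm (R w u - R z u) \<le> cmod (w - z) * (2 * C * norm (R z u))"
      if w: "dist w z < 1 / (2 * (C + 1))" for w
    proof -
      define v where "v = R z u"
      have "R w v = R z v + scaleC (w - z) (R z (R w v))" using res2[of w v z] by (simp add: diff_eq_eq add.commute)
      then have "norm (R w v) \<le> norm (R z v) + cmod (w - z) * norm (R z (R w v))"
        by (metis norm_scaleC norm_triangle_ineq)
      also have "\<dots> \<le> C * norm v + cmod (w - z) * (C * norm (R w v))"
        unfolding C_def by (intro add_mono mult_left_mono cblin_bound R) auto
      finally have 1: "norm (R w v) \<le> C * norm v + (cmod (w - z) * C) * norm (R w v)" by (simp add: mult_ac)
      have "cmod (w - z) * C \<le> 1 / (2 * (C + 1)) * C"
        using w C0 by (intro mult_right_mono) (auto simp: dist_norm)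
      also have "\<dots> \<le> 1 / 2" using C0 by (simp add: field_simps)
      finally have "(cmod (w - z) * C) * norm (R w v) \<le> 1 / 2 * norm (R w v)" by (intro mult_right_mono) auto
      with 1 have "norm (R w v) \<le> 2 * C * norm v" by simp
      then show ?thesis
        unfolding res1[of w u z] v_def norm_scaleC by (intro mult_left_mono) auto
    qed
    then have "\<forall>\<^sub>F w in at z. norm (R w u - R z u) \<le> cmod (w - z) * (2 * C * norm (R z u))"
      unfolding eventually_at using C0 by (intro exI[of _ "1 / (2 * (C + 1))"]) auto
    moreover have "((\<lambda>w. cmod (w - z) * (2 * C * norm (R z u))) \<longlongrightarrow> cmod (z - z) * (2 * C * norm (R z u))) (at z)"
      by (intro tendsto_intros)
    ultimately have "((\<lambda>w. R w u - R z u) \<longlongrightarrow> 0) (at z)"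
      by (elim Lim_null_comparison) simp
    then show ?thesis by (simp add: LIM_zero_iff)
  qed
  have zero: "f (R z x) = 0" if f: "cblin f" for f :: "'a \<Rightarrow> complex" and z x
  proof (rule Liouville_weak[where f = "\<lambda>w. f (R w x)"])
    have "((\<lambda>w. f (R w x)) has_field_derivative f (R z (R z x))) (at z)" for z
      unfolding has_field_derivative_iff
    proof (rule Lim_transform_eventually)
      show "((\<lambda>w. f (R w (R z x))) \<longlongrightarrow> f (R z (R z x))) (at z)"
        by (rule bounded_linear.tendsto[OF cblin_bounded_linear[OF f] cont])
      have "(f (R w x) - f (R z x)) / (w - z) = f (R w (R z x))" if "w \<noteq> z" for w
        using that res1[of w x z] by (simp add: cblin_scaleC[OF f] flip: cblin_diff[OF f])
      then show "\<forall>\<^sub>F w in at z. f (R w (R z x)) = (f (R w x) - f (R z x)) / (w - z)"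
        unfolding eventually_at by (intro exI[of _ 1]) auto
    qed
    then show "(\<lambda>w. f (R w x)) holomorphic_on UNIV"
      unfolding holomorphic_on_def by (metis field_differentiable_def field_differentiable_at_within)
    define M where "M = onorm T"
    have bound: "cmod (f (R w x)) \<le> onorm f * (norm x / (cmod w - M))" if "cmod w > M" for w
    proof -
      have "x = T (R w x) - scaleC w (R w x)" by (simp add: R)
      then have "norm x \<ge> norm (scaleC w (R w x)) - norm (T (R w x))"
        by (metis norm_minus_commute norm_triangle_ineq2)
      moreover have "norm (T (R w x)) \<le> M * norm (R w x)" unfolding M_def by (rule cblin_bound[OF T])
      ultimately have "(cmod w - M) * norm (R w x) \<le> norm x" by (simp add: left_diff_distrib)
      then have "norm (R w x) \<le> norm x / (cmod w - M)" using that by (simp add: field_simps)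
      then show ?thesis
        using cblin_bound[OF f, of "R w x"] cblin_onorm_nonneg[OF f]
        by (meson mult_left_mono order_trans)
    qed
    show "((\<lambda>w. f (R w x)) \<longlongrightarrow> 0) at_infinity"
    proof (rule Lim_null_comparison)
      show "\<forall>\<^sub>F w in at_infinity. norm (f (R w x)) \<le> onorm f * (norm x / (cmod w - M))"
        unfolding eventually_at_infinity by (rule exI[of _ "M + 1"]) (intro allI impI bound, linarith)
      have "filterlim (\<lambda>w::complex. cmod w - M) at_top at_infinity"
        using filterlim_tendsto_add_at_top[OF tendsto_const[of "- M"] filterlim_norm_at_top] by simp
      then have "((\<lambda>w::complex. onorm f * (norm x / (cmod w - M))) \<longlongrightarrow> onorm f * 0) at_infinity"
        by (intro tendsto_mult tendsto_const tendsto_divide_0[OF tendsto_const]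
            filterlim_at_top_imp_at_infinity)
      then show "((\<lambda>w::complex. onorm f * (norm x / (cmod w - M))) \<longlongrightarrow> 0) at_infinity" by simp
    qed
  qed
  have "R 0 x0 = 0"
    by (rule functionals_separate) (simp add: zero cblin_zero)
  with TR[of 0 x0] x0 show False by (simp add: cblin_zero[OF T])
qed

lemma peripheral_spectrumI:
  assumes "\<And>z. z \<in> spectrum_op T \<Longrightarrow> cmod z \<le> r" "z0 \<in> spectrum_op T" "cmod z0 = r"
  shows "peripheral_spectrum T = {z \<in> spectrum_op T. cmod z = r}"
proof -
  have "spectral_radius_op T = r"
    unfolding spectral_radius_op_def by (rule cSup_eq_maximum) (use assms in auto)
  then show ?thesis by (simp add: peripheral_spectrum_def)
qed

text \<open>Only the nonzero spectra of \<open>ST\<close> and \<open>TS\<close> agree in general; the peripheral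
  spectra agree because both spectra are nonempty.\<close>

lemma spectrum_comp_commute_subset:
  fixes S T :: "'a::complex_banach \<Rightarrow> 'a"
  assumes S: "cblin S" and T: "cblin T"
  shows "spectrum_op (S \<circ> T) - {0} \<subseteq> spectrum_op (T \<circ> S) - {0}"
proof
  fix z assume z: "z \<in> spectrum_op (S \<circ> T) - {0}"
  have "z \<in> spectrum_op (T \<circ> S)"
  proof (rule ccontr)
    assume "z \<notin> spectrum_op (T \<circ> S)"
    then obtain Q where Q: "cblin Q" "\<And>x. Q ((T \<circ> S) x - scaleC z x) = x"
        "\<And>x. (T \<circ> S) (Q x) - scaleC z (Q x) = x"
      using not_in_spectrumE by metis
    note Q = Q[unfolded comp_apply]
    \<comment> \<open>This is \<open>z\<close> times the inverse of \<open>S T - z\<close>, as the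
      geometric series suggests: \<open>z (S T - z)\<^sup>-\<^sup>1 = S (T S - z)\<^sup>-\<^sup>1 T
      - 1\<close>.\<close>
    let ?G = "\<lambda>x. S (Q (T x)) - x"
    have "z \<notin> spectrum_op (S \<circ> T)"
    proof (rule not_in_spectrumI_multiple[where G = ?G and k = z])
      show "cblin ?G" "cblin (S \<circ> T)"
        by (intro cblin_minusfun cblin_compose[OF S cblin_compose[OF Q(1) T]] cblin_comp S T cblin_ident)+
      show "z \<noteq> 0" using z by simp
      fix x
      have "Q (T (S (T x) - scaleC z x)) = T x"
        using Q(2)[of "T x"] by (simp add: cblin_diff[OF T] cblin_scaleC[OF T])
      then show "?G ((S \<circ> T) x - scaleC z x) = scaleC z x" by simp
      have "S (T x) = S (T (S (Q (T x))) - scaleC z (Q (T x)))" by (simp add: Q(3))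
      then show "(S \<circ> T) (?G x) - scaleC z (?G x) = scaleC z x"
        by (simp add: cblin_diff[OF T] cblin_diff[OF S] cblin_scaleC[OF S] scaleC.scale_right_diff_distrib
            algebra_simps)
    qed
    with z show False by simp
  qed
  with z show "z \<in> spectrum_op (T \<circ> S) - {0}" by simp
qed

text \<open>If some nonzero point exists, 0 neither changes the supremum of the moduli nor is
  peripheral. Otherwise nonemptiness makes both spectra equal to \<open>{0}\<close>.\<close>

lemma peripheral_spectrum_eqI:
  fixes A :: "'a::complex_banach \<Rightarrow> 'a" and B :: "'b::complex_banach \<Rightarrow> 'b"
  assumes eq: "spectrum_op A - {0} = spectrum_op B - {0}"
    and ne: "spectrum_op A \<noteq> {}" "spectrum_op B \<noteq> {}" and "cblin A" "cblin B"
  shows "peripheral_spectrum A = peripheral_spectrum B"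
proof (cases "spectrum_op A - {0} = {}")
  case True
  with eq ne have "spectrum_op A = {0}" "spectrum_op B = {0}" by auto
  then show ?thesis by (simp add: peripheral_spectrum_def spectral_radius_op_def)
next
  case False
  let ?N = "spectrum_op A - {0}"
  have sup: "Sup (cmod ` \<sigma>) = Sup (cmod ` ?N)"
    if "\<sigma> - {0} = ?N" "\<And>z. z \<in> \<sigma> \<Longrightarrow> cmod z \<le> K" for \<sigma> K
  proof (cases "0 \<in> \<sigma>")
    case True
    then have "\<sigma> = insert 0 ?N" using that(1) by blast
    moreover have "bdd_above (cmod ` ?N)" using that by (intro bdd_aboveI2[of _ _ K]) auto
    moreover obtain w where "w \<in> ?N" using False by blast
    ultimately have "0 \<le> Sup (cmod ` ?N)" by (meson cSUP_upper2 norm_ge_zero)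
    then have "Sup (insert 0 (cmod ` ?N)) = Sup (cmod ` ?N)"
      using \<open>bdd_above (cmod ` ?N)\<close> False by (subst cSup_insert) (auto simp: sup_real_def)
    then show ?thesis using \<open>\<sigma> = insert 0 ?N\<close> by (metis image_insert norm_zero)
  next
    case False
    with that show ?thesis by (metis Diff_insert0 Diff_empty)
  qed
  have rA: "spectral_radius_op A = Sup (cmod ` ?N)"
    unfolding spectral_radius_op_def by (rule sup[OF refl spectrum_norm_le[OF \<open>cblin A\<close>]])
  have rB: "spectral_radius_op B = Sup (cmod ` ?N)"
    unfolding spectral_radius_op_def by (rule sup[OF eq[symmetric] spectrum_norm_le[OF \<open>cblin B\<close>]])
  obtain w where w: "w \<in> ?N" using False by blast
  have "bdd_above (cmod ` ?N)" using spectrum_norm_le[OF \<open>cblin A\<close>] by (intro bdd_aboveI2) auto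
  with w have "cmod w \<le> Sup (cmod ` ?N)" by (intro cSUP_upper)
  moreover have "0 < cmod w" using w by simp
  ultimately have "Sup (cmod ` ?N) > 0" by linarith
  moreover have "z \<in> spectrum_op A \<longleftrightarrow> z \<in> spectrum_op B" if "z \<noteq> 0" for z
    using eq that by blast
  ultimately show ?thesis
    unfolding peripheral_spectrum_def rA rB by (metis (no_types, lifting) less_irrefl norm_zero)
qed

text \<open>The zero space is split off because spectra are empty there; on it any two operators
  coincide.\<close>

lemma peripheral_spectrum_comp_commute:
  fixes S T :: "'a::complex_banach \<Rightarrow> 'a"
  assumes "cblin S" "cblin T"
  shows "peripheral_spectrum (S \<circ> T) = peripheral_spectrum (T \<circ> S)"
proof (cases "\<exists>x0::'a. x0 \<noteq> 0")
  case True
  then show ?thesis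
    using assms spectrum_comp_commute_subset[of S T] spectrum_comp_commute_subset[of T S]
    by (intro peripheral_spectrum_eqI cblin_comp)
      (auto dest: spectrum_nonempty[OF cblin_comp[OF assms]] spectrum_nonempty[OF cblin_comp[OF assms(2,1)]])
next
  case False
  then have "S \<circ> T = T \<circ> S" by (metis (full_types) ext)
  then show ?thesis by simp
qed

section \<open>Peripheral spectra of the operators \<open>y \<otimes> g\<close> and of test
  operators of rank two\<close>

definition rank1 :: "'b::complex_banach \<Rightarrow> ('a::complex_banach \<Rightarrow> complex) \<Rightarrow> 'a \<Rightarrow> 'b" where
  "rank1 y g = (\<lambda>x. scaleC (g x) y)"

lemma rank1_apply: "rank1 y g x = scaleC (g x) y"
  by (simp add: rank1_def)

lemma cblin_rank1: "cblin g \<Longrightarrow> cblin (rank1 y g)"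
  unfolding rank1_def by (rule cblin_scaleC_left)

text \<open>Writing \<open>P\<close> for the operator, \<open>P\<^sup>2 = g(y) P\<close> confines
  the spectrum to 0 and \<open>g y\<close>. The value \<open>g y\<close> always has an eigenvector:
  \<open>y\<close> itself, or \<open>u\<close> when \<open>P\<close> kills both vectors. The
  peripheral spectrum of a rank-one operator is thus its trace.\<close>

lemma peripheral_spectrum_rank1:
  fixes y :: "'a::complex_banach"
  assumes g: "cblin g" and nontriv: "(u::'a) \<noteq> 0"
  shows "peripheral_spectrum (rank1 y g) = {g y}"
proof -
  let ?P = "rank1 y g"
  have P: "cblin ?P" by (rule cblin_rank1[OF g])
  have sub: "z = 0 \<or> z = g y" if "z \<in> spectrum_op ?P" for z
  proof (rule ccontr)
    assume z: "\<not> ?thesis"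
    have k: "- (z * (z - g y)) \<noteq> 0" using z by auto
    have G: "cblin (\<lambda>x. ?P x + scaleC (z - g y) x)"
      by (intro cblin_plus cblin_scaleC_right P cblin_ident)
    have "z \<notin> spectrum_op ?P"
      by (rule not_in_spectrumI_multiple[OF G k _ _ P])
        (auto simp: rank1_apply cblin_add[OF g] cblin_diff[OF g] cblin_scaleC[OF g]
          scaleC.scale_right_diff_distrib scaleC.scale_left_diff_distrib scaleC_add_left scaleC_add_right
          algebra_simps)
    with that show False by simp
  qed
  have gy: "g y \<in> spectrum_op ?P"
  proof (cases "?P y = 0")
    case True
    show ?thesis
    proof (cases "?P u = 0")
      case True
      show ?thesis
      proof (cases "g y = 0")
        case True
        then show ?thesis using \<open>?P u = 0\<close> by (intro eigenvalue_in_spectrum[OF _ nontriv P]) simp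
      next
        case False
        then have "y = 0" using \<open>?P y = 0\<close> by (simp add: rank1_apply)
        then show ?thesis using False by (simp add: cblin_zero[OF g])
      qed
    next
      case False
      then have "y \<noteq> 0" "g y = 0" using \<open>?P y = 0\<close> by (auto simp: rank1_apply)
      then show ?thesis by (intro eigenvalue_in_spectrum[OF _ _ P]) (auto simp: rank1_apply)
    qed
  next
    case False
    then show ?thesis by (intro eigenvalue_in_spectrum[OF _ _ P, of y]) (auto simp: rank1_apply)
  qed
  have "cmod z \<le> cmod (g y)" if "z \<in> spectrum_op ?P" for z using sub[OF that] by auto
  from peripheral_spectrumI[OF this gy refl]
  have "peripheral_spectrum ?P = {z \<in> spectrum_op ?P. cmod z = cmod (g y)}" .
  also have "\<dots> = {g y}" using gy sub by fastforce
  finally show ?thesis .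
qed

lemma spectrum_similar_subset:
  fixes T :: "'a::complex_banach \<Rightarrow> 'b::complex_banach"
  assumes T: "cblin T" and S: "cblin S" and TS: "\<And>y. T (S y) = y" and ST: "\<And>x. S (T x) = x"
  shows "spectrum_op (\<lambda>y. T (F (S y))) \<subseteq> spectrum_op F"
proof
  fix z assume z: "z \<in> spectrum_op (\<lambda>y. T (F (S y)))"
  show "z \<in> spectrum_op F"
  proof (rule ccontr)
    assume "z \<notin> spectrum_op F"
    then obtain Q where Q: "cblin Q" "\<And>x. Q (F x - scaleC z x) = x" "\<And>x. F (Q x) - scaleC z (Q x) = x"
      using not_in_spectrumE by metis
    have "z \<notin> spectrum_op (\<lambda>y. T (F (S y)))"
    proof (rule not_in_spectrumI)
      show "cblin (\<lambda>y. T (Q (S y)))" by (rule cblin_compose[OF T cblin_compose[OF Q(1) S]])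
      show "T (Q (S (T (F (S y)) - scaleC z y))) = y" for y
        using Q(2)[of "S y"] by (simp add: cblin_diff[OF S] cblin_scaleC[OF S] ST TS)
      have "T (F (Q (S y)) - scaleC z (Q (S y))) = y" for y by (simp add: Q TS)
      then show "T (F (S (T (Q (S y))))) - scaleC z (T (Q (S y))) = y" for y
        by (simp add: cblin_diff[OF T] cblin_scaleC[OF T] ST TS)
    qed
    with z show False by simp
  qed
qed

lemma peripheral_spectrum_similar:
  fixes T :: "'a::complex_banach \<Rightarrow> 'b::complex_banach"
  assumes "cblin T" "cblin S" "\<And>y. T (S y) = y" "\<And>x. S (T x) = x"
  shows "peripheral_spectrum (\<lambda>y. T (F (S y))) = peripheral_spectrum F"
proof -
  have "spectrum_op (\<lambda>y. T (F (S y))) = spectrum_op F"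
    using spectrum_similar_subset[of T S F] spectrum_similar_subset[of S T "\<lambda>y. T (F (S y))"] assms
    by simp
  then show ?thesis by (simp add: peripheral_spectrum_def spectral_radius_op_def)
qed
text \<open>The operator \<open>F\<close> satisfies \<open>F\<^sup>3 = \<mu>\<^sup>2 F\<close>, which confines its spectrum.\<close>

lemma peripheral_spectrum_rank2:
  assumes al: "cblin \<alpha>" and be: "cblin \<beta>" and F: "\<And>x. F x = scaleC (\<alpha> x) p + scaleC (\<beta> x) q"
    and val: "\<alpha> p = \<mu>" "\<alpha> q = 0" "\<beta> p = 0" "\<beta> q = - \<mu>" and mu: "\<mu> \<noteq> 0"
  shows "peripheral_spectrum F = {\<mu>, - \<mu>}"
proof -
  have "cblin (\<lambda>x. scaleC (\<alpha> x) p + scaleC (\<beta> x) q)"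
    by (intro cblin_plus cblin_scaleC_left al be)
  then have cF: "cblin F" using F by (metis (no_types, lifting) ext)
  have FF: "F (F x) = scaleC (\<mu> * \<alpha> x) p - scaleC (\<mu> * \<beta> x) q" for x
    by (simp add: F cblin_add[OF al] cblin_add[OF be] cblin_scaleC[OF al] cblin_scaleC[OF be] val mult.commute)
  have F3: "F (F (F x)) = scaleC (\<mu> * \<mu>) (F x)" for x
    unfolding FF[of "F x"]
    by (simp add: F cblin_add[OF al] cblin_add[OF be] cblin_scaleC[OF al] cblin_scaleC[OF be] val
        scaleC_add_right mult_ac)
  have Fp: "F p = scaleC \<mu> p" "F q = scaleC (- \<mu>) q" by (simp_all add: F val)
  have ne: "p \<noteq> 0" "q \<noteq> 0" using val mu cblin_zero[OF al] cblin_zero[OF be] by auto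
  have sub: "z = 0 \<or> z = \<mu> \<or> z = - \<mu>" if "z \<in> spectrum_op F" for z
  proof (rule ccontr)
    assume z: "\<not> ?thesis"
    have "z * (\<mu> * \<mu>) - z * (z * z) = - (z * (z - \<mu>) * (z + \<mu>))" by (simp add: algebra_simps)
    then have k: "z * (\<mu> * \<mu>) - z * (z * z) \<noteq> 0" using z by (auto simp: add_eq_0_iff2)
    \<comment> \<open>For the polynomial \<open>q(t) = t\<^sup>3 - \<mu>\<^sup>2 t\<close>, which
      annihilates \<open>F\<close>, this is the quotient \<open>(q(t) - q(z)) / (t - z)\<close> at
      \<open>F\<close>; hence \<open>(F - z) G = - q(z)\<close>.\<close>
    let ?G = "\<lambda>x. F (F x) + scaleC z (F x) + scaleC (z * z - \<mu> * \<mu>) x"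
    have G: "cblin ?G"
      by (intro cblin_plus cblin_scaleC_right cblin_compose[OF cF cF] cF cblin_ident)
    have "z \<notin> spectrum_op F"
      by (rule not_in_spectrumI_multiple[OF G k _ _ cF])
        (auto simp: cblin_add[OF cF] cblin_diff[OF cF] cblin_scaleC[OF cF] F3 scaleC_add_right
          scaleC.scale_right_diff_distrib scaleC.scale_left_diff_distrib scaleC_add_left
          algebra_simps)
    with that show False by simp
  qed
  have r: "cmod z \<le> cmod \<mu>" if "z \<in> spectrum_op F" for z using sub[OF that] by auto
  have pos: "\<mu> \<in> spectrum_op F" by (rule eigenvalue_in_spectrum[OF Fp(1) ne(1) cF])
  have neg: "- \<mu> \<in> spectrum_op F" by (rule eigenvalue_in_spectrum[OF Fp(2) ne(2) cF])
  have "peripheral_spectrum F = {z \<in> spectrum_op F. cmod z = cmod \<mu>}"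
    by (rule peripheral_spectrumI[OF r pos]) auto
  also have "\<dots> = {\<mu>, - \<mu>}" using pos neg sub mu by fastforce
  finally show ?thesis .
qed

section \<open>Rank-one operators and the generalized product\<close>

lemma cspan_pair: "z \<in> cspan {x, y} \<longleftrightarrow> (\<exists>a b. z = scaleC a x + scaleC b y)"
proof
  assume "z \<in> cspan {x, y}"
  then obtain a b where "z - scaleC a x = scaleC b y"
    by (auto simp: scaleC.span_insert)
  then show "\<exists>a b. z = scaleC a x + scaleC b y" by (metis diff_eq_eq add.commute)
next
  assume "\<exists>a b. z = scaleC a x + scaleC b y"
  then obtain a b where z: "z = scaleC a x + scaleC b y" by blast
  show "z \<in> cspan {x, y}"
    unfolding z by (intro scaleC.span_add scaleC.span_scale scaleC.span_base) simp_all
qed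

lemma rank_le_rank2: "(\<And>x. F x = scaleC (\<alpha> x) p + scaleC (\<beta> x) q) \<Longrightarrow> rank_le F 2"
proof -
  assume F: "\<And>x. F x = scaleC (\<alpha> x) p + scaleC (\<beta> x) q"
  have "card {p, q} \<le> 2" by (simp add: card_insert_if)
  moreover have "range F \<subseteq> cspan {p, q}" unfolding image_subset_iff cspan_pair F by blast
  ultimately show "rank_le F 2" unfolding rank_le_def by (intro exI[of _ "{p, q}"]) simp
qed

lemma rank_le_rank1: "rank_le (rank1 y g) 2"
  by (rule rank_le_rank2[where p = y and \<alpha> = g and \<beta> = "\<lambda>x. 0" and q = y]) (simp add: rank1_apply)

lemma standard_algebra_rank_le:
  assumes "standard_operator_algebra \<A>" "cblin F" "rank_le F n"
  shows "F \<in> \<A>"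
  using assms unfolding standard_operator_algebra_def finite_rank_def rank_le_def by blast

lemma standard_algebra_cblin: "standard_operator_algebra \<A> \<Longrightarrow> F \<in> \<A> \<Longrightarrow> cblin F"
  unfolding standard_operator_algebra_def by blast

lemma standard_algebra_rank1: "standard_operator_algebra \<A> \<Longrightarrow> cblin g \<Longrightarrow> rank1 y g \<in> \<A>"
  by (rule standard_algebra_rank_le[OF _ cblin_rank1 rank_le_rank1])

lemma rank1_comp_left: "cblin S \<Longrightarrow> S \<circ> rank1 y g = rank1 (S y) g"
  by (simp add: fun_eq_iff rank1_apply cblin_scaleC)

lemma rank1_comp_right: "rank1 y g \<circ> S = rank1 y (g \<circ> S)"
  by (simp add: fun_eq_iff rank1_apply)

lemma rank1_funpow:
  assumes g: "cblin g"
  shows "rank1 y g ^^ Suc n = rank1 (scaleC (g y ^ n) y) g"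
proof (induction n)
  case (Suc n)
  have "rank1 y g ^^ Suc (Suc n) = rank1 y g \<circ> (rank1 y g ^^ Suc n)" by simp
  also have "\<dots> = rank1 (scaleC (g y ^ Suc n) y) g"
    unfolding Suc by (simp add: fun_eq_iff rank1_apply cblin_scaleC[OF g] mult_ac)
  finally show ?case .
qed (simp add: fun_eq_iff)

text \<open>The product is again of rank one, and the value is its trace. The condition
  \<open>n \<ge> 1\<close> makes a power of a rank-one operator have rank at most one and gives the
  exponent \<open>n - 1\<close> its usual meaning.\<close>

lemma peripheral_spectrum_comp_rank1_power:
  fixes S :: "'a::complex_banach \<Rightarrow> 'a"
  assumes "cblin g" "cblin S" "n \<ge> 1" "(u::'a) \<noteq> 0"
  shows "peripheral_spectrum (S \<circ> rank1 y g ^^ n) = {g y ^ (n - 1) * g (S y)}"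
proof -
  obtain k where n: "n = Suc k" using \<open>n \<ge> 1\<close> by (cases n) auto
  show ?thesis
    unfolding n rank1_funpow[OF assms(1)] rank1_comp_left[OF assms(2)]
      peripheral_spectrum_rank1[OF assms(1,4)]
    by (simp add: cblin_scaleC[OF assms(1)] cblin_scaleC[OF assms(2)])
qed

text \<open>If an operator of larger rank had these properties, one could choose a test operator \<open>A\<close>
  of rank two making two opposite peripheral eigenvalues appear.\<close>

lemma rank1_if_singleton_spectra:
  fixes B :: "'a::complex_banach \<Rightarrow> 'a"
  assumes B: "cblin B" and n: "n \<ge> 1"
    and c: "peripheral_spectrum (B \<circ> B ^^ n) = {c}" "c \<noteq> 0"
    and s1: "\<And>A. cblin A \<Longrightarrow> rank_le A 2 \<Longrightarrow> \<exists>c. peripheral_spectrum (A \<circ> B ^^ n) \<subseteq> {c}"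
    and s2: "\<And>A. cblin A \<Longrightarrow> rank_le A 2 \<Longrightarrow> \<exists>c. peripheral_spectrum (B \<circ> A ^^ n) \<subseteq> {c}"
  obtains u h where "cblin h" "B = rank1 u h" "h u \<noteq> 0"
proof -
  define C where "C = B ^^ n"
  have C: "cblin C" unfolding C_def by (rule cblin_funpow[OF B])
  have BC: "B (C x) = C (B x)" for x unfolding C_def by (simp add: funpow_swap1)
  \<comment> \<open>If \<open>C\<close> vanished, so would \<open>B \<circ> C\<close>, whose
    spectrum cannot contain the nonzero \<open>c\<close>.\<close>
  obtain x1 where x1: "C x1 \<noteq> 0"
  proof (rule ccontr)
    assume "\<not> thesis"
    then have 0: "B (C x) = 0" for x using that cblin_zero[OF B] by metis
    have "c \<notin> spectrum_op (B \<circ> C)"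
      by (rule not_in_spectrumI[OF cblin_scaleC_right[OF cblin_ident, of "- (1 / c)"]])
        (use \<open>c \<noteq> 0\<close> 0 in simp_all)
    moreover have "c \<in> spectrum_op (B \<circ> C)"
      using c(1) unfolding C_def peripheral_spectrum_def by blast
    ultimately show False by blast
  qed
  define u where "u = C x1"
  have u: "u \<noteq> 0" using x1 by (simp add: u_def)
  have C_span: "C z \<in> cspan {u}" for z
  proof (rule ccontr)
    assume zn: "C z \<notin> cspan {u}"
    have un: "u \<notin> cspan {C z}"
    proof
      assume "u \<in> cspan {C z}"
      then obtain a where a: "u = scaleC a (C z)" by (auto simp: scaleC.span_singleton)
      then have "C z = scaleC (1 / a) u" using u by auto
      then show False using zn by (auto simp: scaleC.span_singleton)
    qed
    obtain g1 :: "'a \<Rightarrow> complex" where g1: "cblin g1" "g1 u = 1" "\<And>w. w \<in> {C z} \<Longrightarrow> g1 w = 0"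
      using functional_vanishing_on_span[OF _ un] by blast
    obtain g2 :: "'a \<Rightarrow> complex" where g2: "cblin g2" "g2 (C z) = 1" "\<And>w. w \<in> {u} \<Longrightarrow> g2 w = 0"
      using functional_vanishing_on_span[OF _ zn] by blast
    \<comment> \<open>The test operator undoes \<open>C\<close> on two independent values, once with
      a sign: \<open>A C x1 = x1\<close> and \<open>A C z = - z\<close>.\<close>
    let ?A = "\<lambda>x. scaleC (g1 x) x1 + scaleC (- g2 x) z"
    have A: "cblin ?A" "rank_le ?A 2"
      by (intro cblin_plus cblin_scaleC_left cblin_uminus g1 g2) (rule rank_le_rank2, rule refl)
    have "peripheral_spectrum (?A \<circ> C) = {1, - 1}"
      by (rule peripheral_spectrum_rank2[where \<alpha> = "\<lambda>x. g1 (C x)" and \<beta> = "\<lambda>x. - g2 (C x)"])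
        (use g1 g2 in \<open>auto simp: u_def intro: cblin_compose[OF g1(1) C]
          cblin_uminus cblin_compose[OF g2(1) C]\<close>)
    then show False using s1[OF A] by (auto simp: C_def)
  qed
  obtain g :: "'a \<Rightarrow> complex" where g: "cblin g" "g u = 1"
    using functional_nonzero[OF u] by blast
  define h where "h = (\<lambda>z. g (C z))"
  have h: "cblin h" unfolding h_def by (rule cblin_compose[OF g(1) C])
  have Ch: "C z = scaleC (h z) u" for z
  proof -
    obtain a where "C z = scaleC a u" using C_span[of z] by (auto simp: scaleC.span_singleton)
    then show ?thesis by (simp add: h_def cblin_scaleC[OF g(1)] g)
  qed
  have hx1: "h x1 = 1" by (simp add: h_def g flip: u_def)
  define \<mu> where "\<mu> = h (B x1)"
  have Bu: "B u = scaleC \<mu> u" using BC[of x1] by (simp add: \<mu>_def Ch hx1)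
  have hB: "h (B z) = \<mu> * h z" for z
  proof -
    have "scaleC (h (B z)) u = B (C z)" unfolding BC by (rule Ch[symmetric])
    also have "\<dots> = scaleC (\<mu> * h z) u" by (simp add: Ch cblin_scaleC[OF B] Bu mult.commute)
    finally have "scaleC (h (B z)) u = scaleC (\<mu> * h z) u" .
    with u show ?thesis by (metis scaleC.scale_cancel_right)
  qed
  have "B \<circ> C = rank1 (scaleC \<mu> u) h"
    by (simp add: fun_eq_iff Ch cblin_scaleC[OF B] Bu rank1_apply)
  with c have "h (scaleC \<mu> u) = c"
    unfolding C_def[symmetric] by (simp add: peripheral_spectrum_rank1[OF h u])
  with c(2) have mu: "\<mu> \<noteq> 0" and hu: "h u \<noteq> 0" by (auto simp: cblin_scaleC[OF h])
  have "B z = scaleC (\<mu> * h z / h u) u" for z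
  proof (rule ccontr)
    assume neq: "B z \<noteq> scaleC (\<mu> * h z / h u) u"
    \<comment> \<open>So far only the power \<open>C\<close> is known to have rank one.
      \<open>B\<close> could still differ from a multiple of \<open>u \<otimes> h\<close> by a
      nilpotent part on the kernel of \<open>h\<close>; \<open>w\<close> is a vector of that kernel
      on which this part is visible.\<close>
    define w where "w = z - scaleC (h z / h u) u"
    have hw: "h w = 0" using hu by (simp add: w_def cblin_diff[OF h] cblin_scaleC[OF h])
    have Bw: "B w \<noteq> 0"
      using neq by (simp add: w_def cblin_diff[OF B] cblin_scaleC[OF B] Bu mult.commute)
    have hBi: "h ((B ^^ i) w) = 0" for i by (induction i) (simp_all add: hw hB)
    have "(B ^^ n) w = 0" using Ch[of w] hw by (simp add: C_def)
    \<comment> \<open>The last two nonzero iterates form a Jordan chain \<open>v\<close>,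
      \<open>t\<close> with \<open>B v = t\<close> and \<open>B t = 0\<close>, independent of the
      eigenvector \<open>u\<close>.\<close>
    define m where "m = (LEAST m. (B ^^ m) w = 0)"
    have m: "(B ^^ m) w = 0" unfolding m_def by (rule LeastI) fact
    have ml: "(B ^^ i) w \<noteq> 0" if "i < m" for i using not_less_Least that unfolding m_def by blast
    have "m \<noteq> 0" using m Bw cblin_zero[OF B] by (intro notI) simp
    moreover have "m \<noteq> 1" using m Bw by (intro notI) simp
    ultimately obtain i where i: "m = Suc (Suc i)" by (metis One_nat_def not0_implies_Suc)
    define v where "v = (B ^^ i) w"
    define t where "t = B v"
    have t: "t \<noteq> 0" using ml[of "Suc i"] by (simp add: i t_def v_def)
    have Bt: "B t = 0" using m by (simp add: i t_def v_def)
    have hv: "h v = 0" and ht: "h t = 0" by (simp_all add: v_def hBi t_def hB)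
    have un: "u \<notin> cspan {v, t}"
      using hu by (auto simp: cspan_pair cblin_add[OF h] cblin_scaleC[OF h] hv ht)
    have vn: "v \<notin> cspan {u, t}"
    proof
      assume "v \<in> cspan {u, t}"
      then obtain a b where v': "v = scaleC a u + scaleC b t" by (auto simp: cspan_pair)
      then have "h v = a * h u" by (simp add: cblin_add[OF h] cblin_scaleC[OF h] ht)
      then have "a = 0" using hv hu by simp
      then have "v = scaleC b t" using v' by simp
      then have "t = scaleC b (B t)" unfolding t_def by (metis cblin_scaleC[OF B])
      with t show False by (simp add: Bt)
    qed
    have tn: "t \<notin> cspan {u, v}"
    proof
      assume "t \<in> cspan {u, v}"
      then obtain a b where t': "t = scaleC a u + scaleC b v" by (auto simp: cspan_pair)
      then have "h t = a * h u" by (simp add: cblin_add[OF h] cblin_scaleC[OF h] hv)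
      then have "a = 0" using ht hu by simp
      then have tb: "t = scaleC b v" using t' by simp
      then have "B t = scaleC b t" by (metis cblin_scaleC[OF B] t_def)
      then have "b = 0" using Bt t by simp
      with tb t show False by simp
    qed
    obtain g1 :: "'a \<Rightarrow> complex" where g1: "cblin g1" "g1 u = 1" "\<And>w. w \<in> {v, t} \<Longrightarrow> g1 w = 0"
      using functional_vanishing_on_span[OF _ un] by blast
    obtain g2 :: "'a \<Rightarrow> complex" where g2: "cblin g2" "g2 v = 1" "\<And>w. w \<in> {u, t} \<Longrightarrow> g2 w = 0"
      using functional_vanishing_on_span[OF _ vn] by blast
    obtain g3 :: "'a \<Rightarrow> complex" where g3: "cblin g3" "g3 t = 1" "\<And>w. w \<in> {u, v} \<Longrightarrow> g3 w = 0"
      using functional_vanishing_on_span[OF _ tn] by blast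
    \<comment> \<open>\<open>A\<close> fixes \<open>u\<close> and \<open>v\<close> and sends
      \<open>t\<close> to \<open>- \<mu> v\<close>. It is idempotent, so its powers do not matter,
      and \<open>B A\<close> has the eigenvalue \<open>\<mu>\<close> at \<open>u\<close> and
      \<open>- \<mu>\<close> at \<open>t\<close>.\<close>
    let ?\<beta> = "\<lambda>x. g2 x - \<mu> * g3 x"
    let ?A = "\<lambda>x. scaleC (g1 x) u + scaleC (?\<beta> x) v"
    have be: "cblin ?\<beta>" by (intro cblin_minusfun cblin_cmult g2 g3)
    have A: "cblin ?A" "rank_le ?A 2"
      by (intro cblin_plus cblin_scaleC_left be g1) (rule rank_le_rank2, rule refl)
    have AA: "?A \<circ> ?A = ?A"
      using g1 g2 g3 by (simp add: fun_eq_iff cblin_add cblin_scaleC)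
    have An: "?A ^^ Suc j = ?A" for j
    proof (induction j)
      case (Suc j)
      have "?A ^^ Suc (Suc j) = ?A \<circ> (?A ^^ Suc j)" by simp
      then show ?case unfolding Suc AA .
    qed (simp add: fun_eq_iff)
    obtain j where j: "n = Suc j" using n by (cases n) auto
    have "peripheral_spectrum (B \<circ> ?A) = {\<mu>, - \<mu>}"
    proof (rule peripheral_spectrum_rank2[where \<alpha> = "\<lambda>x. \<mu> * g1 x" and \<beta> = ?\<beta> and p = u and q = t])
      show "cblin (\<lambda>x. \<mu> * g1 x)" by (rule cblin_cmult[OF g1(1)])
      show "(B \<circ> ?A) x = scaleC (\<mu> * g1 x) u + scaleC (?\<beta> x) t" for x
        by (simp add: cblin_add[OF B] cblin_scaleC[OF B] Bu mult.commute flip: t_def)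
    qed (use g1 g2 g3 be mu in auto)
    moreover obtain d where "peripheral_spectrum (B \<circ> ?A) \<subseteq> {d}"
      using s2[OF A] unfolding j An by blast
    ultimately have "\<mu> = d" "- \<mu> = d" by auto
    then show False using mu by simp
  qed
  then have "B = rank1 u (\<lambda>z. (\<mu> / h u) * h z)" by (simp add: fun_eq_iff rank1_apply)
  moreover have "cblin (\<lambda>z. (\<mu> / h u) * h z)" by (rule cblin_cmult[OF h])
  ultimately show ?thesis using that[of "\<lambda>z. (\<mu> / h u) * h z" u] mu hu by simp
qed

section \<open>Words of operators and the passage to two operators\<close>

lemma gen_prod_append: "gen_prod (xs @ ys) T = gen_prod xs T \<circ> gen_prod ys T"
  by (induction xs) (simp_all add: gen_prod_def comp_assoc)

lemma gen_prod_Cons: "gen_prod (i # xs) T = T i \<circ> gen_prod xs T"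
  and gen_prod_Nil [simp]: "gen_prod [] T = id"
  by (simp_all add: gen_prod_def)

lemma gen_prod_cong: "(\<And>i. i \<in> set xs \<Longrightarrow> S i = T i) \<Longrightarrow> gen_prod xs S = gen_prod xs T"
  by (induction xs) (simp_all add: gen_prod_Cons)

lemma gen_prod_const: "gen_prod xs (\<lambda>i. B) = B ^^ length xs"
  by (induction xs) (simp_all add: gen_prod_Cons)

lemma cblin_gen_prod: "(\<And>i. i \<in> set xs \<Longrightarrow> cblin (T i)) \<Longrightarrow> cblin (gen_prod xs T)"
  by (induction xs) (simp_all add: gen_prod_Cons cblin_comp)

lemma unique_pos_split:
  assumes "unique_pos idx p"
  shows "idx = take p idx @ idx ! p # drop (Suc p) idx"
    and "idx ! p \<notin> set (take p idx)" "idx ! p \<notin> set (drop (Suc p) idx)"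
  using assms unfolding unique_pos_def
  by (auto simp: id_take_nth_drop in_set_conv_nth)

lemma gen_prod_unique_pos:
  assumes "unique_pos idx p"
  shows "gen_prod idx T = gen_prod (take p idx) T \<circ> T (idx ! p) \<circ> gen_prod (drop (Suc p) idx) T"
  by (subst unique_pos_split(1)[OF assms]) (simp only: gen_prod_append gen_prod_Cons comp_assoc)

text \<open>Cycling the factors left of \<open>S\<close> round to the right merges all copies of
  \<open>B\<close> into one power; only their number survives, not the position
  \<open>p\<close>.\<close>

lemma peripheral_spectrum_gen_prod_two:
  fixes S B :: "'a::complex_banach \<Rightarrow> 'a"
  assumes p: "unique_pos idx p" and S: "cblin S" and B: "cblin B"
  shows "peripheral_spectrum (gen_prod idx (\<lambda>j. if j = idx ! p then S else B))
    = peripheral_spectrum (S \<circ> B ^^ (length idx - 1))"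
proof -
  let ?T = "\<lambda>j. if j = idx ! p then S else B"
  note cf = cblin_funpow[OF B]
  have len: "length (drop (Suc p) idx) + length (take p idx) = length idx - 1"
    using p by (simp add: unique_pos_def)
  have "gen_prod (take p idx) ?T = B ^^ length (take p idx)"
    "gen_prod (drop (Suc p) idx) ?T = B ^^ length (drop (Suc p) idx)"
    unfolding gen_prod_const[symmetric] using unique_pos_split(2,3)[OF p]
    by (auto intro!: gen_prod_cong)
  then have "gen_prod idx ?T = B ^^ length (take p idx) \<circ> (S \<circ> B ^^ length (drop (Suc p) idx))"
    unfolding gen_prod_unique_pos[OF p] by (simp add: comp_assoc)
  then have "peripheral_spectrum (gen_prod idx ?T)
    = peripheral_spectrum (B ^^ length (take p idx) \<circ> (S \<circ> B ^^ length (drop (Suc p) idx)))" by simp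
  also have "\<dots> = peripheral_spectrum ((S \<circ> B ^^ length (drop (Suc p) idx)) \<circ> B ^^ length (take p idx))"
    by (rule peripheral_spectrum_comp_commute) (intro cblin_comp S cf)+
  also have "(S \<circ> B ^^ length (drop (Suc p) idx)) \<circ> B ^^ length (take p idx) = S \<circ> B ^^ (length idx - 1)"
    unfolding len[symmetric] funpow_add by (simp add: comp_assoc)
  finally show ?thesis .
qed

text \<open>The case \<open>g y = 0\<close> is reached by perturbation: if \<open>g2\<close> detects
  \<open>D y\<close> but vanishes at \<open>y\<close>, then \<open>g1 + g2\<close> with
  \<open>g1 y = 1\<close> is admissible and still detects \<open>D y\<close>. Linearity of
  \<open>D\<close> does not enter, so \<open>D\<close> may be a difference of values of
  \<open>\<Phi>\<close>.\<close>

lemma operator_eq_zero_if_functionals: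
  fixes D :: "'b::complex_banach \<Rightarrow> 'b"
  assumes "\<And>y g. cblin g \<Longrightarrow> g y \<noteq> 0 \<Longrightarrow> g (D y) = (0::complex)" and "D 0 = 0"
  shows "D y = 0"
proof (rule ccontr)
  assume Dy: "D y \<noteq> 0"
  then have "y \<noteq> 0" using assms(2) by auto
  then obtain g1 :: "'b \<Rightarrow> complex" where g1: "cblin g1" "g1 y = 1"
    using functional_nonzero by blast
  obtain g2 :: "'b \<Rightarrow> complex" where g2: "cblin g2" "g2 (D y) = 1"
    using functional_nonzero[OF Dy] by blast
  have "g1 (D y) = 0" using assms(1)[OF g1(1), of y] g1 by simp
  moreover have "g2 y = 0" using assms(1)[OF g2(1), of y] g2 by auto
  ultimately show False
    using assms(1)[OF cblin_plus[OF g1(1) g2(1)], of y] g1 g2 by simp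
qed

text \<open>All that is kept of the generalized product is the identity for two operators, with
  \<open>n\<close> one less than the width. The vectors \<open>a0\<close> and \<open>b0\<close>
  witness that both spaces are nonzero, so that rank-one operators have singleton peripheral
  spectra.\<close>

locale peripheral_preserver =
  fixes \<A> :: "('a::complex_banach \<Rightarrow> 'a) set" and \<Phi> :: "('a \<Rightarrow> 'a) \<Rightarrow> ('b::complex_banach \<Rightarrow> 'b)"
    and n :: nat and a0 :: 'a and b0 :: 'b
  assumes alg: "standard_operator_algebra \<A>"
    and cblin_image: "S \<in> \<A> \<Longrightarrow> cblin (\<Phi> S)"
    and range: "cblin F \<Longrightarrow> rank_le F 2 \<Longrightarrow> F \<in> \<Phi> ` \<A>"
    and n: "n \<ge> 1"
    and preserves: "S \<in> \<A> \<Longrightarrow> B \<in> \<A> \<Longrightarrow>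
      peripheral_spectrum (\<Phi> S \<circ> \<Phi> B ^^ n) = peripheral_spectrum (S \<circ> B ^^ n)"
    and a0: "a0 \<noteq> 0" and b0: "b0 \<noteq> 0"
begin

lemmas algD = standard_algebra_cblin[OF alg]
lemmas rank1_alg = standard_algebra_rank1[OF alg]

lemma trace_identity:
  fixes f :: "'a \<Rightarrow> complex" and g :: "'b \<Rightarrow> complex"
  assumes "S \<in> \<A>" "cblin f" "cblin g" "\<Phi> (rank1 x f) = rank1 y g"
  shows "g y ^ (n - 1) * g (\<Phi> S y) = f x ^ (n - 1) * f (S x)"
  using preserves[OF assms(1) rank1_alg[OF assms(2), of x]]
  unfolding assms(4) peripheral_spectrum_comp_rank1_power[OF assms(3) cblin_image[OF assms(1)] n b0]
    peripheral_spectrum_comp_rank1_power[OF assms(2) algD[OF assms(1)] n a0]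
  by simp

text \<open>The rank criterion is applied to the image. Each test operator of rank two is a value of
  \<open>\<Phi>\<close> by the hypothesis on the range, so its products with the image have the
  spectra of products with \<open>x \<otimes> f\<close>, which are singletons.\<close>

lemma rank1_image:
  fixes f :: "'a \<Rightarrow> complex"
  assumes f: "cblin f" and fx: "f x \<noteq> 0"
  obtains y and g :: "'b \<Rightarrow> complex" where "cblin g" "\<Phi> (rank1 x f) = rank1 y g" "g y \<noteq> 0"
proof -
  let ?R = "rank1 x f"
  note R = rank1_alg[OF f, of x] and cR = cblin_rank1[OF f, of x]
  have cPhi: "cblin (\<Phi> ?R)" by (rule cblin_image[OF R])
  have 1: "peripheral_spectrum (\<Phi> ?R \<circ> \<Phi> ?R ^^ n) = {f x ^ (n - 1) * f (?R x)}"
    unfolding preserves[OF R R] by (rule peripheral_spectrum_comp_rank1_power[OF f cR n a0])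
  have 2: "f x ^ (n - 1) * f (?R x) \<noteq> 0" using fx by (simp add: rank1_apply cblin_scaleC[OF f])
  have 3: "\<exists>c. peripheral_spectrum (A \<circ> \<Phi> ?R ^^ n) \<subseteq> {c}" if A: "cblin A" "rank_le A 2" for A
  proof -
    obtain S where S: "S \<in> \<A>" "A = \<Phi> S" using range[OF A] by blast
    show ?thesis unfolding S(2) preserves[OF S(1) R]
      peripheral_spectrum_comp_rank1_power[OF f algD[OF S(1)] n a0] by blast
  qed
  have 4: "\<exists>c. peripheral_spectrum (\<Phi> ?R \<circ> A ^^ n) \<subseteq> {c}" if A: "cblin A" "rank_le A 2" for A
  proof -
    obtain S where S: "S \<in> \<A>" "A = \<Phi> S" using range[OF A] by blast
    show ?thesis unfolding S(2) preserves[OF R S(1)] rank1_comp_right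
      peripheral_spectrum_rank1[OF cblin_comp[OF f cblin_funpow[OF algD[OF S(1)]]] a0] by blast
  qed
  show ?thesis using rank1_if_singleton_spectra[OF cPhi n 1 2 3 4] that by blast
qed

text \<open>Here the criterion is applied to a preimage \<open>B\<close>, and the test operators of
  rank two lie in the algebra because it contains all finite-rank operators.\<close>

lemma rank1_preimage:
  fixes g :: "'b \<Rightarrow> complex"
  assumes g: "cblin g" and gy: "g y \<noteq> 0"
  obtains x and f :: "'a \<Rightarrow> complex" where "cblin f" "\<Phi> (rank1 x f) = rank1 y g" "f x \<noteq> 0"
proof -
  let ?R = "rank1 y g"
  note cR = cblin_rank1[OF g, of y]
  obtain B where B: "B \<in> \<A>" "\<Phi> B = ?R" using range[OF cR rank_le_rank1] by auto
  have 1: "peripheral_spectrum (B \<circ> B ^^ n) = {g y ^ (n - 1) * g (?R y)}"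
    unfolding preserves[OF B(1) B(1), symmetric] B(2)
    by (rule peripheral_spectrum_comp_rank1_power[OF g cR n b0])
  have 2: "g y ^ (n - 1) * g (?R y) \<noteq> 0" using gy by (simp add: rank1_apply cblin_scaleC[OF g])
  have 3: "\<exists>c. peripheral_spectrum (A \<circ> B ^^ n) \<subseteq> {c}" if A: "cblin A" "rank_le A 2" for A
  proof -
    note S = standard_algebra_rank_le[OF alg A]
    show ?thesis unfolding preserves[OF S B(1), symmetric] B(2)
      peripheral_spectrum_comp_rank1_power[OF g cblin_image[OF S] n b0] by blast
  qed
  have 4: "\<exists>c. peripheral_spectrum (B \<circ> A ^^ n) \<subseteq> {c}" if A: "cblin A" "rank_le A 2" for A
  proof -
    note S = standard_algebra_rank_le[OF alg A]
    show ?thesis unfolding preserves[OF B(1) S, symmetric] B(2) rank1_comp_right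
      peripheral_spectrum_rank1[OF cblin_comp[OF g cblin_funpow[OF cblin_image[OF S]]] b0] by blast
  qed
  show ?thesis using rank1_if_singleton_spectra[OF algD[OF B(1)] n 1 2 3 4] that B(2) by blast
qed

text \<open>Each matrix entry of \<open>\<Phi> S\<close> against a non-nilpotent pair is a fixed
  linear functional of \<open>S\<close>. This is where linearity of \<open>\<Phi>\<close> comes
  from.\<close>

lemma functional_image:
  fixes g :: "'b \<Rightarrow> complex"
  assumes g: "cblin g" and gy: "g y \<noteq> 0"
  shows "\<exists>x (f :: 'a \<Rightarrow> complex) c. cblin f \<and> (\<forall>S\<in>\<A>. g (\<Phi> S y) = c * f (S x))"
proof -
  obtain x and f :: "'a \<Rightarrow> complex" where f: "cblin f" "\<Phi> (rank1 x f) = rank1 y g" "f x \<noteq> 0"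
    using rank1_preimage[OF g gy] by blast
  have "g (\<Phi> S y) = (f x ^ (n - 1) / g y ^ (n - 1)) * f (S x)" if "S \<in> \<A>" for S
    using trace_identity[OF that f(1) g f(2)] gy by (simp add: field_simps)
  then show ?thesis using f by blast
qed

lemma image_add:
  assumes "S \<in> \<A>" "T \<in> \<A>"
  shows "\<Phi> (\<lambda>x. S x + T x) = (\<lambda>y. \<Phi> S y + \<Phi> T y)"
proof
  fix y
  have ST: "(\<lambda>x. S x + T x) \<in> \<A>" using alg assms unfolding standard_operator_algebra_def by blast
  note c = cblin_image[OF ST] cblin_image[OF assms(1)] cblin_image[OF assms(2)]
  have "\<Phi> (\<lambda>x. S x + T x) y - (\<Phi> S y + \<Phi> T y) = 0"
  proof (rule operator_eq_zero_if_functionals[where D = "\<lambda>y. \<Phi> (\<lambda>x. S x + T x) y - (\<Phi> S y + \<Phi> T y)"])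
    fix y and g :: "'b \<Rightarrow> complex" assume g: "cblin g" "g y \<noteq> 0"
    obtain x c and f :: "'a \<Rightarrow> complex" where f: "cblin f" "\<forall>S\<in>\<A>. g (\<Phi> S y) = c * f (S x)"
      using functional_image[OF g] by blast
    note f(2)[rule_format, simp]
    show "g (\<Phi> (\<lambda>x. S x + T x) y - (\<Phi> S y + \<Phi> T y)) = 0"
      by (simp add: cblin_diff[OF g(1)] cblin_add[OF g(1)] ST assms cblin_add[OF f(1)] distrib_left)
  qed (simp add: c cblin_zero)
  then show "\<Phi> (\<lambda>x. S x + T x) y = \<Phi> S y + \<Phi> T y" by simp
qed

lemma image_scaleC:
  assumes "S \<in> \<A>"
  shows "\<Phi> (\<lambda>x. scaleC a (S x)) = (\<lambda>y. scaleC a (\<Phi> S y))"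
proof
  fix y
  have aS: "(\<lambda>x. scaleC a (S x)) \<in> \<A>" using alg assms unfolding standard_operator_algebra_def by blast
  note c = cblin_image[OF aS] cblin_image[OF assms]
  have "\<Phi> (\<lambda>x. scaleC a (S x)) y - scaleC a (\<Phi> S y) = 0"
  proof (rule operator_eq_zero_if_functionals[where D = "\<lambda>y. \<Phi> (\<lambda>x. scaleC a (S x)) y - scaleC a (\<Phi> S y)"])
    fix y and g :: "'b \<Rightarrow> complex" assume g: "cblin g" "g y \<noteq> 0"
    obtain x c and f :: "'a \<Rightarrow> complex" where f: "cblin f" "\<forall>S\<in>\<A>. g (\<Phi> S y) = c * f (S x)"
      using functional_image[OF g] by blast
    note f(2)[rule_format, simp]
    show "g (\<Phi> (\<lambda>x. scaleC a (S x)) y - scaleC a (\<Phi> S y)) = 0"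
      by (simp add: cblin_diff[OF g(1)] cblin_scaleC[OF g(1)] aS assms cblin_scaleC[OF f(1)])
  qed (simp add: c cblin_zero)
  then show "\<Phi> (\<lambda>x. scaleC a (S x)) y = scaleC a (\<Phi> S y)" by simp
qed

end

section \<open>Rank-one families over a dual pair\<close>

text \<open>Working with an abstract dual pair lets the pairs \<open>(X, X\<^sup>*)\<close> and \<open>(X\<^sup>*, X)\<close>, which give
  rise to the two possible forms of the preserver, be treated alike.\<close>

locale dual_pair =
  fixes p :: "'u::complex_banach \<Rightarrow> 'v::complex_banach \<Rightarrow> complex"
  assumes add_left: "p (u + u') v = p u v + p u' v"
    and add_right: "p u (v + v') = p u v + p u v'"
    and scale_left: "p (scaleC c u) v = c * p u v"
    and scale_right: "p u (scaleC c v) = c * p u v"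
    and bound: "cmod (p u v) \<le> norm u * norm v"
    and norming_left: "K \<ge> 0 \<Longrightarrow> (\<And>v. cmod (p u v) \<le> K * norm v) \<Longrightarrow> norm u \<le> K"
    and norming_right: "K \<ge> 0 \<Longrightarrow> (\<And>u. cmod (p u v) \<le> K * norm u) \<Longrightarrow> norm v \<le> K"
begin

lemma cblin_left: "cblin (\<lambda>u. p u v)"
  using bound by (intro cblinI[where K = "norm v"]) (simp_all add: add_left scale_left mult.commute)

lemma cblin_right: "cblin (p u)"
  using bound by (intro cblinI[where K = "norm u"]) (simp_all add: add_right scale_right)

lemma eq_left:
  assumes "\<And>v. p u v = p u' v"
  shows "u = u'"
proof -
  have "norm (u - u') \<le> 0"
    by (rule norming_left) (simp_all add: assms cblin_diff[OF cblin_left])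
  then show ?thesis by simp
qed

lemma eq_right:
  assumes "\<And>u. p u v = p u v'"
  shows "v = v'"
proof -
  have "norm (v - v') \<le> 0"
    by (rule norming_right) (simp_all add: assms cblin_diff[OF cblin_right])
  then show ?thesis by simp
qed

lemma dual_pair_swap: "dual_pair (\<lambda>v u. p u v)"
  using bound norming_left norming_right
  by unfold_locales (simp_all add: add_left add_right scale_left scale_right mult.commute)

end

definition rank1_structure ::
  "('u::complex_banach \<Rightarrow> 'v::complex_banach \<Rightarrow> complex) \<Rightarrow> ('u \<Rightarrow> 'v \<Rightarrow> 'b::complex_banach \<Rightarrow> 'b)
    \<Rightarrow> ('u \<Rightarrow> 'b) \<Rightarrow> ('b \<Rightarrow> 'u) \<Rightarrow> ('v \<Rightarrow> 'b \<Rightarrow> complex) \<Rightarrow> bool" where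
  "rank1_structure p N T T' S \<longleftrightarrow> cblin T \<and> cblin T' \<and> (\<forall>u. T' (T u) = u) \<and> (\<forall>y. T (T' y) = y) \<and>
    (\<forall>v. cblin (S v)) \<and> (\<forall>v w. S (v + w) = (\<lambda>y. S v y + S w y)) \<and>
    (\<forall>c v. S (scaleC c v) = (\<lambda>y. c * S v y)) \<and> (\<exists>K. \<forall>v. onorm (S v) \<le> K * norm v) \<and>
    (\<forall>g. cblin g \<longrightarrow> (\<exists>v. g = S v)) \<and> (\<forall>u v. S v (T u) = p u v) \<and> (\<forall>u v. N u v = rank1 (T u) (S v))"

text \<open>The trace identity alone determines a number only up to a root of unity; testing it on
  two operators gives two consecutive exponents and removes the ambiguity.\<close>

lemma eq_if_consecutive_powers_eq:
  fixes a b :: "'a::field"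
  assumes "a ^ Suc k = b ^ Suc k" "a ^ Suc (Suc k) = b ^ Suc (Suc k)" "b \<noteq> 0"
  shows "a = b"
proof -
  have "a * b ^ Suc k = b * b ^ Suc k" using assms(1,2) by (metis power_Suc)
  then show ?thesis using \<open>b \<noteq> 0\<close> by simp
qed

text \<open>A sum of two rank-one operators has rank at most one only if the functionals or the
  vectors are proportional. The normalization \<open>g0 y0 = 1\<close> makes the factor explicit,
  and the second alternative is phrased for the operator \<open>y \<otimes> g\<close> so that it
  includes \<open>g = 0\<close>.\<close>

lemma rank1_adjacent:
  fixes g g0 g' :: "'b::complex_banach \<Rightarrow> complex"
  assumes g: "cblin g" and g0: "cblin g0" and g': "cblin g'"
    and eq: "\<And>z. scaleC (g z) y + scaleC (g0 z) y0 = scaleC (g' z) y'" and one: "g0 y0 = 1"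
  shows "(\<forall>z. g z = g0 z * g y0) \<or> (\<forall>z. scaleC (g z) y = scaleC (g0 (scaleC (g z) y)) y0)"
proof (rule disjCI)
  assume "\<not> (\<forall>z. scaleC (g z) y = scaleC (g0 (scaleC (g z) y)) y0)"
  then have neg: "\<not> (\<exists>d. y0 = scaleC d y)"
  proof (rule contrapos_nn)
    assume "\<exists>d. y0 = scaleC d y"
    then obtain d where d: "y0 = scaleC d y" by blast
    with one have "d * g0 y = 1" by (simp add: cblin_scaleC[OF g0])
    then show "\<forall>z. scaleC (g z) y = scaleC (g0 (scaleC (g z) y)) y0"
      by (simp add: d cblin_scaleC[OF g0] mult.assoc mult.commute[of "g0 y"])
  qed
  have y: "y \<noteq> 0"
  proof
    assume "y = 0"
    with \<open>\<not> (\<forall>z. scaleC (g z) y = scaleC (g0 (scaleC (g z) y)) y0)\<close> show False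
      by (simp add: cblin_zero[OF g0])
  qed
  show "\<forall>z. g z = g0 z * g y0"
  proof (rule ccontr)
    assume "\<not> ?thesis"
    then obtain z where z: "g z \<noteq> g0 z * g y0" by blast
    \<comment> \<open>On the kernel of \<open>g0\<close> only the first summand is left, so
      \<open>y'\<close> is a multiple of \<open>y\<close>; evaluating at \<open>y0\<close> then
      makes \<open>y0\<close> a multiple of \<open>y\<close> too.\<close>
    define w where "w = z - scaleC (g0 z) y0"
    have gw: "g0 w = 0" "g w \<noteq> 0"
      using z one by (simp_all add: w_def cblin_diff[OF g0] cblin_scaleC[OF g0] cblin_diff[OF g] cblin_scaleC[OF g])
    have w1: "scaleC (g w) y = scaleC (g' w) y'" using eq[of w] gw by simp
    then have g'w: "g' w \<noteq> 0" using y gw by auto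
    have "y' = scaleC (1 / g' w) (scaleC (g' w) y')" using g'w by simp
    also have "\<dots> = scaleC (g w / g' w) y" unfolding w1[symmetric] by simp
    finally have y': "y' = scaleC (g w / g' w) y" .
    have "y0 = scaleC (g' y0) y' - scaleC (g y0) y" using eq[of y0] one by (simp add: eq_diff_eq add.commute)
    also have "\<dots> = scaleC (g' y0 * (g w / g' w) - g y0) y"
      by (simp add: y' scaleC.scale_left_diff_distrib)
    finally show False using neg by blast
  qed
qed

text \<open>\<open>N u v\<close> stands for the normalized image of \<open>u \<otimes> v\<close>,
  and \<open>k\<close> for \<open>n - 1\<close>. Rank one is known only off the zero set of the
  pairing. The base data let \<open>x0\<close> or \<open>f0\<close> be added to leave that zero
  set.\<close>

locale rank1_family = dual_pair p
  for p :: "'u::complex_banach \<Rightarrow> 'v::complex_banach \<Rightarrow> complex" +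
  fixes N :: "'u \<Rightarrow> 'v \<Rightarrow> 'b::complex_banach \<Rightarrow> 'b" and k :: nat
    and x0 :: 'u and f0 :: 'v and y0 :: 'b and g0 :: "'b \<Rightarrow> complex"
  assumes cblin_N: "cblin (N u v)"
    and N_add_left: "N (u + u') v z = N u v z + N u' v z"
    and N_add_right: "N u (v + v') z = N u v z + N u v' z"
    and N_scale_left: "N (scaleC c u) v z = scaleC c (N u v z)"
    and N_scale_right: "N u (scaleC c v) z = scaleC c (N u v z)"
    and N_rank1: "p u v \<noteq> 0 \<Longrightarrow> \<exists>y g. cblin g \<and> N u v = rank1 y g"
    and N_onto: "cblin g \<Longrightarrow> g y \<noteq> 0 \<Longrightarrow> \<exists>u v. p u v \<noteq> 0 \<and> N u v = rank1 y g"
    and N_trace: "cblin g \<Longrightarrow> p u v \<noteq> 0 \<Longrightarrow> N u v = rank1 y g \<Longrightarrow>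
      g y ^ k * g (N u' v' y) = p u v ^ k * (p u v' * p u' v)"
    and base: "p x0 f0 = 1" "cblin g0" "N x0 f0 = rank1 y0 g0" "g0 y0 = 1"
begin

lemma rank1_family_swap: "rank1_family (\<lambda>v u. p u v) (\<lambda>v u. N u v) k f0 x0 y0 g0"
proof (intro rank1_family.intro dual_pair_swap rank1_family_axioms.intro)
  fix u :: 'u and v :: 'v and y and g :: "'b \<Rightarrow> complex" and u' v'
  assume "cblin g" "p u v \<noteq> 0" "N u v = rank1 y g"
  from N_trace[OF this, of u' v']
  show "g y ^ k * g (N u' v' y) = p u v ^ k * (p u' v * p u v')" by (simp add: mult.commute)
next
  fix g :: "'b \<Rightarrow> complex" and y assume "cblin g" "g y \<noteq> 0"
  from N_onto[OF this] show "\<exists>v u. p u v \<noteq> 0 \<and> N u v = rank1 y g" by blast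
qed (simp_all add: cblin_N N_add_left N_add_right N_scale_left N_scale_right N_rank1 base)

text \<open>In a column the functional stays \<open>g0\<close> while the vector moves; in a row the
  vector stays \<open>y0\<close> while the functional moves. A column in \<open>u\<close> together
  with a row in \<open>v\<close> leads to the similarity form, the opposite combination to the
  adjoint form.\<close>

definition column_type where "column_type \<longleftrightarrow> (\<forall>u z. N u f0 z = scaleC (g0 z) (N u f0 y0))"
definition row_type where "row_type \<longleftrightarrow> (\<forall>u z. N u f0 z = scaleC (g0 (N u f0 z)) y0)"
definition dual_column_type where "dual_column_type \<longleftrightarrow> (\<forall>v z. N x0 v z = scaleC (g0 z) (N x0 v y0))"
definition dual_row_type where "dual_row_type \<longleftrightarrow> (\<forall>v z. N x0 v z = scaleC (g0 (N x0 v z)) y0)"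

lemma N_base: "N x0 f0 z = scaleC (g0 z) y0"
  by (simp add: base rank1_apply)

text \<open>The vectors \<open>u\<close> satisfying either condition form a subspace, and a vector space is not the
  union of two proper subspaces.\<close>

lemma column_or_row_type: "column_type \<or> row_type"
proof -
  define P where "P u \<longleftrightarrow> (\<forall>z. N u f0 z = scaleC (g0 z) (N u f0 y0))" for u
  define Q where "Q u \<longleftrightarrow> (\<forall>z. N u f0 z = scaleC (g0 (N u f0 z)) y0)" for u
  have Nd: "N (u - w) f0 z = N u f0 z - N w f0 z" for u w z
    using N_add_left[of "u - w" w f0 z] by simp
  have Padd: "P (u - w)" if "P u" "P w" for u w
    using that unfolding P_def Nd by (metis scaleC.scale_right_diff_distrib)
  have Qadd: "Q (u - w)" if "Q u" "Q w" for u w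
    using that unfolding Q_def Nd by (metis scaleC.scale_left_diff_distrib cblin_diff[OF base(2)])
  have x0: "P (scaleC c x0)" "Q (scaleC c x0)" for c
    by (simp_all add: P_def Q_def N_scale_left base rank1_apply cblin_scaleC[OF base(2)] mult.commute)
  \<comment> \<open>On this affine hyperplane both \<open>u\<close> and \<open>u + x0\<close> pair
    with \<open>f0\<close> to a nonzero number (1 and 2), so both images have rank one. Any other
    vector is moved onto it by a multiple of \<open>x0\<close>, and such multiples satisfy both
    conditions.\<close>
  have one: "P u \<or> Q u" if "p u f0 = 1" for u
  proof -
    obtain y g where g: "cblin g" "N u f0 = rank1 y g" using N_rank1[of u f0] \<open>p u f0 = 1\<close> by auto
    have "p (u + x0) f0 \<noteq> 0" using that by (simp add: add_left base)
    then obtain y' g' where g': "cblin g'" "N (u + x0) f0 = rank1 y' g'" using N_rank1 by blast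
    have "scaleC (g z) y + scaleC (g0 z) y0 = scaleC (g' z) y'" for z
      using N_add_left[of u x0 f0 z] by (simp add: g g' N_base rank1_apply)
    from rank1_adjacent[OF g(1) base(2) g'(1) this base(4)]
    show ?thesis by (auto simp: P_def Q_def g rank1_apply)
  qed
  have "P u \<or> Q u" for u
  proof -
    define c where "c = 1 - p u f0"
    have "P (u - scaleC (- c) x0) \<or> Q (u - scaleC (- c) x0)"
      by (rule one) (simp add: cblin_diff[OF cblin_left] scale_left base c_def)
    moreover have "u - scaleC (- c) x0 - scaleC c x0 = u" by simp
    ultimately show ?thesis using Padd Qadd x0 by metis
  qed
  then have "(\<forall>u. P u) \<or> (\<forall>u. Q u)"
    using Padd Qadd by (metis diff_add_cancel add_diff_cancel_left')
  then show ?thesis by (auto simp: P_def Q_def column_type_def row_type_def)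
qed

text \<open>The candidates are forced: if \<open>N u v = T u \<otimes> S v\<close> with
  \<open>T x0 = y0\<close> and \<open>S f0 = g0\<close>, then \<open>g0 y0 = 1\<close> yields these
  two formulas.\<close>

abbreviation "T u \<equiv> N u f0 y0"
abbreviation "S v \<equiv> \<lambda>z. g0 (N x0 v z)"

lemma cblin_S: "cblin (S v)"
  by (rule cblin_compose[OF base(2) cblin_N])

lemma S_add: "S (v + w) z = S v z + S w z"
  by (simp add: N_add_right cblin_add[OF base(2)])

lemma S_scale: "S (scaleC c v) z = c * S v z"
  by (simp add: N_scale_right cblin_scaleC[OF base(2)])

lemma T_base: "T x0 = y0" and S_base: "S f0 z = g0 z"
  by (simp_all add: base rank1_apply cblin_scaleC[OF base(2)])

context
  assumes col: column_type
begin

lemma N_column: "N u f0 = rank1 (T u) g0"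
proof
  show "N u f0 z = rank1 (T u) g0 z" for z
    using col unfolding column_type_def rank1_apply by blast
qed

text \<open>Testing the trace identity against \<open>N x0 f0\<close> and \<open>N u f0\<close>
  yields the exponents \<open>k + 1\<close> and \<open>k + 2\<close>. Vectors with
  \<open>p u f0 = 0\<close> are reached by adding \<open>x0\<close>.\<close>

lemma g0_T: "g0 (T u) = p u f0"
proof -
  have *: "g0 (T u) = p u f0" if "p u f0 \<noteq> 0" for u
  proof (rule eq_if_consecutive_powers_eq[OF _ _ that])
    note tr = N_trace[OF base(2) that N_column]
    show "g0 (T u) ^ Suc k = p u f0 ^ Suc k"
      using tr[of x0 f0] by (simp add: base rank1_apply cblin_scaleC[OF base(2)] mult.commute)
    have "N u f0 (T u) = scaleC (g0 (T u)) (T u)"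
      by (metis N_column rank1_apply)
    then show "g0 (T u) ^ Suc (Suc k) = p u f0 ^ Suc (Suc k)"
      using tr[of u f0] by (simp add: cblin_scaleC[OF base(2)] mult_ac)
  qed
  show ?thesis
  proof (cases "p u f0 = 0")
    case True
    then have "g0 (T (u + x0)) = p (u + x0) f0" by (intro *) (simp add: add_left base)
    then show ?thesis using True by (simp add: N_add_left T_base add_left base(1,4) cblin_add[OF base(2)])
  qed (rule *)
qed

lemma g0_N_T: "g0 (N u' v' (T u)) = p u v' * p u' f0"
proof -
  have *: "g0 (N u' v' (T u)) = p u v' * p u' f0" if "p u f0 \<noteq> 0" for u
    using N_trace[OF base(2) that N_column, of u' v'] that by (simp add: g0_T)
  show ?thesis
  proof (cases "p u f0 = 0")
    case True
    then have "g0 (N u' v' (T (u + x0))) = p (u + x0) v' * p u' f0"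
      by (intro *) (simp add: add_left base)
    moreover have "g0 (N u' v' (T x0)) = p x0 v' * p u' f0" by (rule *) (simp add: base)
    ultimately show ?thesis
      by (simp add: N_add_left add_left cblin_add[OF base(2)] cblin_add[OF cblin_N] distrib_right)
  qed (rule *)
qed

end

context
  assumes drow: dual_row_type
begin

lemma N_dual_row: "N x0 v = rank1 y0 (S v)"
proof
  show "N x0 v z = rank1 y0 (S v) z" for z
    using drow unfolding dual_row_type_def rank1_apply by blast
qed

lemma S_y0: "S v y0 = p x0 v"
proof -
  have *: "S v y0 = p x0 v" if "p x0 v \<noteq> 0" for v
  proof (rule eq_if_consecutive_powers_eq[OF _ _ that])
    note tr = N_trace[OF cblin_S that N_dual_row]
    show "S v y0 ^ Suc k = p x0 v ^ Suc k"
      using tr[of x0 f0] by (simp add: base rank1_apply mult.commute)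
    have "N x0 v y0 = scaleC (S v y0) y0"
      by (metis N_dual_row rank1_apply)
    then have "S v (N x0 v y0) = S v y0 * S v y0"
      by (metis cblin_scaleC[OF cblin_S] scaleC_complex)
    then show "S v y0 ^ Suc (Suc k) = p x0 v ^ Suc (Suc k)"
      using tr[of x0 v] by (simp add: mult_ac)
  qed
  show ?thesis
  proof (cases "p x0 v = 0")
    case True
    then have "S (v + f0) y0 = p x0 (v + f0)" by (intro *) (simp add: add_right base)
    then show ?thesis using True by (simp add: S_add S_base add_right base(1,4) del: N_add_right)
  qed (rule *)
qed

lemma S_N_y0: "S v (N u' v' y0) = p x0 v' * p u' v"
proof -
  have *: "S v (N u' v' y0) = p x0 v' * p u' v" if "p x0 v \<noteq> 0" for v
    using N_trace[OF cblin_S that N_dual_row, of u' v'] that by (simp add: S_y0)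
  show ?thesis
  proof (cases "p x0 v = 0")
    case True
    then have "S (v + f0) (N u' v' y0) = p x0 v' * p u' (v + f0)"
      by (intro *) (simp add: add_right base)
    moreover have "S f0 (N u' v' y0) = p x0 v' * p u' f0" by (rule *) (simp add: base)
    ultimately show ?thesis
      by (simp add: S_add add_right distrib_left)
  qed (rule *)
qed

end

text \<open>The combination is degenerate rather than contradictory: two column conditions make
  every \<open>v\<close> a multiple of \<open>f0\<close>, so the space has dimension one, where
  columns and rows coincide.\<close>

lemma dual_row_if_columns:
  assumes col: column_type and dual_column_type
  shows dual_row_type
  unfolding dual_row_type_def
proof (intro allI)
  fix v z
  define c where "c = g0 (N x0 v y0)"
  have "p u v = p u (scaleC c f0)" for u
  proof -
    have "N x0 v (T u) = scaleC (g0 (T u)) (N x0 v y0)"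
      using \<open>dual_column_type\<close> unfolding dual_column_type_def by blast
    then have "g0 (N x0 v (T u)) = p u f0 * c"
      by (simp add: g0_T[OF col] cblin_scaleC[OF base(2)] c_def)
    then show ?thesis using g0_N_T[OF col, of x0 v u] by (simp add: base scale_right mult.commute)
  qed
  then have v: "v = scaleC c f0" by (rule eq_right)
  show "N x0 v z = scaleC (g0 (N x0 v z)) y0"
    unfolding v by (simp add: N_scale_right base rank1_apply cblin_scaleC[OF base(2)])
qed

lemma column_if_rows:
  assumes row_type and drow: dual_row_type
  shows column_type
  unfolding column_type_def
proof (intro allI)
  fix u z
  define c where "c = g0 (N u f0 y0)"
  have "p u v = p (scaleC c x0) v" for v
  proof -
    have "N u f0 y0 = scaleC c y0"
      using \<open>row_type\<close> unfolding row_type_def c_def by blast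
    then have "S v (N u f0 y0) = c * p x0 v"
      using S_y0[OF drow, of v] by (metis cblin_scaleC[OF cblin_S] scaleC_complex)
    then show ?thesis using S_N_y0[OF drow, of v u f0] by (simp add: base scale_left)
  qed
  then have u: "u = scaleC c x0" by (rule eq_left)
  show "N u f0 z = scaleC (g0 z) (N u f0 y0)"
    unfolding u by (simp add: N_scale_left base rank1_apply mult.commute)
qed

text \<open>Surjectivity of both factors comes from \<open>N_onto\<close>. Because every functional
  on the target is then some \<open>S v\<close>, the factorization of \<open>N\<close> can be tested
  on known pairings, and boundedness of \<open>T\<close> and of its inverse follows from uniform
  boundedness.\<close>

lemma structure_if_column:
  assumes col: column_type and drow: dual_row_type
  shows "\<exists>T T' S. rank1_structure p N T T' S"
proof -
  have ST: "S v (T u) = p u v" for u v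
    using g0_N_T[OF col, of x0 v u] by (simp add: base)
  have T_add: "T (u + w) = T u + T w" and T_scale: "T (scaleC c u) = scaleC c (T u)" for u w c
    by (simp_all add: N_add_left N_scale_left)
  have y0: "y0 \<noteq> 0" using base cblin_zero[OF base(2)] by auto
  \<comment> \<open>The trace identity forces \<open>f0\<close> to be a multiple of the second entry
    of any preimage of \<open>y \<otimes> g0\<close>, so after rescaling the preimage lies in the
    column of \<open>f0\<close>.\<close>
  have T_onto1: "\<exists>u. y = T u" if y1: "g0 y = 1" for y
  proof -
    obtain u v where uv: "p u v \<noteq> 0" "N u v = rank1 y g0" using N_onto[OF base(2), of y] y1 by auto
    define D where "D = p u v ^ k * p u f0"
    have "p u' f0 = p u' (scaleC D v)" for u'
    proof -
      have "N u' f0 y = scaleC (g0 y) (T u')" using col unfolding column_type_def by blast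
      then have "g0 (N u' f0 y) = p u' f0" by (simp add: y1 g0_T[OF col])
      then show ?thesis using N_trace[OF base(2) uv, of u' f0] y1 by (simp add: D_def scale_right)
    qed
    then have f0: "f0 = scaleC D v" by (rule eq_right)
    have "D \<noteq> 0"
    proof
      assume "D = 0"
      then have "p x0 f0 = p x0 (scaleC 0 v)" using f0 by simp
      then show False using base(1) scale_right[of x0 0 v] by simp
    qed
    then have "T (scaleC (1 / D) u) = N u v y0" unfolding f0 by (simp add: N_scale_left N_scale_right)
    then have "T (scaleC (1 / D) u) = y" using uv(2) base(4) by (simp add: rank1_apply)
    then show ?thesis by blast
  qed
  have T_onto: "\<exists>u. y = T u" for y
  proof (cases "g0 y = 0")
    case True
    then obtain u where "y + y0 = T u" using T_onto1[of "y + y0"] by (auto simp: cblin_add[OF base(2)] base)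
    moreover have "T u = T (u - x0) + T x0" by (metis T_add diff_add_cancel)
    ultimately show ?thesis by (metis T_base add_right_imp_eq)
  next
    case False
    then obtain u where u: "scaleC (1 / g0 y) y = T u"
      using T_onto1[of "scaleC (1 / g0 y) y"] by (auto simp: cblin_scaleC[OF base(2)])
    have "T (scaleC (g0 y) u) = scaleC (g0 y) (scaleC (1 / g0 y) y)" unfolding u by (rule T_scale)
    then have "T (scaleC (g0 y) u) = y" using False by simp
    then show ?thesis by metis
  qed
  \<comment> \<open>Likewise \<open>x0\<close> is a multiple of the first entry of a preimage of
    \<open>y0 \<otimes> g\<close>.\<close>
  have S_onto1: "\<exists>v. g = S v" if g: "cblin g" "g y0 = 1" for g
  proof -
    obtain u v where uv: "p u v \<noteq> 0" "N u v = rank1 y0 g" using N_onto[OF g(1), of y0] g(2) by auto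
    define D where "D = p u v ^ k * p x0 v"
    have "p x0 v' = p (scaleC D u) v'" for v'
    proof -
      have "N x0 v' y0 = scaleC (S v' y0) y0" using drow unfolding dual_row_type_def by blast
      then have "g (N x0 v' y0) = p x0 v'"
        unfolding S_y0[OF drow] by (simp add: cblin_scaleC[OF g(1)] g(2))
      then show ?thesis using N_trace[OF g(1) uv, of x0 v'] g(2) by (simp add: D_def scale_left mult_ac)
    qed
    then have x0: "x0 = scaleC D u" by (rule eq_left)
    have "D \<noteq> 0"
    proof
      assume "D = 0"
      then have "p x0 f0 = p (scaleC 0 u) f0" using x0 by simp
      then show False using base(1) scale_left[of 0 u f0] by simp
    qed
    then have "N x0 (scaleC (1 / D) v) z = N u v z" for z unfolding x0 by (simp add: N_scale_left N_scale_right)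
    then have "S (scaleC (1 / D) v) z = g z" for z
      using uv(2) base(4) by (simp add: rank1_apply cblin_scaleC[OF base(2)])
    then show ?thesis by (intro exI[of _ "scaleC (1 / D) v"]) (simp add: fun_eq_iff)
  qed
  have S_onto: "\<exists>v. g = S v" if g: "cblin g" for g
  proof (cases "g y0 = 0")
    case True
    then obtain v where v: "(\<lambda>z. g z + g0 z) = S v"
      using S_onto1[OF cblin_plus[OF g base(2)]] by (auto simp: base)
    have "S v z = S (v - f0) z + S f0 z" for z by (metis S_add diff_add_cancel)
    then have "g z = S (v - f0) z" for z using fun_cong[OF v, of z] by (simp add: S_base)
    then show ?thesis by blast
  next
    case False
    then obtain v where v: "(\<lambda>z. (1 / g y0) * g z) = S v"
      using S_onto1[OF cblin_cmult[OF g, of "1 / g y0"]] by auto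
    have "g z = S (scaleC (g y0) v) z" for z
      using fun_cong[OF v, of z] False unfolding S_scale by (simp add: field_simps)
    then show ?thesis by blast
  qed
  \<comment> \<open>For \<open>N u v = y \<otimes> g\<close>, pairing with \<open>g0\<close>
    identifies \<open>g\<close> and evaluating at \<open>y0\<close> identifies \<open>y\<close>,
    each up to a scalar. The product of these scalars is \<open>p u f0 * p x0 v\<close>, which is
    nonzero here.\<close>
  have gen: "N u v z = scaleC (S v z) (T u)" if nz: "p u v \<noteq> 0" "p u f0 \<noteq> 0" "p x0 v \<noteq> 0" for u v z
  proof -
    obtain y g where g: "cblin g" "N u v = rank1 y g" using N_rank1[OF nz(1)] by blast
    have 1: "g0 y * g z = p u f0 * S v z" for z
    proof -
      obtain u' where u': "z = T u'" using T_onto by blast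
      show ?thesis using g0_N_T[OF col, of u v u'] unfolding u' ST g(2) rank1_apply
        by (simp add: cblin_scaleC[OF base(2)] mult.commute)
    qed
    have 2: "scaleC (g y0) y = scaleC (p x0 v) (T u)"
    proof (rule functionals_separate)
      fix h :: "'b \<Rightarrow> complex" assume h: "cblin h"
      then obtain v' where v': "h = S v'" using S_onto by blast
      have "h (N u v y0) = p x0 v * h (T u)" unfolding v' by (simp add: S_N_y0[OF drow] base(1))
      then show "h (scaleC (g y0) y) = h (scaleC (p x0 v) (T u))"
        unfolding g(2) rank1_apply by (simp add: cblin_scaleC[OF h])
    qed
    have gy: "g0 y * g y0 = p u f0 * p x0 v" using 1[of y0] by (simp add: S_y0[OF drow])
    then have "g0 y \<noteq> 0" "g y0 \<noteq> 0" using nz by auto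
    have "scaleC (g0 y * g y0) (N u v z) = scaleC (g0 y * g z) (scaleC (g y0) y)"
      by (simp add: g(2) rank1_apply mult_ac)
    also have "\<dots> = scaleC (g0 y * g y0) (scaleC (S v z) (T u))"
      unfolding 1 2 by (simp add: S_y0[OF drow] mult_ac)
    finally show ?thesis using \<open>g0 y \<noteq> 0\<close> \<open>g y0 \<noteq> 0\<close>
      by (metis scaleC.scale_left_imp_eq mult_eq_0_iff)
  qed
  have gen2: "N u v z = scaleC (S v z) (T u)" if nz: "p x0 v \<noteq> 0" for u v z
  proof -
    have "infinite (UNIV :: complex set)" by (rule infinite_UNIV_char_0)
    \<comment> \<open>The excluded values are the zeros of the two pairings with
      \<open>u + s x0\<close>; the identity for \<open>x0\<close> is subtracted afterwards.\<close>
    then obtain s where s: "s \<notin> {0, - p u v / p x0 v, - p u f0}"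
      using ex_new_if_finite[of "{0, - p u v / p x0 v, - p u f0}"] by auto
    have ne: "p (u + scaleC s x0) v \<noteq> 0" "p (u + scaleC s x0) f0 \<noteq> 0"
      using s nz by (auto simp: add_left scale_left base field_simps add_eq_0_iff2)
    have x0: "N x0 v z = scaleC (S v z) (T x0)" by (rule gen[OF nz _ nz]) (simp add: base)
    have "N (u + scaleC s x0) v z = scaleC (S v z) (T (u + scaleC s x0))" by (rule gen[OF ne nz])
    then have "N u v z + scaleC s (N x0 v z) = scaleC (S v z) (T u) + scaleC s (scaleC (S v z) (T x0))"
      by (simp add: N_add_left N_scale_left scaleC_add_right mult.commute)
    then show ?thesis unfolding x0[symmetric] by (rule add_right_imp_eq)
  qed
  have N_eq: "N u v z = scaleC (S v z) (T u)" for u v z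
  proof (cases "p x0 v = 0")
    case True
    then have "N u (v + f0) z = scaleC (S (v + f0) z) (T u)" by (intro gen2) (simp add: add_right base)
    moreover have "N u f0 z = scaleC (S f0 z) (T u)" by (rule gen2) (simp add: base)
    ultimately show ?thesis by (simp add: N_add_right S_add scaleC_add_left cblin_add[OF base(2)])
  qed (rule gen2)
  have inj: "u = w" if "T u = T w" for u w
  proof (rule eq_left)
    fix v show "p u v = p w v" using that by (metis ST)
  qed
  have scale_bound: "norm (L u) \<le> K * norm u"
    if sc: "\<And>c u. L (scaleC c u) = scaleC c (L u)" and K: "\<And>u. norm u \<le> 1 \<Longrightarrow> norm (L u) \<le> K"
    for L :: "'x::complex_banach \<Rightarrow> 'y::complex_banach" and K and u :: 'x
  proof (cases "u = 0")
    case True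
    then show ?thesis using sc[of 0 u] by simp
  next
    case False
    have "norm (L (scaleC (of_real (1 / norm u)) u)) \<le> K" by (rule K) (use False in \<open>simp add: norm_divide\<close>)
    then show ?thesis using False unfolding sc norm_scaleC norm_of_real by (simp add: field_simps)
  qed
  \<comment> \<open>The vectors \<open>T u\<close> with \<open>u\<close> in the unit ball act on the
    dual of the target. They are pointwise bounded because every functional there is some
    \<open>S v\<close>, and \<open>S v (T u) = p u v\<close>.\<close>
  obtain K1 where K1: "K1 \<ge> 0" "\<And>f x. f \<in> (\<lambda>u g. dual_apply g (T u)) ` cball 0 1 \<Longrightarrow> cmod (f x) \<le> K1 * norm x"
  proof (rule uniform_boundedness[of "(\<lambda>u g. dual_apply g (T u)) ` cball 0 1"])
    fix f assume "f \<in> (\<lambda>u g. dual_apply g (T u)) ` cball 0 1"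
    then obtain u where f: "f = (\<lambda>g. dual_apply g (T u))" by blast
    show "cblin f" unfolding f
      by (rule cblinI[where K = "norm (T u)"])
        (simp_all add: plus_cdual.rep_eq scaleC_cdual.rep_eq dual_apply_bound mult.commute)
  next
    fix g :: "'b cdual"
    obtain v where v: "dual_apply g = S v" using S_onto[OF cblin_dual_apply] by blast
    have "cmod (dual_apply g (T u)) \<le> norm v" if "norm u \<le> 1" for u
    proof -
      have "cmod (p u v) \<le> norm u * norm v" by (rule bound)
      also have "\<dots> \<le> 1 * norm v" using that by (intro mult_right_mono) auto
      finally show ?thesis unfolding v ST by simp
    qed
    then show "\<exists>K. \<forall>f\<in>(\<lambda>u g. dual_apply g (T u)) ` cball 0 1. cmod (f g) \<le> K"
      by (intro exI[of _ "norm v"]) auto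
  qed blast
  have T_bound: "norm (T u) \<le> K1 * norm u" for u
  proof (rule scale_bound)
    fix u :: 'u assume u: "norm u \<le> 1"
    show "norm (T u) \<le> K1"
    proof (rule norm_le_of_functionals[OF _ K1(1)])
      fix f :: "'b \<Rightarrow> complex" assume f: "cblin f"
      have "norm (Abs_cdual f) = onorm f" using f by (simp add: norm_cdual.rep_eq)
      moreover have "cmod (dual_apply (Abs_cdual f) (T u)) \<le> K1 * norm (Abs_cdual f)"
        by (rule K1(2)) (use u in auto)
      ultimately show "cmod (f (T u)) \<le> K1 * onorm f" using f by simp
    qed
  qed (rule T_scale)
  define T' where "T' y = (SOME u. y = T u)" for y
  have TT': "T (T' y) = y" for y unfolding T'_def using someI_ex[OF T_onto[of y]] by simp
  have T'T: "T' (T u) = u" for u by (rule inj) (rule TT')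
  have T'_add: "T' (y + z) = T' y + T' z" for y z by (rule inj) (simp only: TT' T_add)
  have T'_scale: "T' (scaleC c y) = scaleC c (T' y)" for c y by (rule inj) (simp only: TT' T_scale)
  \<comment> \<open>For the inverse, the vectors \<open>T' y\<close> act through the pairing, and
    \<open>p (T' y) v = S v y\<close> is bounded by the norm of \<open>S v\<close>.\<close>
  obtain K2 where K2: "K2 \<ge> 0" "\<And>f x. f \<in> (\<lambda>y. p (T' y)) ` cball 0 1 \<Longrightarrow> cmod (f x) \<le> K2 * norm x"
  proof (rule uniform_boundedness[of "(\<lambda>y. p (T' y)) ` cball 0 1"])
    show "cblin f" if "f \<in> (\<lambda>y. p (T' y)) ` cball 0 1" for f using that cblin_right by blast
  next
    fix v
    have "cmod (p (T' y) v) \<le> onorm (S v)" if "norm y \<le> 1" for y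
    proof -
      have "cmod (S v y) \<le> onorm (S v) * norm y" by (rule cblin_bound[OF cblin_S])
      also have "\<dots> \<le> onorm (S v) * 1" using that by (intro mult_left_mono cblin_onorm_nonneg[OF cblin_S]) auto
      finally show ?thesis using ST[of v "T' y"] unfolding TT' by simp
    qed
    then show "\<exists>K. \<forall>f\<in>(\<lambda>y. p (T' y)) ` cball 0 1. cmod (f v) \<le> K"
      by (intro exI[of _ "onorm (S v)"]) auto
  qed blast
  have T'_bound: "norm (T' y) \<le> K2 * norm y" for y
  proof (rule scale_bound)
    fix y :: 'b assume y: "norm y \<le> 1"
    show "norm (T' y) \<le> K2" by (rule norming_left[OF K2(1)], rule K2(2)) (use y in auto)
  qed (rule T'_scale)
  have "onorm (S v) \<le> K2 * norm v" for v
  proof (rule onorm_bound)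
    fix y
    have "cmod (S v y) \<le> norm (T' y) * norm v" using bound[of "T' y" v] ST[of v "T' y"] by (simp add: TT')
    also have "\<dots> \<le> (K2 * norm y) * norm v" by (intro mult_right_mono T'_bound) auto
    finally show "cmod (S v y) \<le> K2 * norm v * norm y" by (simp add: mult_ac)
  qed (use K2(1) in auto)
  then have "\<exists>K. \<forall>v. onorm (S v) \<le> K * norm v" by blast
  moreover have "cblin (\<lambda>u. T u)" by (rule cblinI[OF T_add T_scale T_bound])
  moreover have "cblin T'" by (rule cblinI[OF T'_add T'_scale T'_bound])
  moreover have "N u v = rank1 (T u) (S v)" for u v
    by (rule ext, unfold rank1_apply, rule N_eq)
  ultimately have "rank1_structure p N (\<lambda>u. T u) T' (\<lambda>v. S v)"
    unfolding rank1_structure_def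
  proof (intro conjI allI impI)
    show "S (v + w) = (\<lambda>y. S v y + S w y)" "S (scaleC c v) = (\<lambda>y. c * S v y)" for c v w
      by (simp_all add: S_add S_scale fun_eq_iff)
    show "\<exists>v. g = S v" if "cblin g" for g using that by (rule S_onto)
  qed (rule TT' T'T cblin_S ST | assumption)+
  then show ?thesis by blast
qed

text \<open>The degenerate combinations reduce to column with dual row; the remaining one, row with
  dual column, becomes column with dual row for the swapped pair.\<close>

theorem structure_dichotomy:
  "(\<exists>T T' S. rank1_structure p N T T' S) \<or>
   (\<exists>T T' S. rank1_structure (\<lambda>v u. p u v) (\<lambda>v u. N u v) T T' S)"
proof -
  interpret swap: rank1_family "\<lambda>v u. p u v" "\<lambda>v u. N u v" k f0 x0 y0 g0 by (rule rank1_family_swap)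
  have swap: "swap.column_type \<longleftrightarrow> dual_column_type" "swap.row_type \<longleftrightarrow> dual_row_type"
    "swap.dual_row_type \<longleftrightarrow> row_type"
    by (simp_all add: swap.column_type_def swap.row_type_def swap.dual_row_type_def
        dual_column_type_def dual_row_type_def row_type_def)
  have "dual_column_type \<or> dual_row_type" using swap.column_or_row_type swap by simp
  moreover note column_or_row_type
  ultimately consider "column_type \<and> dual_row_type" | "row_type \<and> dual_column_type"
    using dual_row_if_columns column_if_rows by blast
  then show ?thesis
  proof cases
    case 1
    then show ?thesis using structure_if_column by blast
  next
    case 2
    then show ?thesis using swap.structure_if_column swap by blast
  qed
qed

end

section \<open>Adjoints and reflexivity\<close>

lemma norm_Abs_cdual: "cblin f \<Longrightarrow> norm (Abs_cdual f) = onorm f"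
  by (simp add: norm_cdual.rep_eq)

lemma cblin_dual_eval: "cblin (\<lambda>v. dual_apply v x)"
proof (rule cblinI[where K = "norm x"])
  show "cmod (dual_apply v x) \<le> norm x * norm v" for v
    using dual_apply_bound[of v x] by (simp add: mult.commute)
qed (simp_all add: plus_cdual.rep_eq scaleC_cdual.rep_eq)

lemma dual_pair_dual_apply: "dual_pair (\<lambda>u v. dual_apply v u)"
proof
  fix u :: 'a and v :: "'a cdual" and K :: real
  show "cmod (dual_apply v u) \<le> norm u * norm v" using dual_apply_bound[of v u] by (simp add: mult.commute)
  show "norm v \<le> K" if "K \<ge> 0" "\<And>u. cmod (dual_apply v u) \<le> K * norm u"
    using that by (rule norm_cdual_le)
  show "norm u \<le> K" if "K \<ge> 0" and K: "\<And>v. cmod (dual_apply v u) \<le> K * norm v"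
  proof (rule norm_le_of_functionals[OF _ \<open>K \<ge> 0\<close>])
    fix f :: "'a \<Rightarrow> complex" assume f: "cblin f"
    show "cmod (f u) \<le> K * onorm f" using K[of "Abs_cdual f"] by (simp add: f norm_Abs_cdual)
  qed
qed (simp_all add: cblin_add cblin_scaleC plus_cdual.rep_eq scaleC_cdual.rep_eq)

definition cdual_adjoint :: "('a::complex_banach \<Rightarrow> 'a) \<Rightarrow> 'a cdual \<Rightarrow> 'a cdual" where
  "cdual_adjoint V v = Abs_cdual (dual_apply v \<circ> V)"

lemma dual_apply_adjoint [simp]: "cblin V \<Longrightarrow> dual_apply (cdual_adjoint V v) x = dual_apply v (V x)"
  by (simp add: cdual_adjoint_def cblin_comp)

lemma cblin_adjoint:
  assumes V: "cblin V"
  shows "cblin (cdual_adjoint V)"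
proof (rule cblinI[where K = "onorm V"])
  show "norm (cdual_adjoint V v) \<le> onorm V * norm v" for v
  proof (rule norm_cdual_le)
    fix x
    have "cmod (dual_apply v (V x)) \<le> norm v * norm (V x)" by (rule dual_apply_bound)
    also have "\<dots> \<le> norm v * (onorm V * norm x)" by (intro mult_left_mono cblin_bound[OF V]) simp
    finally show "cmod (dual_apply (cdual_adjoint V v) x) \<le> onorm V * norm v * norm x"
      using V by (simp add: mult_ac)
  qed (simp add: cblin_onorm_nonneg[OF V])
qed (rule cdual_eqI, simp add: V plus_cdual.rep_eq scaleC_cdual.rep_eq)+

lemma adjoint_comp: "cblin V \<Longrightarrow> cblin W \<Longrightarrow> cdual_adjoint V (cdual_adjoint W v) = cdual_adjoint (W \<circ> V) v"
  by (rule cdual_eqI) (simp add: cblin_comp)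

lemma adjoint_id: "cdual_adjoint id v = v"
  by (rule cdual_eqI) simp

lemma adjoint_rank1: "cblin g \<Longrightarrow> cdual_adjoint (rank1 y g) = rank1 (Abs_cdual g) (\<lambda>v. dual_apply v y)"
  by (rule ext, rule cdual_eqI) (simp add: cblin_rank1 rank1_apply scaleC_cdual.rep_eq cblin_scaleC mult.commute)

lemma reflexive_spaceD:
  fixes \<phi> :: "'a::complex_banach cdual \<Rightarrow> complex"
  assumes refl: "reflexive_space TYPE('a)" and \<phi>: "cblin \<phi>"
  shows "\<exists>x. \<forall>v. \<phi> v = dual_apply v x"
proof -
  let ?\<psi> = "\<lambda>f. \<phi> (Abs_cdual f)"
  have "\<exists>x. \<forall>f\<in>dual_space. ?\<psi> f = f x"
  proof (rule refl[unfolded reflexive_space_def, rule_format], intro conjI ballI allI)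
    fix f g :: "'a \<Rightarrow> complex" and c assume f: "f \<in> dual_space"
    show "?\<psi> (\<lambda>x. c * f x) = c * ?\<psi> f"
    proof -
      have "Abs_cdual (\<lambda>x. c * f x) = scaleC c (Abs_cdual f)"
        using f by (intro cdual_eqI) (simp add: scaleC_cdual.rep_eq cblin_cmult)
      then show ?thesis by (simp add: cblin_scaleC[OF \<phi>])
    qed
    assume g: "g \<in> dual_space"
    have "Abs_cdual (\<lambda>x. f x + g x) = Abs_cdual f + Abs_cdual g"
      using f g by (intro cdual_eqI) (simp add: plus_cdual.rep_eq cblin_plus)
    then show "?\<psi> (\<lambda>x. f x + g x) = ?\<psi> f + ?\<psi> g" by (simp add: cblin_add[OF \<phi>])
  next
    show "\<exists>K. \<forall>f\<in>dual_space. cmod (?\<psi> f) \<le> K * onorm f"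
    proof (intro exI ballI)
      fix f :: "'a \<Rightarrow> complex" assume "f \<in> dual_space"
      then show "cmod (?\<psi> f) \<le> onorm \<phi> * onorm f"
        using cblin_bound[OF \<phi>, of "Abs_cdual f"] by (simp add: norm_Abs_cdual)
    qed
  qed
  then obtain x where x: "\<And>f. cblin f \<Longrightarrow> \<phi> (Abs_cdual f) = f x" by auto
  show ?thesis
    using x[OF cblin_dual_apply] by (auto simp: dual_apply_inverse)
qed

lemma reflexive_spaceI:
  assumes "\<And>\<phi> :: 'a::complex_banach cdual \<Rightarrow> complex. cblin \<phi> \<Longrightarrow> \<exists>x. \<forall>v. \<phi> v = dual_apply v x"
  shows "reflexive_space TYPE('a)"
  unfolding reflexive_space_def
proof (intro allI impI, elim conjE exE)
  fix \<phi> :: "('a \<Rightarrow> complex) \<Rightarrow> complex" and K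
  assume add: "\<forall>f\<in>dual_space. \<forall>g\<in>dual_space. \<phi> (\<lambda>x. f x + g x) = \<phi> f + \<phi> g"
    and sc: "\<forall>c. \<forall>f\<in>dual_space. \<phi> (\<lambda>x. c * f x) = c * \<phi> f"
    and K: "\<forall>f\<in>dual_space. cmod (\<phi> f) \<le> K * onorm f"
  have "cblin (\<lambda>v. \<phi> (dual_apply v))"
  proof (rule cblinI[where K = K])
    show "cmod (\<phi> (dual_apply v)) \<le> K * norm v" for v using K by (simp add: norm_cdual.rep_eq)
    show "\<phi> (dual_apply (v + w)) = \<phi> (dual_apply v) + \<phi> (dual_apply w)" for v w
      using add by (simp add: plus_cdual.rep_eq)
    show "\<phi> (dual_apply (scaleC c v)) = scaleC c (\<phi> (dual_apply v))" for c v
      using sc by (simp add: scaleC_cdual.rep_eq)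
  qed
  then obtain x where x: "\<And>v. \<phi> (dual_apply v) = dual_apply v x" using assms by blast
  have "\<phi> f = f x" if "f \<in> dual_space" for f using x[of "Abs_cdual f"] that by simp
  then show "\<exists>x. \<forall>f\<in>dual_space. \<phi> f = f x" by blast
qed

text \<open>An inverse on the space dualizes at once. Conversely, reflexivity turns an inverse
  \<open>R\<close> on the dual into an adjoint: for each \<open>x\<close> the functional
  \<open>v \<mapsto> (R v) x\<close> is evaluation at a point, and this point is
  \<open>Q x\<close>.\<close>

lemma spectrum_adjoint:
  fixes V :: "'a::complex_banach \<Rightarrow> 'a"
  assumes refl: "reflexive_space TYPE('a)" and V: "cblin V"
  shows "spectrum_op (cdual_adjoint V) = spectrum_op V"
proof (rule set_eqI, rule iffI; rule ccontr)
  fix z assume "z \<notin> spectrum_op V" and z: "z \<in> spectrum_op (cdual_adjoint V)"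
  then obtain Q where Q: "cblin Q" "\<And>x. Q (V x - scaleC z x) = x" "\<And>x. V (Q x) - scaleC z (Q x) = x"
    using not_in_spectrumE by metis
  have "z \<notin> spectrum_op (cdual_adjoint V)"
  proof (rule not_in_spectrumI[OF cblin_adjoint[OF Q(1)]])
    fix v
    show "cdual_adjoint Q (cdual_adjoint V v - scaleC z v) = v"
    proof (rule cdual_eqI)
      fix x
      have "dual_apply v x = dual_apply v (V (Q x) - scaleC z (Q x))" by (simp add: Q)
      then show "dual_apply (cdual_adjoint Q (cdual_adjoint V v - scaleC z v)) x = dual_apply v x"
        by (simp add: Q(1) V minus_cdual.rep_eq scaleC_cdual.rep_eq cblin_diff cblin_scaleC)
    qed
    show "cdual_adjoint V (cdual_adjoint Q v) - scaleC z (cdual_adjoint Q v) = v"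
    proof (rule cdual_eqI)
      fix x
      have "dual_apply v x = dual_apply v (Q (V x - scaleC z x))" by (simp add: Q)
      then show "dual_apply (cdual_adjoint V (cdual_adjoint Q v) - scaleC z (cdual_adjoint Q v)) x = dual_apply v x"
        by (simp add: Q(1) V minus_cdual.rep_eq scaleC_cdual.rep_eq cblin_diff cblin_scaleC)
    qed
  qed
  with z show False by simp
next
  fix z assume "z \<notin> spectrum_op (cdual_adjoint V)" and z: "z \<in> spectrum_op V"
  then obtain R where R: "cblin R" "\<And>v. R (cdual_adjoint V v - scaleC z v) = v"
      "\<And>v. cdual_adjoint V (R v) - scaleC z (R v) = v"
    using not_in_spectrumE by metis
  have "\<exists>y. \<forall>v. dual_apply (R v) x = dual_apply v y" for x
    by (rule reflexive_spaceD[OF refl cblin_compose[OF cblin_dual_eval R(1)]])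
  then obtain Q where Q: "\<And>x v. dual_apply v (Q x) = dual_apply (R v) x" by metis
  have eqI: "x = y" if "\<And>v. dual_apply v x = dual_apply v y" for x y :: 'a
    using dual_pair.eq_left[OF dual_pair_dual_apply, of x y] that by blast
  have cQ: "cblin Q"
  proof (rule cblinI[where K = "onorm R"])
    show "Q (x + y) = Q x + Q y" "Q (scaleC c x) = scaleC c (Q x)" for x y c
      by (rule eqI, simp add: cblin_add cblin_scaleC Q)+
    show "norm (Q x) \<le> onorm R * norm x" for x
    proof (rule dual_pair.norming_left[OF dual_pair_dual_apply])
      fix v
      have "cmod (dual_apply v (Q x)) \<le> norm (R v) * norm x" unfolding Q by (rule dual_apply_bound)
      also have "\<dots> \<le> (onorm R * norm v) * norm x" by (intro mult_right_mono cblin_bound[OF R(1)]) simp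
      finally show "cmod (dual_apply v (Q x)) \<le> onorm R * norm x * norm v" by (simp add: mult_ac)
    qed (simp add: cblin_onorm_nonneg[OF R(1)])
  qed
  have "z \<notin> spectrum_op V"
  proof (rule not_in_spectrumI[OF cQ])
    show "Q (V x - scaleC z x) = x" for x
    proof (rule eqI)
      fix v
      have "dual_apply (cdual_adjoint V (R v) - scaleC z (R v)) x = dual_apply v x" by (simp add: R)
      then show "dual_apply v (Q (V x - scaleC z x)) = dual_apply v x"
        by (simp add: V Q minus_cdual.rep_eq scaleC_cdual.rep_eq cblin_diff cblin_scaleC)
    qed
    show "V (Q x) - scaleC z (Q x) = x" for x
    proof (rule eqI)
      fix v
      have "dual_apply (cdual_adjoint V v - scaleC z v) (Q x) = dual_apply v x" by (simp add: R Q)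
      then show "dual_apply v (V (Q x) - scaleC z (Q x)) = dual_apply v x"
        by (simp add: V minus_cdual.rep_eq scaleC_cdual.rep_eq cblin_diff cblin_scaleC)
    qed
  qed
  with z show False by simp
qed

section \<open>The two standard forms\<close>

lemma gen_prod_similar:
  assumes T: "cblin T" and S: "cblin S" and ST: "\<And>x. S (T x) = x" and TS: "\<And>y. T (S y) = y"
    and A: "\<And>i. i \<in> set xs \<Longrightarrow> cblin (A i)"
    and \<Phi>: "\<And>i. i \<in> set xs \<Longrightarrow> \<Phi> i = (\<lambda>y. scaleC c (T (A i (S y))))"
  shows "gen_prod xs \<Phi> = (\<lambda>y. scaleC (c ^ length xs) (T (gen_prod xs A (S y))))"
  using A \<Phi>
proof (induction xs)
  case (Cons i xs)
  then have "gen_prod xs \<Phi> = (\<lambda>y. scaleC (c ^ length xs) (T (gen_prod xs A (S y))))" by simp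
  then show ?case
    using Cons.prems by (simp add: gen_prod_Cons fun_eq_iff cblin_scaleC[OF S] ST cblin_scaleC[OF T] cblin_scaleC)
qed (simp add: fun_eq_iff TS)

text \<open>Adjoints reverse products, hence the reversed word on the right.\<close>

lemma gen_prod_adjoint:
  fixes T :: "'a::complex_banach cdual \<Rightarrow> 'b::complex_banach"
  assumes T: "cblin T" and S: "cblin S" and ST: "\<And>x. S (T x) = x" and TS: "\<And>y. T (S y) = y"
    and A: "\<And>i. i \<in> set xs \<Longrightarrow> cblin (A i)"
    and \<Phi>: "\<And>i. i \<in> set xs \<Longrightarrow> \<Phi> i = (\<lambda>y. scaleC c (T (cdual_adjoint (A i) (S y))))"
  shows "gen_prod xs \<Phi> = (\<lambda>y. scaleC (c ^ length xs) (T (cdual_adjoint (gen_prod (rev xs) A) (S y))))"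
proof -
  have "gen_prod xs \<Phi> = (\<lambda>y. scaleC (c ^ length xs) (T (gen_prod xs (\<lambda>i. cdual_adjoint (A i)) (S y))))"
    by (rule gen_prod_similar[OF T S ST TS]) (simp_all add: A \<Phi> cblin_adjoint)
  also have "gen_prod xs (\<lambda>i. cdual_adjoint (A i)) = cdual_adjoint (gen_prod (rev xs) A)"
    using A
  proof (induction xs)
    case (Cons i xs)
    then have IH: "gen_prod xs (\<lambda>i. cdual_adjoint (A i)) = cdual_adjoint (gen_prod (rev xs) A)" by simp
    have "cblin (gen_prod (rev xs) A)" by (rule cblin_gen_prod) (simp add: Cons.prems)
    then show ?case using Cons.prems
      by (simp add: gen_prod_Cons gen_prod_append IH fun_eq_iff adjoint_comp comp_def)
  qed (simp add: fun_eq_iff adjoint_id)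
  finally show ?thesis .
qed

text \<open>Read cyclically from the unique letter, the word is \<open>i\<close> followed by
  \<open>R @ L\<close>, and the reversed word is \<open>i\<close> followed by
  \<open>rev (R @ L)\<close>. The palindrome condition makes the two agree.\<close>

lemma peripheral_spectrum_rev_if_quasi_semi_jordan:
  fixes A :: "nat \<Rightarrow> 'a::complex_banach \<Rightarrow> 'a"
  assumes "quasi_semi_jordan idx" and A: "\<And>i. i \<in> set idx \<Longrightarrow> cblin (A i)"
  shows "peripheral_spectrum (gen_prod (rev idx) A) = peripheral_spectrum (gen_prod idx A)"
proof -
  obtain p where p: "unique_pos idx p"
    and pal: "drop (Suc p) idx @ take p idx = rev (drop (Suc p) idx @ take p idx)"
    using assms(1) unfolding quasi_semi_jordan_def by blast
  define L R i where "L = take p idx" and "R = drop (Suc p) idx" and "i = idx ! p"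
  have idx: "idx = L @ i # R" unfolding L_def R_def i_def by (rule unique_pos_split(1)[OF p])
  have pal: "R @ L = rev L @ rev R" using pal by (simp add: L_def R_def)
  have c: "cblin (A i)" "cblin (gen_prod L A)" "cblin (gen_prod R A)"
    "cblin (gen_prod (rev L) A)" "cblin (gen_prod (rev R) A)"
    using A by (auto simp: idx intro!: cblin_gen_prod)
  have "peripheral_spectrum (gen_prod (rev idx) A)
      = peripheral_spectrum (gen_prod (rev R) A \<circ> (A i \<circ> gen_prod (rev L) A))"
    by (simp add: idx gen_prod_append gen_prod_Cons comp_assoc)
  also have "\<dots> = peripheral_spectrum ((A i \<circ> gen_prod (rev L) A) \<circ> gen_prod (rev R) A)"
    by (rule peripheral_spectrum_comp_commute) (intro cblin_comp c)+
  also have "(A i \<circ> gen_prod (rev L) A) \<circ> gen_prod (rev R) A = (A i \<circ> gen_prod R A) \<circ> gen_prod L A"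
    using arg_cong[OF pal, of "\<lambda>xs. A i \<circ> gen_prod xs A"] by (simp add: gen_prod_append comp_assoc)
  also have "peripheral_spectrum \<dots> = peripheral_spectrum (gen_prod L A \<circ> (A i \<circ> gen_prod R A))"
    by (rule peripheral_spectrum_comp_commute) (intro cblin_comp c)+
  also have "gen_prod L A \<circ> (A i \<circ> gen_prod R A) = gen_prod idx A"
    by (simp add: idx gen_prod_append gen_prod_Cons comp_assoc)
  finally show ?thesis .
qed

text \<open>The head is the least significant digit, so parity recovers it. Equal lengths rule out
  words that differ by zeros at the far end.\<close>

lemma bits_eq_if_binary_eq:
  assumes "length xs = length ys" "\<forall>x\<in>set xs. b x < (2::nat)" "\<forall>x\<in>set ys. b x < 2"
    and "foldr (\<lambda>i t. 2 * t + b i) xs 0 = foldr (\<lambda>i t. 2 * t + b i) ys (0::nat)"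
  shows "map b xs = map b ys"
  using assms
proof (induction xs ys rule: list_induct2)
  case (Cons x xs y ys)
  let ?f = "\<lambda>zs. foldr (\<lambda>i t. 2 * t + b i) zs (0::nat)"
  have eq: "2 * ?f xs + b x = 2 * ?f ys + b y" and lt: "b x < 2" "b y < 2" using Cons.prems by auto
  have "b x = b y" "?f xs = ?f ys" using eq lt by presburger+
  then show ?case using Cons by simp
qed simp

text \<open>The operators \<open>B j\<close> below map \<open>t e1 + e2\<close> to \<open>(2 t + b j) e1 + e2\<close>, so a product of them
  reads off binary digits and determines the bits of the word it comes from.\<close>

lemma word_eq_if_products_eq:
  fixes e1 e2 :: "'a::complex_banach"
  assumes alg: "standard_operator_algebra (\<A> :: ('a \<Rightarrow> 'a) set)" and len: "length xs = length ys"
    and e1: "e1 \<notin> cspan {e2}" and e2: "e2 \<notin> cspan {e1}"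
    and eq: "\<And>A. (\<And>j. A j \<in> \<A>) \<Longrightarrow> gen_prod xs A = gen_prod ys A"
  shows "xs = ys"
proof (rule ccontr)
  assume "xs \<noteq> ys"
  then obtain q where q: "q < length xs" "xs ! q \<noteq> ys ! q" using len by (metis nth_equalityI)
  \<comment> \<open>The bit marks a single letter, one on which the two words disagree at position
    \<open>q\<close>; reading off its occurrences is enough.\<close>
  define b where "b j = (if j = xs ! q then 1 else 0 :: nat)" for j
  obtain f1 :: "'a \<Rightarrow> complex" where f1: "cblin f1" "f1 e1 = 1" "\<And>w. w \<in> {e2} \<Longrightarrow> f1 w = 0"
    using functional_vanishing_on_span[OF _ e1] by blast
  obtain f2 :: "'a \<Rightarrow> complex" where f2: "cblin f2" "f2 e2 = 1" "\<And>w. w \<in> {e1} \<Longrightarrow> f2 w = 0"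
    using functional_vanishing_on_span[OF _ e2] by blast
  define B where "B j = (\<lambda>z. scaleC (2 * f1 z + of_nat (b j) * f2 z) e1 + scaleC (f2 z) e2)" for j
  have cB: "cblin (B j)" for j
    unfolding B_def by (intro cblin_plus cblin_scaleC_left cblin_cmult f1 f2)
  have "rank_le (B j) 2" for j
    by (rule rank_le_rank2) (simp add: B_def)
  then have BA: "B j \<in> \<A>" for j by (rule standard_algebra_rank_le[OF alg cB])
  have val: "gen_prod zs B e2 = scaleC (of_nat (foldr (\<lambda>i t. 2 * t + b i) zs 0)) e1 + e2" for zs
    by (induction zs) (simp_all add: gen_prod_Cons B_def cblin_add f1 f2 cblin_scaleC)
  let ?v = "\<lambda>zs. foldr (\<lambda>i t. 2 * t + b i) zs (0::nat)"
  have "scaleC (of_nat (?v xs)) e1 + e2 = scaleC (of_nat (?v ys)) e1 + e2"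
    unfolding val[symmetric] eq[of B, OF BA] ..
  then have "scaleC (of_nat (?v xs)) e1 = scaleC (of_nat (?v ys)) e1" by (rule add_right_imp_eq)
  then have "f1 (scaleC (of_nat (?v xs)) e1) = f1 (scaleC (of_nat (?v ys)) e1)" by (rule arg_cong)
  then have "?v xs = ?v ys" by (simp add: cblin_scaleC[OF f1(1)] f1(2))
  then have "map b xs = map b ys" by (intro bits_eq_if_binary_eq len) (auto simp: b_def)
  then have "b (xs ! q) = b (ys ! q)" using q(1) len by (metis nth_map)
  then show False using q(2) by (simp add: b_def split: if_splits)
qed

text \<open>With \<open>x \<otimes> f\<close> at the unique letter both sides become singletons,
  namely \<open>f\<close> of the word \<open>R @ L\<close> and of its reversal applied to
  \<open>x\<close>. As \<open>x\<close> and \<open>f\<close> are arbitrary the two products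
  coincide, and two independent vectors allow the words themselves to be recovered.\<close>

lemma quasi_semi_jordan_if_adjoint_form:
  fixes T :: "'a::complex_banach cdual \<Rightarrow> 'b::complex_banach" and e1 e2 :: 'a
  assumes alg: "standard_operator_algebra \<A>" and p: "unique_pos idx p"
    and e1: "e1 \<notin> cspan {e2}" and e2: "e2 \<notin> cspan {e1}"
    and T: "cblin T" and S: "cblin S" and ST: "\<And>x. S (T x) = x" and TS: "\<And>y. T (S y) = y"
    and c: "c ^ length idx = 1"
    and \<Phi>: "\<And>A. A \<in> \<A> \<Longrightarrow> \<Phi> A = (\<lambda>y. scaleC c (T (cdual_adjoint A (S y))))"
    and pres: "\<And>A. (\<And>j. A j \<in> \<A>) \<Longrightarrow>
      peripheral_spectrum (gen_prod idx (\<lambda>j. \<Phi> (A j))) = peripheral_spectrum (gen_prod idx A)"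
  shows "quasi_semi_jordan idx"
proof -
  define L R i where "L = take p idx" and "R = drop (Suc p) idx" and "i = idx ! p"
  have idx: "idx = L @ i # R" and iL: "i \<notin> set L" and iR: "i \<notin> set R"
    unfolding L_def R_def i_def by (rule unique_pos_split[OF p])+
  have e10: "e1 \<noteq> 0" using e1 by (auto simp: scaleC.span_zero)
  have "Abs_cdual f \<noteq> 0" if "cblin f" "f e1 = 1" for f :: "'a \<Rightarrow> complex"
  proof
    assume "Abs_cdual f = 0"
    then have "dual_apply (Abs_cdual f) e1 = 0" by (simp add: zero_cdual.rep_eq)
    with that show False by simp
  qed
  then obtain v0 :: "'a cdual" where v0: "v0 \<noteq> 0" using functional_nonzero[OF e10] by metis
  have "R @ L = rev (R @ L)"
  proof (rule word_eq_if_products_eq[OF alg _ e1 e2])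
    fix B :: "nat \<Rightarrow> 'a \<Rightarrow> 'a" assume B: "\<And>j. B j \<in> \<A>"
    note cB = standard_algebra_cblin[OF alg B]
    have cg: "cblin (gen_prod zs B)" for zs by (rule cblin_gen_prod) (rule cB)
    show "gen_prod (R @ L) B = gen_prod (rev (R @ L)) B"
    proof (rule ext, rule functionals_separate)
      fix x and f :: "'a \<Rightarrow> complex" assume f: "cblin f"
      \<comment> \<open>The letter \<open>i\<close> occurs in neither \<open>L\<close> nor
        \<open>R\<close>, so the rest of the word still consists of the chosen operators
        \<open>B j\<close>.\<close>
      define A where "A = B(i := rank1 x f)"
      have A: "A j \<in> \<A>" for j by (simp add: A_def B standard_algebra_rank1[OF alg f])
      have AL: "gen_prod L A = gen_prod L B" "gen_prod R A = gen_prod R B"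
        "gen_prod (rev L) A = gen_prod (rev L) B" "gen_prod (rev R) A = gen_prod (rev R) B"
        using iL iR by (auto simp: A_def intro!: gen_prod_cong)
      have "gen_prod idx A = gen_prod L B \<circ> (rank1 x f \<circ> gen_prod R B)"
        by (simp add: idx gen_prod_append gen_prod_Cons AL) (simp add: A_def)
      also have "\<dots> = rank1 (gen_prod L B x) (f \<circ> gen_prod R B)"
        unfolding rank1_comp_right by (rule rank1_comp_left[OF cg])
      finally have 1: "peripheral_spectrum (gen_prod idx A) = {f (gen_prod (R @ L) B x)}"
        using peripheral_spectrum_rank1[OF cblin_comp[OF f cg] e10] by (simp add: gen_prod_append)
      have "gen_prod (rev idx) A = gen_prod (rev R) B \<circ> (rank1 x f \<circ> gen_prod (rev L) B)"
        by (simp add: idx gen_prod_append gen_prod_Cons AL comp_assoc) (simp add: A_def)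
      also have "\<dots> = rank1 (gen_prod (rev R) B x) (f \<circ> gen_prod (rev L) B)"
        unfolding rank1_comp_right by (rule rank1_comp_left[OF cg])
      finally have rv: "gen_prod (rev idx) A = rank1 (gen_prod (rev R) B x) (f \<circ> gen_prod (rev L) B)" .
      have "gen_prod idx (\<lambda>j. \<Phi> (A j)) = (\<lambda>y. T (cdual_adjoint (gen_prod (rev idx) A) (S y)))"
        using gen_prod_adjoint[OF T S ST TS, of idx A "\<lambda>j. \<Phi> (A j)" c]
          standard_algebra_cblin[OF alg A] \<Phi>[OF A] by (simp add: c)
      then have "peripheral_spectrum (gen_prod idx (\<lambda>j. \<Phi> (A j)))
          = peripheral_spectrum (cdual_adjoint (gen_prod (rev idx) A))"
        using peripheral_spectrum_similar[OF T S TS ST] by simp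
      also have "\<dots> = {f (gen_prod (rev (R @ L)) B x)}"
        unfolding rv adjoint_rank1[OF cblin_comp[OF f cg]] peripheral_spectrum_rank1[OF cblin_dual_eval v0]
        using cblin_comp[OF f cg] by (simp add: gen_prod_append)
      finally show "f (gen_prod (R @ L) B x) = f (gen_prod (rev (R @ L)) B x)"
        using pres[of A, OF A] 1 by simp
    qed
  qed simp
  then show ?thesis using p unfolding quasi_semi_jordan_def L_def R_def by blast
qed

section \<open>From the trace identity to the two forms\<close>

context peripheral_preserver
begin

text \<open>Inserting \<open>c y\<close> into the trace identity produces the factor
  \<open>c\<^sup>n\<close>, whose inverse is \<open>c\<close> because
  \<open>c\<^sup>n\<^sup>+\<^sup>1 = 1\<close>.\<close>

lemma trace_identity_normalized:
  fixes f :: "'a \<Rightarrow> complex" and h :: "'b \<Rightarrow> complex"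
  assumes A: "A \<in> \<A>" and f: "cblin f" and h: "cblin h" and c: "c ^ (n + 1) = 1"
    and eq: "\<Phi> (rank1 x f) = rank1 (scaleC c y) h" and hy: "h y = f x" "f x \<noteq> 0"
  shows "h (\<Phi> A y) = c * f (A x)"
proof -
  have c0: "c \<noteq> 0" using c by auto
  have "n = Suc (n - 1)" using n by simp
  then have cn: "c ^ (n - 1) * c * c = 1" using c by (metis Suc_eq_plus1 power_Suc2)
  have "(c * f x) ^ (n - 1) * (c * h (\<Phi> A y)) = f x ^ (n - 1) * f (A x)"
    using trace_identity[OF A f h eq] by (simp add: cblin_scaleC[OF h] cblin_scaleC[OF cblin_image[OF A]] hy)
  then have "f x ^ (n - 1) * (c ^ (n - 1) * c * h (\<Phi> A y)) = f x ^ (n - 1) * f (A x)"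
    by (simp add: power_mult_distrib mult_ac)
  then have eq': "c ^ (n - 1) * c * h (\<Phi> A y) = f (A x)" using hy(2) by (metis mult_left_cancel power_not_zero)
  have "h (\<Phi> A y) = (c ^ (n - 1) * c * c) * h (\<Phi> A y)" unfolding cn by simp
  also have "\<dots> = c * f (A x)" unfolding eq'[symmetric] by (simp only: mult_ac)
  finally show ?thesis .
qed

text \<open>The root of unity is \<open>c = g y\<close> for \<open>y \<otimes> g\<close>, the image
  of a rank-one idempotent: testing the trace identity on that idempotent itself reads
  \<open>c\<^sup>n\<^sup>+\<^sup>1 = 1\<close>. Division by \<open>c\<close> makes the base image an
  idempotent as well.\<close>

lemma ex_rank1_family:
  obtains c where "c ^ (n + 1) = 1"
    "\<exists>x0 f0 y0 g0. rank1_family (\<lambda>u v. dual_apply v u)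
      (\<lambda>u v z. scaleC (1 / c) (\<Phi> (rank1 u (dual_apply v)) z)) (n - 1) x0 f0 y0 g0"
proof -
  obtain f0 :: "'a \<Rightarrow> complex" where f0: "cblin f0" "f0 a0 = 1" using functional_nonzero[OF a0] by blast
  obtain y g where g: "cblin g" "\<Phi> (rank1 a0 f0) = rank1 y g" "g y \<noteq> 0"
    using rank1_image[OF f0(1)] f0(2) by (metis zero_neq_one)
  define c where "c = g y"
  have "g y ^ (n - 1) * (g y * g y) = 1"
    using trace_identity[OF rank1_alg[OF f0(1)] f0(1) g(1,2), of a0]
    by (simp add: g(2) f0) (simp add: rank1_apply f0 cblin_scaleC[OF g(1)] cblin_scaleC[OF f0(1)])
  then have c1: "c ^ (n + 1) = 1"
    using n unfolding c_def by (cases n) (auto simp: mult_ac)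
  have c0: "c \<noteq> 0" using g(3) by (simp add: c_def)
  have cn: "c * (c * c ^ (n - 1)) = 1"
    using c1 n by (cases n) auto
  have "rank1_family (\<lambda>u v. dual_apply v u)
    (\<lambda>u v z. scaleC (1 / c) (\<Phi> (rank1 u (dual_apply v)) z)) (n - 1) a0 (Abs_cdual f0) (scaleC (1 / c) y) g"
  proof (intro rank1_family.intro dual_pair_dual_apply rank1_family_axioms.intro)
    fix u u' :: 'a and v v' :: "'a cdual" and z a
    note ra = rank1_alg[OF cblin_dual_apply]
    show "cblin (\<lambda>z. scaleC (1 / c) (\<Phi> (rank1 u (dual_apply v)) z))"
      by (rule cblin_scaleC_right[OF cblin_image[OF ra]])
    have "rank1 (u + u') (dual_apply v) = (\<lambda>x. rank1 u (dual_apply v) x + rank1 u' (dual_apply v) x)"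
      by (simp add: fun_eq_iff rank1_apply scaleC_add_right)
    then show "scaleC (1 / c) (\<Phi> (rank1 (u + u') (dual_apply v)) z)
      = scaleC (1 / c) (\<Phi> (rank1 u (dual_apply v)) z) + scaleC (1 / c) (\<Phi> (rank1 u' (dual_apply v)) z)"
      by (simp add: image_add[OF ra ra] scaleC_add_right)
    have "rank1 u (dual_apply (v + v')) = (\<lambda>x. rank1 u (dual_apply v) x + rank1 u (dual_apply v') x)"
      by (simp add: fun_eq_iff rank1_apply scaleC_add_left plus_cdual.rep_eq)
    then show "scaleC (1 / c) (\<Phi> (rank1 u (dual_apply (v + v'))) z)
      = scaleC (1 / c) (\<Phi> (rank1 u (dual_apply v)) z) + scaleC (1 / c) (\<Phi> (rank1 u (dual_apply v')) z)"
      by (simp add: image_add[OF ra ra] scaleC_add_right)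
    have "rank1 (scaleC a u) (dual_apply v) = (\<lambda>x. scaleC a (rank1 u (dual_apply v) x))"
      by (simp add: fun_eq_iff rank1_apply mult.commute)
    then show "scaleC (1 / c) (\<Phi> (rank1 (scaleC a u) (dual_apply v)) z)
      = scaleC a (scaleC (1 / c) (\<Phi> (rank1 u (dual_apply v)) z))"
      by (simp add: image_scaleC[OF ra])
    have "rank1 u (dual_apply (scaleC a v)) = (\<lambda>x. scaleC a (rank1 u (dual_apply v) x))"
      by (simp add: fun_eq_iff rank1_apply scaleC_cdual.rep_eq)
    then show "scaleC (1 / c) (\<Phi> (rank1 u (dual_apply (scaleC a v))) z)
      = scaleC a (scaleC (1 / c) (\<Phi> (rank1 u (dual_apply v)) z))"
      by (simp add: image_scaleC[OF ra])
  next
    fix u :: 'a and v :: "'a cdual" assume "dual_apply v u \<noteq> 0"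
    then obtain y' g' where g': "cblin g'" "\<Phi> (rank1 u (dual_apply v)) = rank1 y' g'"
      using rank1_image[OF cblin_dual_apply] by metis
    then show "\<exists>y g. cblin g \<and> (\<lambda>z. scaleC (1 / c) (\<Phi> (rank1 u (dual_apply v)) z)) = rank1 y g"
      by (intro exI[of _ "scaleC (1 / c) y'"] exI[of _ g']) (simp add: fun_eq_iff rank1_apply)
  next
    fix g' :: "'b \<Rightarrow> complex" and y' assume g': "cblin g'" "g' y' \<noteq> 0"
    then have "g' (scaleC c y') \<noteq> 0" using c0 by (simp add: cblin_scaleC)
    then obtain x f where f: "cblin f" "\<Phi> (rank1 x f) = rank1 (scaleC c y') g'" "f x \<noteq> 0"
      using rank1_preimage[OF g'(1)] by metis
    then show "\<exists>u v. dual_apply v u \<noteq> 0 \<and>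
        (\<lambda>z. scaleC (1 / c) (\<Phi> (rank1 u (dual_apply v)) z)) = rank1 y' g'"
      using c0 by (intro exI[of _ x] exI[of _ "Abs_cdual f"]) (simp add: fun_eq_iff rank1_apply)
  next
    fix g' :: "'b \<Rightarrow> complex" and y' and u u' :: 'a and v v' :: "'a cdual"
    assume g': "cblin g'"
      and N: "(\<lambda>z. scaleC (1 / c) (\<Phi> (rank1 u (dual_apply v)) z)) = rank1 y' g'"
    have "\<Phi> (rank1 u (dual_apply v)) z = rank1 (scaleC c y') g' z" for z
    proof -
      have "\<Phi> (rank1 u (dual_apply v)) z = scaleC c (scaleC (1 / c) (\<Phi> (rank1 u (dual_apply v)) z))"
        using c0 by simp
      also have "\<dots> = rank1 (scaleC c y') g' z"
        using fun_cong[OF N, of z] by (simp only: rank1_apply) (simp add: mult.commute)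
      finally show ?thesis .
    qed
    then have eq: "\<Phi> (rank1 u (dual_apply v)) = rank1 (scaleC c y') g'" by blast
    let ?A = "rank1 u' (dual_apply v')"
    have A: "?A \<in> \<A>" by (rule rank1_alg[OF cblin_dual_apply])
    have "g' (scaleC c y') ^ (n - 1) * g' (\<Phi> ?A (scaleC c y')) = dual_apply v u ^ (n - 1) * dual_apply v (?A u)"
      by (rule trace_identity[OF A cblin_dual_apply g' eq])
    then have "(c * c ^ (n - 1)) * (g' y' ^ (n - 1) * g' (\<Phi> ?A y'))
        = dual_apply v u ^ (n - 1) * (dual_apply v' u * dual_apply v u')"
      by (simp add: rank1_apply cblin_scaleC[OF g'] cblin_scaleC[OF cblin_image[OF A]]
          cblin_scaleC[OF cblin_dual_apply] power_mult_distrib mult_ac)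
    moreover have "c * c ^ (n - 1) = 1 / c" using cn c0 by (simp add: field_simps)
    moreover have "g' y' ^ (n - 1) * g' (scaleC (1 / c) (\<Phi> ?A y')) = (1 / c) * (g' y' ^ (n - 1) * g' (\<Phi> ?A y'))"
      by (simp add: cblin_scaleC[OF g'])
    ultimately show "g' y' ^ (n - 1) * g' (scaleC (1 / c) (\<Phi> ?A y'))
        = dual_apply v u ^ (n - 1) * (dual_apply v' u * dual_apply v u')"
      by metis
  next
    show "dual_apply (Abs_cdual f0) a0 = 1" using f0 by simp
    show "(\<lambda>z. scaleC (1 / c) (\<Phi> (rank1 a0 (dual_apply (Abs_cdual f0))) z)) = rank1 (scaleC (1 / c) y) g"
      by (simp add: f0 g fun_eq_iff rank1_apply mult.commute)
    show "g (scaleC (1 / c) y) = 1" using g(3) by (simp add: cblin_scaleC[OF g(1)] c_def)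
  qed (rule g(1))
  with c1 that show ?thesis by blast
qed

text \<open>The structure on rank-one operators extends to all \<open>A\<close> in the algebra
  because \<open>A\<close> may occupy the free slot of the trace identity: all functionals on the
  target are of the form \<open>S v\<close> (or \<open>S u\<close>), so the values of
  \<open>\<Phi> A\<close> on the range of \<open>T\<close> are determined.\<close>

theorem preserver_form:
  obtains (similarity) c T T' where "c ^ (n + 1) = 1" "cblin T" "cblin T'"
      "\<And>x. T' (T x) = x" "\<And>y. T (T' y) = y"
      "\<And>A. A \<in> \<A> \<Longrightarrow> \<Phi> A = (\<lambda>y. scaleC c (T (A (T' y))))"
    | (adjoint) c and T :: "'a cdual \<Rightarrow> 'b" and T' where "c ^ (n + 1) = 1" "cblin T" "cblin T'"
      "\<And>x. T' (T x) = x" "\<And>y. T (T' y) = y"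
      "\<And>A. A \<in> \<A> \<Longrightarrow> \<Phi> A = (\<lambda>y. scaleC c (T (cdual_adjoint A (T' y))))"
      "reflexive_space TYPE('a)" "reflexive_space TYPE('b)"
proof -
  obtain c x0 f0 y0 g0 where c: "c ^ (n + 1) = 1"
    and fam: "rank1_family (\<lambda>u v. dual_apply v u)
      (\<lambda>u v z. scaleC (1 / c) (\<Phi> (rank1 u (dual_apply v)) z)) (n - 1) x0 f0 y0 g0"
    using ex_rank1_family by metis
  have c0: "c \<noteq> 0" using c by auto
  have unscale: "\<Phi> B = rank1 (scaleC c y) h"
    if "(\<lambda>z. scaleC (1 / c) (\<Phi> B z)) = rank1 y h" for B y h
  proof
    fix z
    have "\<Phi> B z = scaleC c (scaleC (1 / c) (\<Phi> B z))" using c0 by simp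
    also have "\<dots> = rank1 (scaleC c y) h z"
      using fun_cong[OF that, of z] by (simp only: rank1_apply) (simp add: mult.commute)
    finally show "\<Phi> B z = rank1 (scaleC c y) h z" .
  qed
  from rank1_family.structure_dichotomy[OF fam] show ?thesis
  proof (elim disjE exE)
    fix T T' S
    assume "rank1_structure (\<lambda>u v. dual_apply v u)
      (\<lambda>u v z. scaleC (1 / c) (\<Phi> (rank1 u (dual_apply v)) z)) T T' S"
    then have T: "cblin T" "cblin T'" and inv: "\<And>x. T' (T x) = x" "\<And>y. T (T' y) = y"
      and S: "\<And>v. cblin (S v)" "\<And>v w. S (v + w) = (\<lambda>y. S v y + S w y)" "\<And>g. cblin g \<Longrightarrow> \<exists>v. g = S v"
      and ST: "\<And>u v. S v (T u) = dual_apply v u"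
      and N: "\<And>u v. (\<lambda>z. scaleC (1 / c) (\<Phi> (rank1 u (dual_apply v)) z)) = rank1 (T u) (S v)"
      unfolding rank1_structure_def by simp_all
    have "\<Phi> A (T u) = scaleC c (T (A u))" if A: "A \<in> \<A>" for A u
    proof (cases "u = 0")
      case True
      then show ?thesis by (simp add: T cblin_zero cblin_image[OF A] algD[OF A])
    next
      case False
      have *: "S v (\<Phi> A (T u)) = c * dual_apply v (A u)" if "dual_apply v u \<noteq> 0" for v
        by (rule trace_identity_normalized[OF A cblin_dual_apply S(1) c unscale[OF N] ST that])
      obtain f1 :: "'a \<Rightarrow> complex" where f1: "cblin f1" "f1 u = 1" using functional_nonzero[OF False] by blast
      define v1 where "v1 = Abs_cdual f1"
      have v1: "dual_apply v1 u = 1" by (simp add: v1_def f1)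
      have **: "S v (\<Phi> A (T u)) = c * dual_apply v (A u)" for v
      proof (cases "dual_apply v u = 0")
        case True
        then have "S (v + v1) (\<Phi> A (T u)) = c * dual_apply (v + v1) (A u)"
          by (intro *) (simp add: plus_cdual.rep_eq v1)
        then show ?thesis using *[of v1] v1 by (simp add: S(2) plus_cdual.rep_eq distrib_left)
      qed (rule *)
      show ?thesis
      proof (rule functionals_separate)
        fix g :: "'b \<Rightarrow> complex" assume g: "cblin g"
        then obtain v where v: "g = S v" using S(3) by blast
        show "g (\<Phi> A (T u)) = g (scaleC c (T (A u)))"
          unfolding v ** by (simp add: cblin_scaleC[OF S(1)] ST)
      qed
    qed
    then have "\<Phi> A = (\<lambda>y. scaleC c (T (A (T' y))))" if "A \<in> \<A>" for A
      using that inv(2) by (metis ext)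
    with similarity[OF c T inv] show thesis by blast
  next
    fix T T' S
    assume "rank1_structure (\<lambda>v u. dual_apply v u)
      (\<lambda>v u z. scaleC (1 / c) (\<Phi> (rank1 u (dual_apply v)) z)) T T' S"
    then have T: "cblin T" "cblin T'" and inv: "\<And>x. T' (T x) = x" "\<And>y. T (T' y) = y"
      and S: "\<And>v. cblin (S v)" "\<And>v w. S (v + w) = (\<lambda>y. S v y + S w y)" "\<And>g. cblin g \<Longrightarrow> \<exists>v. g = S v"
        "\<And>a u. S (scaleC a u) = (\<lambda>y. a * S u y)" "\<exists>K. \<forall>u. onorm (S u) \<le> K * norm u"
      and ST: "\<And>u v. S u (T v) = dual_apply v u"
      and N: "\<And>u v. (\<lambda>z. scaleC (1 / c) (\<Phi> (rank1 u (dual_apply v)) z)) = rank1 (T v) (S u)"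
      unfolding rank1_structure_def by simp_all
    have "\<Phi> A (T v) = scaleC c (T (cdual_adjoint A v))" if A: "A \<in> \<A>" for A v
    proof (cases "v = 0")
      case True
      then show ?thesis by (simp add: T cblin_zero cblin_image[OF A] cblin_adjoint[OF algD[OF A]])
    next
      case False
      have *: "S u (\<Phi> A (T v)) = c * dual_apply v (A u)" if "dual_apply v u \<noteq> 0" for u
        by (rule trace_identity_normalized[OF A cblin_dual_apply S(1) c unscale[OF N] ST that])
      obtain u1 where u1: "dual_apply v u1 \<noteq> 0" using False cdual_eqI[of v 0] by (auto simp: zero_cdual.rep_eq)
      have **: "S u (\<Phi> A (T v)) = c * dual_apply v (A u)" for u
      proof (cases "dual_apply v u = 0")
        case True
        then have "S (u + u1) (\<Phi> A (T v)) = c * dual_apply v (A (u + u1))"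
          by (intro *) (simp add: cblin_add u1)
        then show ?thesis using *[of u1] u1
          by (simp add: S(2) cblin_add[OF algD[OF A]] cblin_add[OF cblin_dual_apply] distrib_left)
      qed (rule *)
      show ?thesis
      proof (rule functionals_separate)
        fix g :: "'b \<Rightarrow> complex" assume g: "cblin g"
        then obtain u where u: "g = S u" using S(3) by blast
        show "g (\<Phi> A (T v)) = g (scaleC c (T (cdual_adjoint A v)))"
          unfolding u ** by (simp add: cblin_scaleC[OF S(1)] ST algD[OF A])
      qed
    qed
    then have form: "\<Phi> A = (\<lambda>y. scaleC c (T (cdual_adjoint A (T' y))))" if "A \<in> \<A>" for A
      using that inv(2) by (metis ext)
    \<comment> \<open>A functional on the dual of \<open>X\<^sub>1\<close>, transported to the
      target by \<open>T'\<close>, is some \<open>S x\<close>; the pairing identifies it with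
      evaluation at \<open>x\<close>.\<close>
    have refl_a: "reflexive_space TYPE('a)"
    proof (rule reflexive_spaceI)
      fix \<phi> :: "'a cdual \<Rightarrow> complex" assume "cblin \<phi>"
      then obtain x where x: "(\<lambda>y. \<phi> (T' y)) = S x" using S(3) cblin_compose[OF _ T(2)] by blast
      have "\<phi> v = dual_apply v x" for v using fun_cong[OF x, of "T v"] by (simp add: inv ST)
      then show "\<exists>x. \<forall>v. \<phi> v = dual_apply v x" by blast
    qed
    \<comment> \<open>\<open>S\<close> is a bounded map of \<open>X\<^sub>1\<close> onto the dual of
      the target. A functional there pulls back to an element of the dual of
      \<open>X\<^sub>1\<close>, and \<open>T\<close> sends this element to the representing
      vector.\<close>
    have refl_b: "reflexive_space TYPE('b)"
    proof (rule reflexive_spaceI)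
      fix \<phi> :: "'b cdual \<Rightarrow> complex" assume \<phi>: "cblin \<phi>"
      obtain K where K: "\<And>u. onorm (S u) \<le> K * norm u" using S(5) by blast
      have "cblin (\<lambda>u. Abs_cdual (S u))"
      proof (rule cblinI[where K = K])
        show "Abs_cdual (S (u + w)) = Abs_cdual (S u) + Abs_cdual (S w)" for u w
          by (rule cdual_eqI) (simp add: S(1) plus_cdual.rep_eq, simp add: S(2))
        show "Abs_cdual (S (scaleC a u)) = scaleC a (Abs_cdual (S u))" for a u
          by (rule cdual_eqI) (simp add: S(1) scaleC_cdual.rep_eq, simp add: S(4))
        show "norm (Abs_cdual (S u)) \<le> K * norm u" for u using K by (simp add: norm_Abs_cdual S(1))
      qed
      then have cf: "cblin (\<lambda>u. \<phi> (Abs_cdual (S u)))" by (rule cblin_compose[OF \<phi>])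
      have "\<phi> w = dual_apply w (T (Abs_cdual (\<lambda>u. \<phi> (Abs_cdual (S u)))))" for w
      proof -
        obtain u where u: "dual_apply w = S u" using S(3)[OF cblin_dual_apply] by blast
        then have "w = Abs_cdual (S u)" by (metis dual_apply_inverse)
        then show ?thesis using u by (simp add: ST cf S(1))
      qed
      then show "\<exists>y. \<forall>w. \<phi> w = dual_apply w y" by blast
    qed
    from adjoint[OF c T inv] form refl_a refl_b show thesis by blast
  qed
qed

end

section \<open>The characterization\<close>

text \<open>On a line every operator is a scalar and equals its own adjoint up to identification.
  This case needs its own treatment because there the adjoint form imposes no palindrome condition
  on the index sequence.\<close>

lemma similarity_form_if_one_dimensional:
  fixes T :: "'a::complex_banach cdual \<Rightarrow> 'b::complex_banach" and a0 :: 'a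
  assumes a0: "a0 \<noteq> 0" and dim: "\<And>x. x \<in> cspan {a0}"
    and T: "cblin T" "cblin T'" "\<And>x. T' (T x) = x" "\<And>y. T (T' y) = y"
  obtains R and R' :: "'b \<Rightarrow> 'a" where "cblin R" "cblin R'" "\<And>x. R' (R x) = x" "\<And>y. R (R' y) = y"
    "\<And>A y. cblin A \<Longrightarrow> R (A (R' y)) = T (cdual_adjoint A (T' y))"
proof -
  obtain f0 :: "'a \<Rightarrow> complex" where f0: "cblin f0" "f0 a0 = 1" using functional_nonzero[OF a0] by blast
  have x: "x = scaleC (f0 x) a0" for x
  proof -
    obtain a where "x = scaleC a a0" using dim[of x] by (auto simp: scaleC.span_singleton)
    then show ?thesis by (simp add: cblin_scaleC[OF f0(1)] f0)
  qed
  have v: "v = scaleC (dual_apply v a0) (Abs_cdual f0)" for v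
  proof (rule cdual_eqI)
    fix z
    have "dual_apply v z = dual_apply v (scaleC (f0 z) a0)" using x[of z] by simp
    then show "dual_apply v z = dual_apply (scaleC (dual_apply v a0) (Abs_cdual f0)) z"
      by (simp add: cblin_scaleC scaleC_cdual.rep_eq f0 mult.commute)
  qed
  let ?R = "\<lambda>z. scaleC (f0 z) (T (Abs_cdual f0))" and ?R' = "\<lambda>y. scaleC (dual_apply (T' y) a0) a0"
  have R': "cblin ?R'" by (rule cblin_scaleC_left[OF cblin_compose[OF cblin_dual_eval T(2)]])
  have R: "cblin ?R" by (rule cblin_scaleC_left[OF f0(1)])
  have 1: "?R' (?R z) = z" for z
    using x[of z] by (simp add: cblin_scaleC[OF T(2)] T(3) scaleC_cdual.rep_eq f0)
  have 2: "?R (?R' y) = y" for y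
  proof -
    have "?R (?R' y) = T (scaleC (dual_apply (T' y) a0) (Abs_cdual f0))"
      by (simp add: cblin_scaleC[OF f0(1)] f0 cblin_scaleC[OF T(1)])
    then show ?thesis using v[of "T' y"] T(4) by simp
  qed
  have 3: "?R (A (?R' y)) = T (cdual_adjoint A (T' y))" if A: "cblin A" for A y
  proof -
    have "dual_apply (T' y) (A a0) = dual_apply (T' y) (scaleC (f0 (A a0)) a0)" using x[of "A a0"] by simp
    then have "T (cdual_adjoint A (T' y)) = T (scaleC (f0 (A a0) * dual_apply (T' y) a0) (Abs_cdual f0))"
      using v[of "cdual_adjoint A (T' y)"] by (simp add: A cblin_scaleC[OF cblin_dual_apply])
    then show ?thesis
      by (simp add: cblin_scaleC[OF A] cblin_scaleC[OF f0(1)] cblin_scaleC[OF T(1)] mult.commute)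
  qed
  show ?thesis by (rule that[OF R R' 1 2 3])
qed

section \<open>Passage between functionals as functions and as elements of the dual type\<close>

lemma cblin_from_dualD:
  assumes "cblin_from_dual T"
  shows "cblin (\<lambda>v. T (dual_apply v))"
proof -
  obtain K where K: "\<And>f. cblin f \<Longrightarrow> norm (T f) \<le> K * onorm f"
    using assms unfolding cblin_from_dual_def by auto
  show ?thesis
  proof (rule cblinI[where K = K])
    show "norm (T (dual_apply v)) \<le> K * norm v" for v using K by (simp add: norm_cdual.rep_eq)
    show "T (dual_apply (v + w)) = T (dual_apply v) + T (dual_apply w)" for v w
      using assms by (simp add: cblin_from_dual_def plus_cdual.rep_eq)
    show "T (dual_apply (scaleC c v)) = scaleC c (T (dual_apply v))" for c v
      using assms by (simp add: cblin_from_dual_def scaleC_cdual.rep_eq)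
  qed
qed

lemma cblin_to_dualD:
  assumes "cblin_to_dual S"
  shows "cblin (S y)" "cblin (\<lambda>y. Abs_cdual (S y))"
proof -
  have S: "cblin (S y)" for y using assms by (simp add: cblin_to_dual_def)
  then show "cblin (S y)" .
  obtain K where K: "\<And>y. onorm (S y) \<le> K * norm y"
    using assms unfolding cblin_to_dual_def by auto
  show "cblin (\<lambda>y. Abs_cdual (S y))"
  proof (rule cblinI[where K = K])
    show "norm (Abs_cdual (S y)) \<le> K * norm y" for y using K by (simp add: norm_Abs_cdual S)
    have 1: "S (y + z) x = S y x + S z x" "S (scaleC c y) x = c * S y x" for x y z c
      using assms by (simp_all add: cblin_to_dual_def)
    show "Abs_cdual (S (y + z)) = Abs_cdual (S y) + Abs_cdual (S z)" for y z
      by (rule cdual_eqI) (simp add: S plus_cdual.rep_eq 1)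
    show "Abs_cdual (S (scaleC c y)) = scaleC c (Abs_cdual (S y))" for c y
      by (rule cdual_eqI) (simp add: S scaleC_cdual.rep_eq 1)
  qed
qed

lemma adjoint_op_eq: "cblin A \<Longrightarrow> adjoint_op A (dual_apply v) = dual_apply (cdual_adjoint A v)"
  by (simp add: adjoint_op_def fun_eq_iff)

lemma cblin_from_dualI:
  assumes T: "cblin T"
  shows "cblin_from_dual (\<lambda>f. T (Abs_cdual f))"
  unfolding cblin_from_dual_def
proof (intro conjI ballI allI)
  fix f g :: "'a \<Rightarrow> complex" and c
  assume f: "f \<in> dual_space"
  have "Abs_cdual (\<lambda>x. c * f x) = scaleC c (Abs_cdual f)"
    using f by (intro cdual_eqI) (simp add: scaleC_cdual.rep_eq cblin_cmult)
  then show "T (Abs_cdual (\<lambda>x. c * f x)) = scaleC c (T (Abs_cdual f))" by (simp add: cblin_scaleC[OF T])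
  assume g: "g \<in> dual_space"
  have "Abs_cdual (\<lambda>x. f x + g x) = Abs_cdual f + Abs_cdual g"
    using f g by (intro cdual_eqI) (simp add: plus_cdual.rep_eq cblin_plus)
  then show "T (Abs_cdual (\<lambda>x. f x + g x)) = T (Abs_cdual f) + T (Abs_cdual g)" by (simp add: cblin_add[OF T])
next
  show "\<exists>K. \<forall>f\<in>dual_space. norm (T (Abs_cdual f)) \<le> K * onorm f"
  proof (intro exI ballI)
    fix f :: "'a \<Rightarrow> complex" assume "f \<in> dual_space"
    then show "norm (T (Abs_cdual f)) \<le> onorm T * onorm f"
      using cblin_bound[OF T, of "Abs_cdual f"] by (simp add: norm_Abs_cdual)
  qed
qed

lemma cblin_to_dualI:
  assumes S: "cblin S"
  shows "cblin_to_dual (\<lambda>y. dual_apply (S y))"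
  unfolding cblin_to_dual_def
proof (intro conjI allI)
  show "\<exists>K. \<forall>y. onorm (dual_apply (S y)) \<le> K * norm y"
    using cblin_bound[OF S] by (auto simp: norm_cdual.rep_eq)
qed (simp_all add: cblin_add[OF S] cblin_scaleC[OF S] plus_cdual.rep_eq scaleC_cdual.rep_eq)

lemma peripheral_spectrum_trivial_space:
  fixes F :: "'a::complex_banach \<Rightarrow> 'a"
  assumes trivial: "\<And>x::'a. x = 0"
  shows "peripheral_spectrum F = {}"
proof -
  have "z \<notin> spectrum_op F" for z
  proof (rule not_in_spectrumI)
    show "cblin (\<lambda>x::'a. 0::'a)" by simp
  qed (metis trivial)+
  then show ?thesis by (auto simp: peripheral_spectrum_def)
qed

theorem theorem2p1:
  fixes \<A>1 :: "('a::complex_banach \<Rightarrow> 'a) set"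
    and \<A>2 :: "('b::complex_banach \<Rightarrow> 'b) set"
    and \<Phi> :: "('a \<Rightarrow> 'a) \<Rightarrow> ('b \<Rightarrow> 'b)"
    and k :: nat and idx :: "nat list"
  assumes "standard_operator_algebra \<A>1"
    and "standard_operator_algebra \<A>2"
    and "k \<ge> 2"
    and "gen_prod_index k idx"
    and "\<Phi> ` \<A>1 \<subseteq> \<A>2"
    and "\<forall>F \<in> Bop. rank_le (F :: 'b \<Rightarrow> 'b) 2 \<longrightarrow> F \<in> \<Phi> ` \<A>1"
  shows "(\<forall>A. (\<forall>j\<in>{1..k}. A j \<in> \<A>1) \<longrightarrow>
            peripheral_spectrum (gen_prod idx (\<lambda>j. \<Phi> (A j)))
              = peripheral_spectrum (gen_prod idx A))
    \<longleftrightarrow>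
    ((\<exists>c::complex. c ^ length idx = 1 \<and>
        (\<exists>T :: 'a \<Rightarrow> 'b. \<exists>S :: 'b \<Rightarrow> 'a. cblin T \<and> cblin S \<and> T \<circ> S = id \<and> S \<circ> T = id \<and>
           (\<forall>A\<in>\<A>1. \<Phi> A = (\<lambda>y. scaleC c (T (A (S y)))))))
   \<or> (reflexive_space TYPE('a) \<and> reflexive_space TYPE('b) \<and> quasi_semi_jordan idx \<and>
      (\<exists>c::complex. c ^ length idx = 1 \<and>
        (\<exists>T :: ('a \<Rightarrow> complex) \<Rightarrow> 'b. \<exists>S :: 'b \<Rightarrow> ('a \<Rightarrow> complex).
           cblin_from_dual T \<and> cblin_to_dual S \<and>
           (\<forall>y. T (S y) = y) \<and> (\<forall>f\<in>dual_space. S (T f) = f) \<and>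
           (\<forall>A\<in>\<A>1. \<Phi> A = (\<lambda>y. scaleC c (T (adjoint_op A (S y)))))))))"
    (is "?L \<longleftrightarrow> ?R1 \<or> ?R2")
proof
  note alg = assms(1)
  have set_idx: "set idx = {1..k}" using assms(4) by (simp add: gen_prod_index_def)
  obtain p where p: "unique_pos idx p" using assms(4) by (auto simp: gen_prod_index_def)
  have len: "2 \<le> length idx" using card_length[of idx] assms(3) by (simp add: set_idx)
  have cimg: "cblin (\<Phi> A)" if "A \<in> \<A>1" for A
    using that assms(5) standard_algebra_cblin[OF assms(2)] by blast
  {
    assume L: ?L
    have pres: "peripheral_spectrum (gen_prod idx (\<lambda>j. \<Phi> (A j))) = peripheral_spectrum (gen_prod idx A)"
      if "\<And>j. A j \<in> \<A>1" for A using L that by blast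
    have zero_alg: "(\<lambda>x. 0) \<in> \<A>1"
      using standard_algebra_rank1[OF alg cblin_const_zero, of 0] by (simp add: rank1_def)
    show "?R1 \<or> ?R2"
    proof (cases "(\<exists>a::'a. a \<noteq> 0) \<and> (\<exists>b::'b. b \<noteq> 0)")
      case True
      then obtain a0 :: 'a and b0 :: 'b where a0: "a0 \<noteq> 0" and b0: "b0 \<noteq> 0" by blast
      have "peripheral_spectrum (\<Phi> S \<circ> \<Phi> B ^^ (length idx - 1)) = peripheral_spectrum (S \<circ> B ^^ (length idx - 1))"
        if S: "S \<in> \<A>1" and B: "B \<in> \<A>1" for S B
      proof -
        have "(\<lambda>j. \<Phi> (if j = idx ! p then S else B)) = (\<lambda>j. if j = idx ! p then \<Phi> S else \<Phi> B)" by auto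
        then show ?thesis
          using pres[of "\<lambda>j. if j = idx ! p then S else B"] S B
            peripheral_spectrum_gen_prod_two[OF p standard_algebra_cblin[OF alg S] standard_algebra_cblin[OF alg B]]
            peripheral_spectrum_gen_prod_two[OF p cimg[OF S] cimg[OF B]]
          by simp
      qed
      then interpret peripheral_preserver \<A>1 \<Phi> "length idx - 1" a0 b0
        using len assms(6) by unfold_locales (auto simp: alg cimg a0 b0)
      have len1: "length idx - 1 + 1 = length idx" using len by simp
      show ?thesis
      proof (rule preserver_form)
        fix c T T'
        assume "c ^ (length idx - 1 + 1) = 1" "cblin T" "cblin T'" "\<And>x. T' (T x) = x" "\<And>y. T (T' y) = y"
          "\<And>A. A \<in> \<A>1 \<Longrightarrow> \<Phi> A = (\<lambda>y. scaleC c (T (A (T' y))))"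
        then have ?R1 unfolding len1
          by (intro exI[of _ c] conjI exI[of _ T] exI[of _ T']) (auto simp: fun_eq_iff)
        then show ?thesis ..
      next
        fix c and T :: "'a cdual \<Rightarrow> 'b" and T'
        assume c: "c ^ (length idx - 1 + 1) = 1" and T: "cblin T" "cblin T'" "\<And>x. T' (T x) = x" "\<And>y. T (T' y) = y"
          and form: "\<And>A. A \<in> \<A>1 \<Longrightarrow> \<Phi> A = (\<lambda>y. scaleC c (T (cdual_adjoint A (T' y))))"
          and refl: "reflexive_space TYPE('a)" "reflexive_space TYPE('b)"
        note c = c[unfolded len1]
        show ?thesis
        \<comment> \<open>Only two independent vectors give room for the operators that read off
          words; a line is moved to the similarity form instead.\<close>
        proof (cases "\<forall>x. x \<in> cspan {a0}")
          case True
          obtain R and R' :: "'b \<Rightarrow> 'a" where R: "cblin R" "cblin R'" "\<And>x. R' (R x) = x" "\<And>y. R (R' y) = y"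
            "\<And>A y. cblin A \<Longrightarrow> R (A (R' y)) = T (cdual_adjoint A (T' y))"
            using similarity_form_if_one_dimensional[OF a0 _ T] True by metis
          have "\<Phi> A = (\<lambda>y. scaleC c (R (A (R' y))))" if "A \<in> \<A>1" for A
            by (simp add: form[OF that] R(5)[OF algD[OF that]])
          then have ?R1 using c R(1-4)
            by (intro exI[of _ c] conjI exI[of _ R] exI[of _ R']) (auto simp: fun_eq_iff)
          then show ?thesis ..
        next
          case False
          then obtain e where e: "e \<notin> cspan {a0}" by blast
          have "a0 \<notin> cspan {e}"
          proof
            assume "a0 \<in> cspan {e}"
            then obtain a where a: "a0 = scaleC a e" by (auto simp: scaleC.span_singleton)
            then have "e = scaleC (1 / a) a0" using a0 by auto
            then show False using e by (auto simp: scaleC.span_singleton)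
          qed
          from quasi_semi_jordan_if_adjoint_form[OF alg p e this T c form pres]
          have qsj: "quasi_semi_jordan idx" .
          let ?T = "\<lambda>f. T (Abs_cdual f)" and ?S = "\<lambda>y. dual_apply (T' y)"
          have "\<Phi> A = (\<lambda>y. scaleC c (?T (adjoint_op A (?S y))))" if "A \<in> \<A>1" for A
            by (simp add: form[OF that] adjoint_op_eq[OF algD[OF that]] dual_apply_inverse)
          moreover have "\<forall>y. ?T (?S y) = y" by (simp add: dual_apply_inverse T)
          moreover have "\<forall>f\<in>dual_space. ?S (?T f) = f" by (simp add: T)
          ultimately have ?R2
            using c refl qsj cblin_from_dualI[OF T(1)] cblin_to_dualI[OF T(2)] by blast
          then show ?thesis ..
        qed
      qed
    next
      case False
      \<comment> \<open>On a zero domain there is a single operator, hence a single value of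
        \<open>\<Phi>\<close>, whereas the range contains distinct rank-one operators once the
        target is nonzero.\<close>
      have b0: "b = 0" for b :: 'b
      proof (rule ccontr)
        assume b: "b \<noteq> 0"
        with False have a: "x = 0" for x :: 'a by blast
        then have one: "A = B" for A B :: "'a \<Rightarrow> 'a" by (metis ext)
        obtain g :: "'b \<Rightarrow> complex" where g: "cblin g" "g b = 1" using functional_nonzero[OF b] by blast
        have "rank1 v g \<in> \<Phi> ` \<A>1" for v
          by (rule assms(6)[rule_format]) (simp_all add: cblin_rank1[OF g(1)] rank_le_rank1)
        then have "rank1 b g = rank1 0 g" using one by (metis imageE)
        then have "rank1 b g b = rank1 0 g b" by simp
        then show False using g b by (simp add: rank1_apply)
      qed
      \<comment> \<open>On a zero target all peripheral spectra are empty, while the zero operator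
        on a nonzero space has peripheral spectrum \<open>{0}\<close>.\<close>
      have a0: "a = 0" for a :: 'a
      proof (rule ccontr)
        assume a: "a \<noteq> 0"
        have "peripheral_spectrum (gen_prod idx (\<lambda>j. (\<lambda>x::'a. 0))) = {}"
          using pres[of "\<lambda>j x. 0", OF zero_alg] peripheral_spectrum_trivial_space[OF b0] by simp
        moreover have "gen_prod idx (\<lambda>j. (\<lambda>x::'a. 0)) = rank1 0 (\<lambda>x. 0)"
          using len by (cases idx) (auto simp: gen_prod_Cons rank1_def fun_eq_iff)
        ultimately show False using peripheral_spectrum_rank1[OF cblin_const_zero a, of 0] by simp
      qed
      have "(\<lambda>x::'a. 0::'b) \<circ> (\<lambda>y. 0) = id" "(\<lambda>y::'b. 0::'a) \<circ> (\<lambda>x. 0) = id"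
        by (metis ext b0) (metis ext a0)
      moreover have "\<Phi> A = (\<lambda>y. scaleC 1 0)" for A by (metis ext b0)
      ultimately have ?R1
        by (intro exI[of _ 1] conjI exI[of _ "\<lambda>x. 0"]) simp_all
      then show ?thesis ..
    qed
  }
  assume "?R1 \<or> ?R2"
  then show ?L
  proof
    assume ?R1
    then obtain c T S where c: "c ^ length idx = 1" and T: "cblin T" "cblin S" "T \<circ> S = id" "S \<circ> T = id"
      and form: "\<And>A. A \<in> \<A>1 \<Longrightarrow> \<Phi> A = (\<lambda>y. scaleC c (T (A (S y))))" by blast
    have inv: "S (T x) = x" "T (S y) = y" for x y using T(3,4) by (simp_all add: fun_eq_iff)
    show ?L
    proof (intro allI impI)
      fix A assume "\<forall>j\<in>{1..k}. A j \<in> \<A>1"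
      then have A: "A j \<in> \<A>1" if "j \<in> set idx" for j using that by (simp add: set_idx)
      have "gen_prod idx (\<lambda>j. \<Phi> (A j)) = (\<lambda>y. scaleC (c ^ length idx) (T (gen_prod idx A (S y))))"
        by (rule gen_prod_similar[OF T(1,2) inv]) (simp_all add: standard_algebra_cblin[OF alg A] form[OF A])
      then show "peripheral_spectrum (gen_prod idx (\<lambda>j. \<Phi> (A j))) = peripheral_spectrum (gen_prod idx A)"
        using peripheral_spectrum_similar[OF T(1,2) inv(2,1)] by (simp add: c)
    qed
  next
    assume R2: ?R2
    then obtain c T S where c: "c ^ length idx = 1" and T: "cblin_from_dual T" "cblin_to_dual S"
      and inv: "\<forall>y. T (S y) = y" "\<forall>f\<in>dual_space. S (T f) = f"
      and form: "\<forall>A\<in>\<A>1. \<Phi> A = (\<lambda>y. scaleC c (T (adjoint_op A (S y))))" by blast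
    have refl: "reflexive_space TYPE('a)" and qsj: "quasi_semi_jordan idx" using R2 by blast+
    let ?T = "\<lambda>v. T (dual_apply v)" and ?S = "\<lambda>y. Abs_cdual (S y)"
    note cS = cblin_to_dualD[OF T(2)]
    have inv': "?S (?T v) = v" "?T (?S y) = y" for v y
      using inv by (simp_all add: dual_apply_inverse cS(1))
    note TS = cblin_from_dualD[OF T(1)] cS(2) inv'
    have form': "\<Phi> A = (\<lambda>y. scaleC c (?T (cdual_adjoint A (?S y))))" if A: "A \<in> \<A>1" for A
      using form A adjoint_op_eq[OF standard_algebra_cblin[OF alg A], of "Abs_cdual (S _)"] cS(1) by simp
    show ?L
    proof (intro allI impI)
      fix A assume "\<forall>j\<in>{1..k}. A j \<in> \<A>1"
      then have A: "A j \<in> \<A>1" if "j \<in> set idx" for j using that by (simp add: set_idx)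
      note cA = standard_algebra_cblin[OF alg A]
      have cV: "cblin (gen_prod (rev idx) A)" by (rule cblin_gen_prod) (simp add: cA)
      have "gen_prod idx (\<lambda>j. \<Phi> (A j))
          = (\<lambda>y. scaleC (c ^ length idx) (?T (cdual_adjoint (gen_prod (rev idx) A) (?S y))))"
        by (rule gen_prod_adjoint[OF TS]) (rule cA form'[OF A], assumption)+
      then have "peripheral_spectrum (gen_prod idx (\<lambda>j. \<Phi> (A j)))
          = peripheral_spectrum (cdual_adjoint (gen_prod (rev idx) A))"
        using peripheral_spectrum_similar[OF TS(1,2) inv'(2,1)] by (simp add: c)
      also have "\<dots> = peripheral_spectrum (gen_prod (rev idx) A)"
        using spectrum_adjoint[OF refl cV] by (simp add: peripheral_spectrum_def spectral_radius_op_def)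
      also have "\<dots> = peripheral_spectrum (gen_prod idx A)"
        by (rule peripheral_spectrum_rev_if_quasi_semi_jordan[OF qsj cA])
      finally show "peripheral_spectrum (gen_prod idx (\<lambda>j. \<Phi> (A j))) = peripheral_spectrum (gen_prod idx A)" .
    qed
  qed
qed

end
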